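(* Let $s\in\mathbb{N}$, let $A$ be an irreducible and aperiodic $s\times s$ transition matrix with entries in $\{0,1\}$, let $\theta\in(0,1)$, and let $(X,\sigma)$ be either the one-sided subshift of finite type $(\Sigma_A^+,\sigma)$ or the two-sided one $(\Sigma_A,\sigma)$. There exist constants $c,\delta>0$ such that for any Lipschitz function $f$ on $X$ and any $n\in\mathbb{N}$ we have $$\left|\int f\,dm-\int f\,d\mu_{\mathrm{Fix}_n}\right|\le c\,\|f\|_\theta\,e^{-\delta n},$$ where $\mathrm{Fix}_n=\{x\in X:\sigma^n(x)=x\}$.
   Context: $\mathbb{N}=\{1,2,\dots\}$. The matrix $A$ is irreducible if for each pair $(i,j)$ there is $n\ge1$ with $A^n(i,j)>0$; $A$ is called aperiodic if $A(i,i)=1$ for all $i=1,\dots,s$. One-sided subshift: $\Sigma_A^+=\{x=(x_n)_{n\ge0}\in\prod_{n=0}^\infty\{1,\dots,s\}: A(x_n,x_{n+1})=1\ \forall n\ge0\}$ with shift $(\sigma(x))_n=x_{n+1}$ and metric $d_\theta(x,y)=\theta^{t(x,y)}$, $t(x,y)=\max\{n\ge0: x_i=y_i,\ 0\le i<n\}$ (and $d_\theta(x,x)=0$). Two-sided subshift: $\Sigma_A=\{x=(x_n)_{n\in\mathbb{Z}}\in\prod_{n=-\infty}^\infty\{1,\dots,s\}: A(x_n,x_{n+1})=1\ \forall n\in\mathbb{Z}\}$ with the shift $\sigma$ given by the same formula and metric $d_\theta(x,y)=\theta^{t(x,y)}$, $t(x,y)=\max\{n\ge0: x_i=y_i,\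 |i|<n\}$ (and $d_\theta(x,x)=0$). For a continuous function $g$ on $\Sigma_A^+$, $|g|_\theta=\sup_{n\ge0}\{|g(x)-g(y)|/\theta^n: x_i=y_i,\ 0\le i\le n\}$; on $\Sigma_A$ the condition $0\le i\le n$ is replaced by $|i|\le n$. With $|\cdot|_\infty$ the supremum norm, $\|g\|_\theta=|g|_\theta+|g|_\infty$. Lipschitz functions are the continuous functions with $\|f\|_\theta<\infty$. $m$ is the measure of maximal entropy on $X$, i.e. the $\sigma$-invariant probability measure whose metric entropy $h_m(\sigma)$ equals the topological entropy of $\sigma$. For a nonempty finite set $I\subset X$, $\mu_I=\frac1{|I|}\sum_{x\in I}\delta_x$. *)

theory Defs
  imports
    "HOL-Probability.Probability"
    "Jordan_Normal_Form.Matrix"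
begin

section \<open>Transition matrices\<close>

definition transition_matrix :: "nat \<Rightarrow> real mat \<Rightarrow> bool" where
  "transition_matrix s A \<longleftrightarrow>
     A \<in> carrier_mat s s \<and> (\<forall>i<s. \<forall>j<s. A $$ (i, j) \<in> {0, 1})"

definition irreducible_mat :: "real mat \<Rightarrow> bool" where
  "irreducible_mat A \<longleftrightarrow>
     (\<forall>i<dim_row A. \<forall>j<dim_row A. \<exists>n\<ge>1. (A ^\<^sub>m n) $$ (i, j) > 0)"

text \<open>Aperiodicity is taken in the strong sense that every diagonal entry equals 1.\<close>

definition aperiodic_mat :: "real mat \<Rightarrow> bool" where
  "aperiodic_mat A \<longleftrightarrow> (\<forall>i<dim_row A. A $$ (i, i) = 1)"


section \<open>Subshifts of finite type\<close>

text \<open>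
  The symbols are \<open>0, \<dots>, s - 1\<close> rather than \<open>1, \<dots>, s\<close>, matching the indexing of matrices.
  The index type \<open>'i\<close> is \<open>nat\<close> for the one-sided subshift and \<open>int\<close> for the two-sided one.
\<close>

definition subshift :: "real mat \<Rightarrow> ('i::{plus, one} \<Rightarrow> nat) set" where
  "subshift A = {x. \<forall>n. x n < dim_row A \<and> A $$ (x n, x (n + 1)) = 1}"

definition left_shift :: "('i::{plus, one} \<Rightarrow> nat) \<Rightarrow> 'i \<Rightarrow> nat" where
  "left_shift x = (\<lambda>n. x (n + 1))"

text \<open>
  The metric and the norm depend on the index type only through the windows of coordinates
  on which two points are compared: \<open>0 \<le> i < n\<close> in the one-sided case and
  \<open>\<bar>i\<bar> < n\<close> in the two-sided case.
\<close>

definition window1 :: "nat \<Rightarrow> nat set" where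
  "window1 n = {i. i < n}"

definition window2 :: "nat \<Rightarrow> int set" where
  "window2 n = {i. \<bar>i\<bar> < int n}"

definition agree :: "'i set \<Rightarrow> ('i \<Rightarrow> nat) \<Rightarrow> ('i \<Rightarrow> nat) \<Rightarrow> bool" where
  "agree I x y \<longleftrightarrow> (\<forall>i\<in>I. x i = y i)"

definition shift_dist ::
    "(nat \<Rightarrow> 'i set) \<Rightarrow> real \<Rightarrow> ('i \<Rightarrow> nat) \<Rightarrow> ('i \<Rightarrow> nat) \<Rightarrow> real" where
  "shift_dist W \<theta> x y = (if x = y then 0 else \<theta> ^ Max {n. agree (W n) x y})"

lemma finite_agree:
  assumes "mono W" "(\<Union>n. W n) = UNIV" "x \<noteq> y"
  shows "finite {n::nat. agree (W n) x y}"
proof -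
  obtain i where i: "x i \<noteq> y i" using assms(3) by blast
  obtain k where k: "i \<in> W k" using assms(2) by blast
  have "{n. agree (W n) x y} \<subseteq> {..<k}"
  proof
    fix n assume "n \<in> {n. agree (W n) x y}"
    then have "i \<notin> W n" using i by (auto simp: agree_def)
    then show "n \<in> {..<k}" using k monoD[OF assms(1), of k n] by (cases "k \<le> n") auto
  qed
  then show ?thesis using finite_subset by blast
qed

lemma Metric_space_shift_dist:
  assumes W: "mono W" "(\<Union>n. W n) = UNIV" "W 0 = {}" and \<theta>: "0 < \<theta>" "\<theta> < 1"
  shows "Metric_space X (shift_dist W \<theta>)"
proof
  fix x y z :: "'a \<Rightarrow> nat"
  let ?S = "\<lambda>x y. {n. agree (W n) x y}"
  have sym: "?S x y = ?S y x" for x y by (auto simp: agree_def)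
  have ne: "?S x y \<noteq> {}" for x y using W(3) by (auto simp: agree_def intro!: exI[of _ 0])
  show nn: "0 \<le> shift_dist W \<theta> x y" for x y using \<theta> by (simp add: shift_dist_def)
  show "shift_dist W \<theta> x y = shift_dist W \<theta> y x" by (simp add: shift_dist_def sym)
  show "shift_dist W \<theta> x y = 0 \<longleftrightarrow> x = y" using \<theta> by (simp add: shift_dist_def)
  show "shift_dist W \<theta> x z \<le> shift_dist W \<theta> x y + shift_dist W \<theta> y z"
  proof (cases "x = y \<or> y = z \<or> x = z")
    case True
    then show ?thesis using nn[of x y] nn[of y z] by (auto simp: shift_dist_def)
  next
    case False
    define a b where "a = Max (?S x y)" and "b = Max (?S y z)"
    have "agree (W a) x y" "agree (W b) y z"
      using Max_in[OF finite_agree[OF W(1,2)] ne, of x y] Max_in[OF finite_agree[OF W(1,2)] ne, of y z]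
        False by (auto simp: a_def b_def)
    moreover have "W (min a b) \<subseteq> W a" "W (min a b) \<subseteq> W b" using W(1) by (auto simp: mono_def)
    ultimately have "min a b \<in> ?S x z" by (auto simp: agree_def subset_iff)
    then have "min a b \<le> Max (?S x z)" using finite_agree[OF W(1,2)] False by (intro Max_ge) auto
    then have "\<theta> ^ Max (?S x z) \<le> \<theta> ^ min a b" using \<theta> by (intro power_decreasing) auto
    also have "\<dots> \<le> \<theta> ^ a + \<theta> ^ b" using \<theta> by (simp add: min_def)
    finally show ?thesis using False by (simp add: shift_dist_def a_def b_def)
  qed
qed

lemma Metric_space_windows:
  assumes "0 < \<theta>" "\<theta> < 1"
  shows "Metric_space X1 (shift_dist window1 \<theta>)" "Metric_space X2 (shift_dist window2 \<theta>)"
proof -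
  have "i \<in> (\<Union>n. window1 n)" for i by (auto simp: window1_def)
  moreover have "i \<in> (\<Union>n. window2 n)" for i
    by (auto simp: window2_def intro!: exI[of _ "nat (\<bar>i\<bar> + 1)"])
  ultimately show "Metric_space X1 (shift_dist window1 \<theta>)" "Metric_space X2 (shift_dist window2 \<theta>)"
    using assms by (intro Metric_space_shift_dist; auto simp: mono_def window1_def window2_def)+
qed

definition shift_top :: "(nat \<Rightarrow> 'i::{plus, one} set) \<Rightarrow> real \<Rightarrow> real mat \<Rightarrow> ('i \<Rightarrow> nat) topology" where
  "shift_top W \<theta> A = Metric_space.mtopology (subshift A) (shift_dist W \<theta>)"


section \<open>Lipschitz functions\<close>

text \<open>
  In the seminorm, two points are compared on the coordinates \<open>0 \<le> i \<le> n\<close>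
  (respectively \<open>\<bar>i\<bar> \<le> n\<close>), that is, on the window with index \<open>n + 1\<close>.
  Only the values of the function on the subshift matter.
\<close>

definition lip_seminorm ::
    "(nat \<Rightarrow> 'i::{plus, one} set) \<Rightarrow> real \<Rightarrow> real mat \<Rightarrow> (('i \<Rightarrow> nat) \<Rightarrow> complex) \<Rightarrow> ereal" where
  "lip_seminorm W \<theta> A g =
     Sup {ereal (cmod (g x - g y) / \<theta> ^ n) | n x y.
            x \<in> subshift A \<and> y \<in> subshift A \<and> agree (W (n + 1)) x y}"

definition sup_norm_on :: "'a set \<Rightarrow> ('a \<Rightarrow> complex) \<Rightarrow> ereal" where
  "sup_norm_on X g = (SUP x\<in>X. ereal (cmod (g x)))"

definition lip_norm ::
    "(nat \<Rightarrow> 'i::{plus, one} set) \<Rightarrow> real \<Rightarrow> real mat \<Rightarrow> (('i \<Rightarrow> nat) \<Rightarrow> complex) \<Rightarrow> ereal" where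
  "lip_norm W \<theta> A g = lip_seminorm W \<theta> A g + sup_norm_on (subshift A) g"

definition lipschitz_fun ::
    "(nat \<Rightarrow> 'i::{plus, one} set) \<Rightarrow> real \<Rightarrow> real mat \<Rightarrow> (('i \<Rightarrow> nat) \<Rightarrow> complex) \<Rightarrow> bool" where
  "lipschitz_fun W \<theta> A g \<longleftrightarrow>
     continuous_map (shift_top W \<theta> A) euclidean g \<and> lip_norm W \<theta> A g < \<infinity>"


section \<open>Entropy\<close>

text \<open>
  For a partition or cover \<open>P\<close> of \<open>X\<close>, \<open>iterated_join X T P n\<close> is the join of
  \<open>P, T\<^sup>-\<^sup>1 P, \<dots>, T\<^sup>-\<^sup>(\<^sup>n\<^sup>-\<^sup>1\<^sup>) P\<close>, with empty members dropped.
\<close>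

primrec iterated_join :: "'a set \<Rightarrow> ('a \<Rightarrow> 'a) \<Rightarrow> 'a set set \<Rightarrow> nat \<Rightarrow> 'a set set" where
  "iterated_join X T P 0 = {X}"
| "iterated_join X T P (Suc n) =
     {B \<inter> (T -` C \<inter> X) | B C. B \<in> P \<and> C \<in> iterated_join X T P n} - {{}}"

definition partition_entropy :: "'a measure \<Rightarrow> 'a set set \<Rightarrow> real" where
  "partition_entropy M P = - (\<Sum>B\<in>P. measure M B * ln (measure M B))"

text \<open>Kolmogorov--Sinai entropy of a measure-preserving map.\<close>

definition metric_entropy :: "'a measure \<Rightarrow> ('a \<Rightarrow> 'a) \<Rightarrow> ereal" where
  "metric_entropy M T =
     (SUP P\<in>{P. finite P \<and> P \<subseteq> sets M \<and> partition_on (space M) P}.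
        ereal (lim (\<lambda>n. partition_entropy M (iterated_join (space M) T P n) / real n)))"

definition min_subcover_card :: "'a set \<Rightarrow> 'a set set \<Rightarrow> nat" where
  "min_subcover_card X U = (LEAST k. \<exists>V\<subseteq>U. finite V \<and> card V = k \<and> \<Union>V = X)"

text \<open>Topological entropy of a continuous self-map of a compact space, defined by open covers.\<close>

definition topological_entropy :: "'a topology \<Rightarrow> ('a \<Rightarrow> 'a) \<Rightarrow> ereal" where
  "topological_entropy \<tau> T =
     (SUP U\<in>{U. (\<forall>B\<in>U. openin \<tau> B) \<and> \<Union>U = topspace \<tau>}.
        ereal (lim (\<lambda>n.
          ln (real (min_subcover_card (topspace \<tau>) (iterated_join (topspace \<tau>) T U n))) / real n)))"

definition invariant_borel_prob :: "'a topology \<Rightarrow> ('a \<Rightarrow> 'a) \<Rightarrow> 'a measure \<Rightarrow> bool" where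
  "invariant_borel_prob \<tau> T m \<longleftrightarrow>
     prob_space m \<and> sets m = sets (sigma (topspace \<tau>) {U. openin \<tau> U}) \<and>
     T \<in> measurable m m \<and> distr m m T = m"

definition max_entropy_measure :: "'a topology \<Rightarrow> ('a \<Rightarrow> 'a) \<Rightarrow> 'a measure \<Rightarrow> bool" where
  "max_entropy_measure \<tau> T m \<longleftrightarrow>
     invariant_borel_prob \<tau> T m \<and> metric_entropy m T = topological_entropy \<tau> T"


section \<open>Periodic points\<close>

definition Fix :: "real mat \<Rightarrow> nat \<Rightarrow> ('i::{plus, one} \<Rightarrow> nat) set" where
  "Fix A n = {x \<in> subshift A. (left_shift ^^ n) x = x}"

text \<open>\<open>(1 / |I|) \<Sum>\<^bsub>x \<in> I\<^esub> \<delta>\<^sub>x\<close> for a nonempty finite set \<open>I\<close>, as a measure on all subsets.\<close>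

abbreviation equidist :: "'a set \<Rightarrow> 'a measure" where
  "equidist I \<equiv> measure_pmf (pmf_of_set I)"

end

(* A measure m of maximal entropy is identified by a finitary form of Parry's argument. The entropies
   H(n) of the partitions into n-cylinders form a concave sequence, and approximating measurable
   partitions by cylinder sets shows that h(m) is at most the limit of H(n) / n, while the topological
   entropy is at least ln l, where l is the Perron eigenvalue of A with right eigenvector r. Hence
   H(n+1) - H(n) >= ln l for all n. The Gibbs inequality against the kernel
   P(i,j) = A(i,j) r(j) / (l r(i)) gives the reverse bound, and its equality case says that m is the
   Markov measure of P.

   On the other hand, the number of points of Fix_n starting with a word w is l^n times the product of
   the P-transition probabilities along w, times the probability that P returns from the last to the
   first letter of w in the remaining steps. Since powers of P converge exponentially fast
   (Doeblin), the laws of the words of length about n/2 under m and under the uniform measure on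
   Fix_n are exponentially close in total variation, and a Lipschitz function is exponentially
   close to a function of such a word. *)
theory Submission
  imports Defs "HOL-Real_Asymp.Real_Asymp"
begin

section \<open>Entropy of simple functions\<close>

text \<open>The obstacle is that \<open>m\<close> is known only through a supremum over all
  partitions; nothing says in advance that it is Markov, ergodic or unique. Concavity overcomes
  this: a lower bound on the limit rate becomes a lower bound on every single increment of block
  entropy, so the equality case of Gibbs applies at each finite length and yields exact cylinder
  masses.

  The vector \<open>r\<close> is useful because the ratios \<open>r j / r i\<close> telescope along
  a word. For a closed word they cancel completely, so all closed words with \<open>n\<close>
  transitions have the same weight \<open>l ^ (- n)\<close>; counting periodic points thus becomes
  computing return probabilities.

  The unit diagonal of \<open>A\<close> is used in three ways: entries of powers of \<open>A\<close>
  never decrease, every admissible word extends to a point by repeating its end letters, and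
  constant sequences are points of each \<open>Fix A n\<close>.

  Word length is a compromise: long words make a Lipschitz function nearly a function of the word,
  but the steps that remain until time \<open>n\<close> must suffice for mixing. With words of
  length \<open>2 * (n div 4) + 1\<close> both errors are exponentially small.\<close>

lemma mult_ln_ratio_ge:
  fixes p q :: real
  assumes "0 \<le> p" "0 \<le> q" "0 < p \<Longrightarrow> 0 < q"
  shows "p - q \<le> p * ln (p / q)"
proof (cases "p = 0")
  case False
  then have "p > 0" "q > 0" using assms by auto
  then have "ln (q / p) \<le> q / p - 1" by (intro ln_le_minus_one) auto
  then have "p * ln (q / p) \<le> p * (q / p - 1)" using \<open>p > 0\<close> by (intro mult_left_mono) auto
  also have "\<dots> = q - p" using \<open>p > 0\<close> by (simp add: field_simps)
  finally show ?thesis using \<open>p > 0\<close> \<open>q > 0\<close> by (simp add: ln_div algebra_simps)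
qed (use assms in auto)

text \<open>The tangent-line bound \<open>p - q \<le> p * ln (p / q)\<close>, summed. The total mass
  of \<open>q\<close> may be smaller than that of \<open>p\<close>, which admits subprobability
  kernels as in \<open>ent_Pair_approx\<close>.\<close>

lemma gibbs_inequality:
  fixes p q :: "'a \<Rightarrow> real"
  assumes "\<And>x. x \<in> S \<Longrightarrow> 0 \<le> p x" "\<And>x. x \<in> S \<Longrightarrow> 0 \<le> q x"
    and "\<And>x. x \<in> S \<Longrightarrow> 0 < p x \<Longrightarrow> 0 < q x" and "sum q S \<le> sum p S"
  shows "0 \<le> (\<Sum>x\<in>S. p x * ln (p x / q x))"
proof -
  have "sum p S - sum q S \<le> (\<Sum>x\<in>S. p x * ln (p x / q x))"
    unfolding sum_subtractf[symmetric] by (intro sum_mono mult_ln_ratio_ge assms)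
  then show ?thesis using assms(4) by linarith
qed

text \<open>The excess of each term over its tangent-line bound is nonnegative and the excesses add
  up to at most 0, so all of them vanish; and \<open>ln t = t - 1\<close> only at
  \<open>t = 1\<close>.\<close>

lemma gibbs_equality:
  fixes p q :: "'a \<Rightarrow> real"
  assumes "finite S" and pq: "\<And>x. x \<in> S \<Longrightarrow> 0 \<le> p x" "\<And>x. x \<in> S \<Longrightarrow> 0 \<le> q x"
    "\<And>x. x \<in> S \<Longrightarrow> 0 < p x \<Longrightarrow> 0 < q x" and "sum q S \<le> sum p S"
    and "(\<Sum>x\<in>S. p x * ln (p x / q x)) \<le> 0" and x: "x \<in> S"
  shows "p x = q x"
proof -
  let ?t = "\<lambda>x. p x * ln (p x / q x) - (p x - q x)"
  have nn: "0 \<le> ?t x" if "x \<in> S" for x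
    using mult_ln_ratio_ge[OF pq[OF that]] by simp
  have "sum ?t S \<le> 0" using assms(5,6) by (simp add: sum_subtractf)
  then have "sum ?t S = 0" using sum_nonneg[of S ?t] nn by (meson order_antisym)
  then have t: "?t x = 0" using sum_nonneg_eq_0_iff[OF \<open>finite S\<close>, of ?t] nn x by blast
  show ?thesis
  proof (cases "p x = 0")
    case False
    then have pos: "p x > 0" "q x > 0" using pq[OF x] by auto
    then have "p x * ln (q x / p x) = q x - p x" using t by (simp add: ln_div algebra_simps)
    then have "ln (q x / p x) = q x / p x - 1" using pos by (simp add: field_simps)
    then have "q x / p x = 1" using ln_eq_minus_one[of "q x / p x"] pos by simp
    then show ?thesis using pos by simp
  qed (use t in auto)
qed

text \<open>Partitions are handled through functions that have them as level sets: a join becomes a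
  pair and an iterated join an itinerary. Only attained values are taken, so there are no empty
  cells, in agreement with \<open>iterated_join\<close>.\<close>

definition fibers :: "'a set \<Rightarrow> ('a \<Rightarrow> 'b) \<Rightarrow> 'a set set" where
  "fibers X F = (\<lambda>v. F -` {v} \<inter> X) ` F ` X"

definition ent :: "'a measure \<Rightarrow> ('a \<Rightarrow> 'b) \<Rightarrow> real" where
  "ent M F = partition_entropy M (fibers (space M) F)"

definition mass :: "'a measure \<Rightarrow> ('a \<Rightarrow> 'b) \<Rightarrow> 'b \<Rightarrow> real" where
  "mass M F v = measure M (F -` {v} \<inter> space M)"

lemma mass_nonneg [simp]: "0 \<le> mass M F v"
  by (simp add: mass_def)

lemma mass_outside: "v \<notin> F ` space M \<Longrightarrow> mass M F v = 0"
proof -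
  assume "v \<notin> F ` space M"
  then have "F -` {v} \<inter> space M = {}" by auto
  then show ?thesis by (simp add: mass_def)
qed

lemma fibers_cong:
  assumes "\<And>x y. x \<in> X \<Longrightarrow> y \<in> X \<Longrightarrow> F x = F y \<longleftrightarrow> G x = G y"
  shows "fibers X F = fibers X G"
proof -
  have "F -` {F x} \<inter> X = G -` {G x} \<inter> X" if "x \<in> X" for x using assms that by auto
  then show ?thesis unfolding fibers_def image_image by (intro image_cong) auto
qed

lemma ent_cong:
  assumes "\<And>x y. x \<in> space M \<Longrightarrow> y \<in> space M \<Longrightarrow> F x = F y \<longleftrightarrow> G x = G y"
  shows "ent M F = ent M G"
  unfolding ent_def by (subst fibers_cong[OF assms]) auto

text \<open>Values that are not attained have mass 0 and contribute 0, so the sum may run over any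
  convenient finite set, such as a product of ranges.\<close>

lemma ent_eq_sum:
  assumes "finite S" "F ` space M \<subseteq> S"
  shows "ent M F = - (\<Sum>v\<in>S. mass M F v * ln (mass M F v))"
proof -
  have inj: "inj_on (\<lambda>v. F -` {v} \<inter> space M) (F ` space M)" by (auto simp: inj_on_def)
  have "ent M F = - (\<Sum>v\<in>F ` space M. mass M F v * ln (mass M F v))"
    unfolding ent_def partition_entropy_def fibers_def by (subst sum.reindex[OF inj]) (simp add: mass_def)
  also have "(\<Sum>v\<in>F ` space M. mass M F v * ln (mass M F v)) = (\<Sum>v\<in>S. mass M F v * ln (mass M F v))"
    using assms by (intro sum.mono_neutral_left) (auto simp: mass_outside)
  finally show ?thesis .
qed

context prob_space
begin

lemma mass_le_1: "mass M F v \<le> 1"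
  by (simp add: mass_def)

lemma mass_marginal_snd:
  assumes F: "simple_function M F" and G: "simple_function M G"
    and S: "finite S" "G ` space M \<subseteq> S"
  shows "mass M F u = (\<Sum>v\<in>S. mass M (\<lambda>x. (F x, G x)) (u, v))"
proof -
  have "mass M F u = measure M (\<Union>v\<in>S. (\<lambda>x. (F x, G x)) -` {(u, v)} \<inter> space M)"
    unfolding mass_def using S by (intro arg_cong[where f = "measure M"]) auto
  also have "\<dots> = (\<Sum>v\<in>S. mass M (\<lambda>x. (F x, G x)) (u, v))"
    unfolding mass_def using S F G
    by (intro finite_measure_finite_Union)
      (auto simp: disjoint_family_on_def intro!: simple_functionD(2))
  finally show ?thesis .
qed

lemma mass_marginal_fst:
  assumes "simple_function M F" "simple_function M G" "finite S" "F ` space M \<subseteq> S"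
  shows "mass M G v = (\<Sum>u\<in>S. mass M (\<lambda>x. (F x, G x)) (u, v))"
proof -
  have "mass M (\<lambda>x. (F x, G x)) (u, v) = mass M (\<lambda>x. (G x, F x)) (v, u)" for u
    by (auto simp: mass_def intro!: arg_cong[where f = "measure M"])
  then show ?thesis using mass_marginal_snd[OF assms(2,1,3,4)] by simp
qed

lemma sum_mass:
  assumes "simple_function M F" "finite S" "F ` space M \<subseteq> S"
  shows "(\<Sum>v\<in>S. mass M F v) = 1"
proof -
  have "(\<Sum>v\<in>S. mass M F v) = (\<Sum>v\<in>S. mass M (\<lambda>x. ((), F x)) ((), v))"
    by (intro sum.cong) (auto simp: mass_def intro!: arg_cong[where f = "measure M"])
  also have "\<dots> = mass M (\<lambda>x. ()) ()"
    using assms by (intro mass_marginal_snd[symmetric]) auto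
  also have "\<dots> = 1" by (simp add: mass_def prob_space)
  finally show ?thesis .
qed

lemma ent_le_ent_Pair:
  assumes F: "simple_function M F" and G: "simple_function M G"
  shows "ent M F \<le> ent M (\<lambda>x. (F x, G x))"
proof -
  let ?U = "F ` space M" and ?V = "G ` space M"
  let ?p = "\<lambda>u v. mass M (\<lambda>x. (F x, G x)) (u, v)"
  have fin: "finite ?U" "finite ?V" using F G by (auto dest: simple_functionD)
  have marg: "mass M F u = (\<Sum>v\<in>?V. ?p u v)" for u
    using mass_marginal_snd[OF F G fin(2)] by simp
  have term_le: "?p u v * ln (?p u v) \<le> ?p u v * ln (mass M F u)" if "v \<in> ?V" for u v
  proof (cases "?p u v = 0")
    case False
    then have "0 < ?p u v" using mass_nonneg[of M "\<lambda>x. (F x, G x)" "(u, v)"] by linarith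
    moreover have "?p u v \<le> mass M F u" unfolding marg using that fin by (intro member_le_sum) auto
    ultimately show ?thesis by (intro mult_left_mono) auto
  qed auto
  have "ent M F = - (\<Sum>u\<in>?U. mass M F u * ln (mass M F u))" using fin by (intro ent_eq_sum) auto
  also have "\<dots> = - (\<Sum>u\<in>?U. \<Sum>v\<in>?V. ?p u v * ln (mass M F u))"
    unfolding sum_distrib_right[symmetric] marg[symmetric] ..
  also have "\<dots> \<le> - (\<Sum>u\<in>?U. \<Sum>v\<in>?V. ?p u v * ln (?p u v))"
    unfolding neg_le_iff_le by (intro sum_mono term_le)
  also have "\<dots> = - (\<Sum>z\<in>?U \<times> ?V. mass M (\<lambda>x. (F x, G x)) z * ln (mass M (\<lambda>x. (F x, G x)) z))"
    by (simp add: sum.cartesian_product case_prod_beta)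
  also have "\<dots> = ent M (\<lambda>x. (F x, G x))" using fin by (intro ent_eq_sum[symmetric]) auto
  finally show ?thesis .
qed

text \<open>If \<open>G\<close> determines \<open>F\<close>, then pairing \<open>F\<close> with
  \<open>G\<close> gives the same cells as \<open>G\<close> alone.\<close>

lemma ent_mono:
  assumes F: "simple_function M F" and G: "simple_function M G"
    and det: "\<And>x y. x \<in> space M \<Longrightarrow> y \<in> space M \<Longrightarrow> G x = G y \<Longrightarrow> F x = F y"
  shows "ent M F \<le> ent M G"
proof -
  have "ent M (\<lambda>x. (F x, G x)) = ent M G" by (intro ent_cong) (metis det prod.inject)
  then show ?thesis using ent_le_ent_Pair[OF F G] by simp
qed

lemma ent_nonneg: "simple_function M F \<Longrightarrow> 0 \<le> ent M F"
proof -
  assume "simple_function M F"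
  then have fin: "finite (F ` space M)" by (auto dest: simple_functionD)
  have "mass M F v * ln (mass M F v) \<le> 0" for v
    using mass_le_1[of F v] mass_nonneg[of M F v]
    by (cases "mass M F v = 0") (auto intro!: mult_nonneg_nonpos simp: ln_le_zero_iff less_le)
  then show ?thesis by (subst ent_eq_sum[OF fin order_refl]) (auto intro!: sum_nonpos)
qed

lemma ent_const: "ent M (\<lambda>x. c) = 0"
  by (subst ent_eq_sum[of "{c}"]) (auto simp: mass_def prob_space)

text \<open>Nonnegativity of the conditional mutual information of \<open>a\<close> and
  \<open>c\<close> given \<open>b\<close>. The Gibbs inequality compares the joint law with
  \<open>?Q\<close>, the law with the same \<open>(a, b)\<close> and \<open>(b, c)\<close> marginals
  under which \<open>a\<close> and \<open>c\<close> are independent given \<open>b\<close>.\<close>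

lemma ent_strong_subadditive:
  assumes a: "simple_function M a" and b: "simple_function M b" and c: "simple_function M c"
  shows "ent M (\<lambda>x. (a x, b x, c x)) + ent M b \<le> ent M (\<lambda>x. (a x, b x)) + ent M (\<lambda>x. (b x, c x))"
proof -
  let ?U = "a ` space M" and ?V = "b ` space M" and ?W = "c ` space M"
  have fin: "finite ?U" "finite ?V" "finite ?W" using a b c by (auto dest: simple_functionD)
  let ?p = "\<lambda>u v w. mass M (\<lambda>x. (a x, b x, c x)) (u, v, w)"
  let ?ab = "\<lambda>u v. mass M (\<lambda>x. (a x, b x)) (u, v)"
  let ?bc = "\<lambda>v w. mass M (\<lambda>x. (b x, c x)) (v, w)"
  let ?b = "\<lambda>v. mass M b v"
  let ?S = "?U \<times> ?V \<times> ?W"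
  have ab: "?ab u v = (\<Sum>w\<in>?W. ?p u v w)" for u v
  proof -
    have "?ab u v = (\<Sum>w\<in>?W. mass M (\<lambda>x. ((a x, b x), c x)) ((u, v), w))"
      using a b c fin by (intro mass_marginal_snd) auto
    then show ?thesis by (auto simp: mass_def intro!: sum.cong arg_cong[where f = "measure M"])
  qed
  have bc: "?bc v w = (\<Sum>u\<in>?U. ?p u v w)" for v w
    using a b c fin by (intro mass_marginal_fst) auto
  have b_ab: "?b v = (\<Sum>u\<in>?U. ?ab u v)" for v
    using a b fin by (intro mass_marginal_fst) auto
  have b_bc: "?b v = (\<Sum>w\<in>?W. ?bc v w)" for v
    using b c fin by (intro mass_marginal_snd) auto
  have le1: "?p u v w \<le> ?ab u v" if "w \<in> ?W" for u v w
    unfolding ab using fin that by (intro member_le_sum) auto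
  have le2: "?p u v w \<le> ?bc v w" if "u \<in> ?U" for u v w
    unfolding bc using fin that by (intro member_le_sum) auto
  have le3: "?ab u v \<le> ?b v" if "u \<in> ?U" for u v
    unfolding b_ab using fin that by (intro member_le_sum) auto
  let ?P = "\<lambda>(u, v, w). ?p u v w" and ?Q = "\<lambda>(u, v, w). ?ab u v * ?bc v w / ?b v"
  have nz: "0 < ?ab u v \<and> 0 < ?bc v w \<and> 0 < ?b v" if "(u, v, w) \<in> ?S" "0 < ?p u v w" for u v w
    using le1[of w u v] le2[of u v w] le3[of u v] that by auto
  have sumQ: "sum ?Q ?S = (\<Sum>v\<in>?V. \<Sum>u\<in>?U. \<Sum>w\<in>?W. ?ab u v * ?bc v w / ?b v)"
    by (subst sum.swap) (simp add: sum.cartesian_product)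
  also have "\<dots> = (\<Sum>v\<in>?V. (\<Sum>u\<in>?U. ?ab u v) * (\<Sum>w\<in>?W. ?bc v w) / ?b v)"
    by (simp add: sum_product sum_divide_distrib)
  also have "\<dots> = (\<Sum>v\<in>?V. ?b v)" by (simp add: b_ab[symmetric] b_bc[symmetric])
  also have "\<dots> = 1" using b fin by (intro sum_mass) auto
  finally have sumQ1: "sum ?Q ?S = 1" .
  have "sum ?P ?S = (\<Sum>z\<in>?S. mass M (\<lambda>x. (a x, b x, c x)) z)" by (intro sum.cong) auto
  also have "\<dots> = 1" using a b c fin by (intro sum_mass) auto
  finally have sumP1: "sum ?P ?S = 1" .
  have "0 \<le> (\<Sum>z\<in>?S. ?P z * ln (?P z / ?Q z))"
  proof (rule gibbs_inequality)
    show "0 < ?Q x" if "x \<in> ?S" "0 < ?P x" for x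
    proof -
      obtain u v w where x: "x = (u, v, w)" by (cases x)
      show ?thesis using nz[of u v w] that unfolding x by simp
    qed
  qed (use sumQ1 sumP1 in auto)
  also have "\<dots> = (\<Sum>z\<in>?S. (\<lambda>(u, v, w). ?p u v w * ln (?p u v w) + ?p u v w * ln (?b v)
      - ?p u v w * ln (?ab u v) - ?p u v w * ln (?bc v w)) z)"
  proof (rule sum.cong[OF refl])
    fix z assume z: "z \<in> ?S"
    obtain u v w where zz: "z = (u, v, w)" by (cases z)
    show "?P z * ln (?P z / ?Q z) = (\<lambda>(u, v, w). ?p u v w * ln (?p u v w) + ?p u v w * ln (?b v)
      - ?p u v w * ln (?ab u v) - ?p u v w * ln (?bc v w)) z"
    proof (cases "?p u v w = 0")
      case False
      then have "0 < ?p u v w" using mass_nonneg[of M "\<lambda>x. (a x, b x, c x)" "(u, v, w)"] by linarith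
      then show ?thesis using nz[of u v w] z unfolding zz
        by (simp add: ln_div ln_mult algebra_simps)
    qed (simp add: zz)
  qed
  also have "\<dots> = (\<Sum>u\<in>?U. \<Sum>v\<in>?V. \<Sum>w\<in>?W. ?p u v w * ln (?p u v w))
     + (\<Sum>u\<in>?U. \<Sum>v\<in>?V. \<Sum>w\<in>?W. ?p u v w * ln (?b v))
     - (\<Sum>u\<in>?U. \<Sum>v\<in>?V. \<Sum>w\<in>?W. ?p u v w * ln (?ab u v))
     - (\<Sum>u\<in>?U. \<Sum>v\<in>?V. \<Sum>w\<in>?W. ?p u v w * ln (?bc v w))"
    by (simp add: sum.cartesian_product[symmetric] sum.distrib sum_subtractf)
  also have "(\<Sum>u\<in>?U. \<Sum>v\<in>?V. \<Sum>w\<in>?W. ?p u v w * ln (?p u v w)) = - ent M (\<lambda>x. (a x, b x, c x))"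
    using fin by (subst ent_eq_sum[of ?S]) (auto simp: sum.cartesian_product case_prod_beta)
  also have "(\<Sum>u\<in>?U. \<Sum>v\<in>?V. \<Sum>w\<in>?W. ?p u v w * ln (?ab u v)) = (\<Sum>u\<in>?U. \<Sum>v\<in>?V. ?ab u v * ln (?ab u v))"
    by (simp add: ab sum_distrib_right)
  also have "\<dots> = - ent M (\<lambda>x. (a x, b x))"
    using fin by (subst ent_eq_sum[of "?U \<times> ?V"]) (auto simp: sum.cartesian_product case_prod_beta)
  also have "(\<Sum>u\<in>?U. \<Sum>v\<in>?V. \<Sum>w\<in>?W. ?p u v w * ln (?b v))
      = (\<Sum>v\<in>?V. \<Sum>u\<in>?U. \<Sum>w\<in>?W. ?p u v w * ln (?b v))" by (rule sum.swap)
  also have "\<dots> = (\<Sum>v\<in>?V. ?b v * ln (?b v))" by (simp add: b_ab ab sum_distrib_right)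
  also have "\<dots> = - ent M b" using fin by (subst ent_eq_sum[of ?V]) auto
  also have "(\<Sum>u\<in>?U. \<Sum>v\<in>?V. \<Sum>w\<in>?W. ?p u v w * ln (?bc v w))
      = (\<Sum>v\<in>?V. \<Sum>w\<in>?W. \<Sum>u\<in>?U. ?p u v w * ln (?bc v w))"
    by (subst sum.swap) (intro sum.cong refl sum.swap)
  also have "\<dots> = (\<Sum>v\<in>?V. \<Sum>w\<in>?W. ?bc v w * ln (?bc v w))" by (simp add: bc sum_distrib_right)
  also have "\<dots> = - ent M (\<lambda>x. (b x, c x))"
    using fin by (subst ent_eq_sum[of "?V \<times> ?W"]) (auto simp: sum.cartesian_product case_prod_beta)
  finally show ?thesis by linarith
qed

text \<open>A form of Fano's inequality: if \<open>F\<close> is guessed correctly from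
  \<open>G\<close> with high probability, then its conditional entropy given \<open>G\<close> is
  small. The bound does not involve the number of values of \<open>G\<close>, so \<open>G\<close>
  may be an arbitrarily long word.\<close>

lemma ent_Pair_approx:
  assumes F: "simple_function M F" and G: "simple_function M G"
    and S: "finite S" "F ` space M \<subseteq> S" and e: "0 < e" "e < 1"
  shows "ent M (\<lambda>x. (F x, G x)) - ent M G
    \<le> - ln (1 - e) + measure M {x \<in> space M. F x \<noteq> g (G x)} * (ln (real (card S)) - ln e)"
proof -
  let ?V = "G ` space M"
  let ?p = "\<lambda>u v. mass M (\<lambda>x. (F x, G x)) (u, v)"
  \<comment> \<open>The guessing kernel: mass \<open>1 - e\<close> on the guess, and
    \<open>e / card S\<close> on every other value. The guess gives up its share of
    \<open>e\<close>, and it may lie outside \<open>S\<close>, so the total is only at most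
    1.\<close>
  define k where "k = (\<lambda>u v. if u = g v then 1 - e else e / real (card S))"
  have fin: "finite ?V" using G by (auto dest: simple_functionD)
  have "S \<noteq> {}" using S not_empty by auto
  then have card: "0 < card S" using S by (simp add: card_gt_0_iff)
  have kpos: "0 < k u v" for u v using e card by (simp add: k_def)
  have marg: "mass M G v = (\<Sum>u\<in>S. ?p u v)" for v using F G S by (intro mass_marginal_fst) auto
  have sumk: "(\<Sum>u\<in>S. k u v) \<le> 1" for v
  proof -
    have "(\<Sum>u\<in>S. k u v) \<le> (\<Sum>u\<in>S. (if u = g v then 1 - e else 0) + e / real (card S))"
      unfolding k_def using e card by (intro sum_mono) auto
    also have "\<dots> \<le> 1" using S card e by (simp add: sum.distrib sum.delta)
    finally show ?thesis .
  qed
  let ?P = "\<lambda>(u, v). ?p u v" and ?Q = "\<lambda>(u, v). mass M G v * k u v"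
  have sumP: "sum ?P (S \<times> ?V) = 1"
  proof -
    have "sum ?P (S \<times> ?V) = (\<Sum>z\<in>S \<times> ?V. mass M (\<lambda>x. (F x, G x)) z)" by (intro sum.cong) auto
    also have "\<dots> = 1" using F G fin S by (intro sum_mass) auto
    finally show ?thesis .
  qed
  have "sum ?Q (S \<times> ?V) = (\<Sum>v\<in>?V. mass M G v * (\<Sum>u\<in>S. k u v))"
    by (simp add: sum.cartesian_product[symmetric] sum_distrib_left sum.swap[of _ S])
  also have "\<dots> \<le> (\<Sum>v\<in>?V. mass M G v * 1)" by (intro sum_mono mult_left_mono sumk) auto
  also have "\<dots> = 1" using sum_mass[OF G fin] by simp
  finally have sumQ: "sum ?Q (S \<times> ?V) \<le> 1" .
  have Gpos: "0 < mass M G v" if "0 < ?p u v" "u \<in> S" for u v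
    using member_le_sum[of u S "\<lambda>u. ?p u v"] that S by (simp add: marg)
  have "0 \<le> (\<Sum>z\<in>S \<times> ?V. ?P z * ln (?P z / ?Q z))"
  proof (rule gibbs_inequality)
    show "0 \<le> ?Q x" for x using kpos by (auto simp: case_prod_beta less_imp_le)
    show "0 < ?Q x" if "x \<in> S \<times> ?V" "0 < ?P x" for x
      using Gpos kpos that by (auto intro!: mult_pos_pos)
  qed (use sumP sumQ in auto)
  also have "\<dots> = (\<Sum>u\<in>S. \<Sum>v\<in>?V. ?p u v * ln (?p u v / (mass M G v * k u v)))"
    by (simp add: sum.cartesian_product case_prod_beta)
  also have "\<dots> = (\<Sum>u\<in>S. \<Sum>v\<in>?V. ?p u v * ln (?p u v) - ?p u v * ln (mass M G v) - ?p u v * ln (k u v))"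
  proof (intro sum.cong refl)
    fix u v assume "u \<in> S" "v \<in> ?V"
    show "?p u v * ln (?p u v / (mass M G v * k u v))
      = ?p u v * ln (?p u v) - ?p u v * ln (mass M G v) - ?p u v * ln (k u v)"
    proof (cases "?p u v = 0")
      case False
      then have "0 < ?p u v" using mass_nonneg[of M "\<lambda>x. (F x, G x)" "(u, v)"] by linarith
      then show ?thesis using Gpos[of u v] kpos[of u v] \<open>u \<in> S\<close>
        by (simp add: ln_div ln_mult algebra_simps)
    qed auto
  qed
  also have "\<dots> = (\<Sum>u\<in>S. \<Sum>v\<in>?V. ?p u v * ln (?p u v)) - (\<Sum>u\<in>S. \<Sum>v\<in>?V. ?p u v * ln (mass M G v))
     - (\<Sum>u\<in>S. \<Sum>v\<in>?V. ?p u v * ln (k u v))"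
    by (simp add: sum_subtractf)
  also have "(\<Sum>u\<in>S. \<Sum>v\<in>?V. ?p u v * ln (?p u v)) = - ent M (\<lambda>x. (F x, G x))"
    using fin S by (subst ent_eq_sum[of "S \<times> ?V"]) (auto simp: sum.cartesian_product case_prod_beta)
  also have "(\<Sum>u\<in>S. \<Sum>v\<in>?V. ?p u v * ln (mass M G v)) = (\<Sum>v\<in>?V. mass M G v * ln (mass M G v))"
    by (subst sum.swap) (simp add: marg sum_distrib_right)
  also have "\<dots> = - ent M G" using fin by (subst ent_eq_sum[of ?V]) auto
  finally have main: "ent M (\<lambda>x. (F x, G x)) - ent M G \<le> - (\<Sum>u\<in>S. \<Sum>v\<in>?V. ?p u v * ln (k u v))"
    by linarith
  have "- (\<Sum>u\<in>S. \<Sum>v\<in>?V. ?p u v * ln (k u v)) =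
      (\<Sum>u\<in>S. \<Sum>v\<in>?V. ?p u v * (if u = g v then - ln (1 - e) else ln (real (card S)) - ln e))"
    unfolding sum_negf[symmetric] k_def using e card
    by (intro sum.cong refl) (auto simp: ln_div algebra_simps)
  also have "\<dots> \<le> (\<Sum>u\<in>S. \<Sum>v\<in>?V. ?p u v * (- ln (1 - e)) +
      (if u = g v then 0 else ?p u v) * (ln (real (card S)) - ln e))"
    using e by (intro sum_mono) (auto intro!: mult_nonneg_nonpos)
  also have "\<dots> = (\<Sum>u\<in>S. \<Sum>v\<in>?V. ?p u v) * (- ln (1 - e))
      + (\<Sum>u\<in>S. \<Sum>v\<in>?V. (if u = g v then 0 else ?p u v)) * (ln (real (card S)) - ln e)"
    by (simp only: sum.distrib sum_distrib_right)
  also have "(\<Sum>u\<in>S. \<Sum>v\<in>?V. ?p u v) = 1" using sumP by (simp add: sum.cartesian_product)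
  also have "(\<Sum>u\<in>S. \<Sum>v\<in>?V. (if u = g v then 0 else ?p u v)) =
      (\<Sum>z\<in>{z \<in> S \<times> ?V. fst z \<noteq> g (snd z)}. mass M (\<lambda>x. (F x, G x)) z)"
    unfolding sum.cartesian_product using fin S
    by (intro sum.mono_neutral_cong_right) (auto split: if_splits)
  also have "\<dots> = measure M (\<Union>z\<in>{z \<in> S \<times> ?V. fst z \<noteq> g (snd z)}. (\<lambda>x. (F x, G x)) -` {z} \<inter> space M)"
    unfolding mass_def using fin S F G
    by (intro finite_measure_finite_Union[symmetric])
      (auto simp: disjoint_family_on_def intro!: simple_functionD(2))
  also have "(\<Union>z\<in>{z \<in> S \<times> ?V. fst z \<noteq> g (snd z)}. (\<lambda>x. (F x, G x)) -` {z} \<inter> space M)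
      = {x \<in> space M. F x \<noteq> g (G x)}" using S by auto
  finally show ?thesis using main by simp
qed

end

section \<open>Entropy of measure-preserving maps\<close>

primrec itin :: "('a \<Rightarrow> 'a) \<Rightarrow> ('a \<Rightarrow> 'b) \<Rightarrow> nat \<Rightarrow> 'a \<Rightarrow> 'b list" where
  "itin T F 0 x = []"
| "itin T F (Suc n) x = F x # itin T F n (T x)"

lemma itin_zero: "itin T F 0 = (\<lambda>x. [])"
  by auto

lemma length_itin [simp]: "length (itin T F n x) = n"
  by (induction n arbitrary: x) auto

lemma nth_itin: "i < n \<Longrightarrow> itin T F n x ! i = F ((T ^^ i) x)"
proof (induction n arbitrary: i x)
  case (Suc n)
  then show ?case by (cases i) (auto simp: funpow_swap1)
qed simp

lemma itin_eq_iff: "itin T F n x = itin T F n y \<longleftrightarrow> (\<forall>i<n. F ((T ^^ i) x) = F ((T ^^ i) y))"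
  by (auto simp: list_eq_iff_nth_eq nth_itin)

lemma itin_add: "itin T F (n + m) x = itin T F n x @ itin T F m ((T ^^ n) x)"
  by (rule nth_equalityI) (auto simp: nth_itin nth_append funpow_add[symmetric]
      funpow_add[unfolded o_def, THEN fun_cong, symmetric])

text \<open>Serves both entropies: partitions for \<open>metric_entropy\<close> and the cover by
  cylinders for \<open>topological_entropy\<close>. Nonemptiness matters at \<open>n = 0\<close>,
  where the join is \<open>{X}\<close>.\<close>

lemma fibers_itin:
  assumes T: "T \<in> X \<rightarrow> X" and X: "X \<noteq> {}"
  shows "iterated_join X T (fibers X F) n = fibers X (itin T F n)"
proof (induction n)
  case 0
  then show ?case using X by (auto simp: fibers_def)
next
  case (Suc n)
  have *: "F -` {v} \<inter> X \<inter> (T -` (itin T F n -` {u} \<inter> X) \<inter> X) = itin T F (Suc n) -` {v # u} \<inter> X" for u v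
    using T by auto
  show ?case
  proof (intro equalityI subsetI)
    fix D assume "D \<in> iterated_join X T (fibers X F) (Suc n)"
    then obtain u v where "D = F -` {v} \<inter> X \<inter> (T -` (itin T F n -` {u} \<inter> X) \<inter> X)" "D \<noteq> {}"
      unfolding iterated_join.simps Suc.IH unfolding fibers_def by blast
    then have D: "D = itin T F (Suc n) -` {v # u} \<inter> X" "D \<noteq> {}" unfolding * by auto
    then obtain x where "x \<in> D" by blast
    then have "x \<in> X" "itin T F (Suc n) x = v # u" using D by blast+
    then have "v # u \<in> itin T F (Suc n) ` X" by (metis imageI)
    then show "D \<in> fibers X (itin T F (Suc n))" using D(1) unfolding fibers_def by blast
  next
    fix D assume "D \<in> fibers X (itin T F (Suc n))"
    then obtain x where x: "x \<in> X" "D = itin T F (Suc n) -` {F x # itin T F n (T x)} \<inter> X"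
      by (auto simp: fibers_def)
    then have "x \<in> D" by auto
    moreover have "D = F -` {F x} \<inter> X \<inter> (T -` (itin T F n -` {itin T F n (T x)} \<inter> X) \<inter> X)"
      unfolding x(2) * ..
    moreover have "F -` {F x} \<inter> X \<in> fibers X F" "itin T F n -` {itin T F n (T x)} \<inter> X \<in> fibers X (itin T F n)"
      using x T by (auto simp: fibers_def)
    ultimately show "D \<in> iterated_join X T (fibers X F) (Suc n)"
      unfolding iterated_join.simps Suc.IH by blast
  qed
qed

text \<open>Turns the partitions in the supremum defining \<open>metric_entropy\<close> into simple
  functions: a point is mapped to its cell.\<close>

lemma partition_eq_fibers:
  assumes "partition_on X P"
  shows "fibers X (\<lambda>x. THE B. B \<in> P \<and> x \<in> B) = P"
proof -
  let ?F = "\<lambda>x. THE B. B \<in> P \<and> x \<in> B"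
  have F: "?F x = B" if "B \<in> P" "x \<in> B" for x B
    using assms that by (intro the_equality) (auto simp: partition_on_def disjoint_def)
  have PX: "\<Union>P = X" "{} \<notin> P" using assms by (auto simp: partition_on_def)
  have fib: "?F -` {B} \<inter> X = B" if "B \<in> P" for B
  proof (intro equalityI subsetI)
    fix x assume x: "x \<in> ?F -` {B} \<inter> X"
    then obtain C where "C \<in> P" "x \<in> C" using PX by auto
    then show "x \<in> B" using F[of C x] x by simp
  next
    fix x assume "x \<in> B"
    then show "x \<in> ?F -` {B} \<inter> X" using F[OF that] that PX by auto
  qed
  have img: "?F ` X = P"
  proof (intro equalityI subsetI)
    fix B assume "B \<in> ?F ` X"
    then obtain x where "x \<in> X" "B = ?F x" by auto
    moreover then obtain C where "C \<in> P" "x \<in> C" using PX by auto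
    ultimately show "B \<in> P" using F by simp
  next
    fix B assume B: "B \<in> P"
    then obtain x where "x \<in> B" using PX by (metis all_not_in_conv)
    then show "B \<in> ?F ` X" using F[OF B] B PX by (intro image_eqI[of _ _ x]) auto
  qed
  show ?thesis unfolding fibers_def img using fib by auto
qed

locale measure_preserving = prob_space M for M :: "'a measure" +
  fixes T :: "'a \<Rightarrow> 'a"
  assumes T_meas [measurable]: "T \<in> measurable M M" and distr_T: "distr M M T = M"
begin

lemma T_space: "T \<in> space M \<rightarrow> space M"
  using measurable_space[OF T_meas] by auto

lemma funpow_space: "x \<in> space M \<Longrightarrow> (T ^^ n) x \<in> space M"
  using T_space by (induction n) auto

lemma measurable_funpow [measurable]: "T ^^ n \<in> measurable M M"
  by (induction n) auto

lemma distr_funpow: "distr M M (T ^^ n) = M"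
proof (induction n)
  case (Suc n)
  have "distr M M (T ^^ Suc n) = distr (distr M M (T ^^ n)) M T"
    by (subst distr_distr) (auto simp: o_def)
  also have "\<dots> = M" unfolding Suc.IH by (rule distr_T)
  finally show ?case .
qed (simp add: distr_id2)

lemma measure_funpow: "A \<in> sets M \<Longrightarrow> measure M ((T ^^ n) -` A \<inter> space M) = measure M A"
  by (metis distr_funpow measure_distr measurable_funpow)

lemma simple_function_funpow: "simple_function M F \<Longrightarrow> simple_function M (\<lambda>x. F ((T ^^ n) x))"
  by (rule simple_function_comp[OF measurable_funpow])

lemma simple_function_T: "simple_function M F \<Longrightarrow> simple_function M (\<lambda>x. F (T x))"
  by (rule simple_function_comp[OF T_meas])

lemma simple_function_itin: "simple_function M F \<Longrightarrow> simple_function M (itin T F n)"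
proof (induction n)
  case (Suc n)
  have "simple_function M (\<lambda>x. F x # itin T F n (T x))"
    by (rule simple_function_compose2[where h = "(#)", OF Suc.prems simple_function_T[OF Suc.IH[OF Suc.prems]]])
  then show ?case by simp
qed (simp add: itin_zero)

lemma mass_funpow:
  assumes "simple_function M F"
  shows "mass M (\<lambda>x. F ((T ^^ n) x)) v = mass M F v"
proof -
  have "(\<lambda>x. F ((T ^^ n) x)) -` {v} \<inter> space M = (T ^^ n) -` (F -` {v} \<inter> space M) \<inter> space M"
    using funpow_space by auto
  then show ?thesis unfolding mass_def
    using measure_funpow[of "F -` {v} \<inter> space M" n] assms by (simp add: simple_functionD)
qed

lemma ent_funpow:
  assumes "simple_function M F"
  shows "ent M (\<lambda>x. F ((T ^^ n) x)) = ent M F"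
proof -
  have fin: "finite (F ` space M)" using assms by (auto dest: simple_functionD)
  have "(\<lambda>x. F ((T ^^ n) x)) ` space M \<subseteq> F ` space M" using funpow_space by auto
  then show ?thesis
    by (simp add: ent_eq_sum[OF fin] mass_funpow[OF assms])
qed

lemma ent_T: "simple_function M F \<Longrightarrow> ent M (\<lambda>x. F (T x)) = ent M F"
  using ent_funpow[of F 1] by simp

section \<open>Concavity and growth rate of block entropies\<close>

text \<open>Strong subadditivity for the first letter, the middle block and the last letter of a
  block of length \<open>n + 2\<close>; by invariance a block has the same entropy wherever it
  starts.\<close>

lemma ent_itin_concave:
  assumes F: "simple_function M F"
  shows "ent M (itin T F (Suc (Suc n))) - ent M (itin T F (Suc n))
    \<le> ent M (itin T F (Suc n)) - ent M (itin T F n)"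
proof -
  let ?b = "\<lambda>x. itin T F n (T x)" and ?c = "\<lambda>x. F ((T ^^ n) (T x))"
  note sf = simple_function_itin[OF F] simple_function_T simple_function_funpow[OF F]
  have snoc: "itin T F (Suc n) x = itin T F n x @ [F ((T ^^ n) x)]" for x
    using itin_add[of T F n 1 x] by simp
  have "ent M (\<lambda>x. (F x, ?b x, ?c x)) + ent M ?b \<le> ent M (\<lambda>x. (F x, ?b x)) + ent M (\<lambda>x. (?b x, ?c x))"
    by (intro ent_strong_subadditive F simple_function_T sf)
  moreover have "ent M (\<lambda>x. (F x, ?b x, ?c x)) = ent M (itin T F (Suc (Suc n)))"
    by (intro ent_cong) (simp add: snoc[of "T _"] del: itin.simps(2) add: itin.simps(2)[of _ _ "Suc n"])
  moreover have "ent M ?b = ent M (itin T F n)" by (intro ent_T sf)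
  moreover have "ent M (\<lambda>x. (F x, ?b x)) = ent M (itin T F (Suc n))" by (intro ent_cong) simp
  moreover have "ent M (\<lambda>x. (?b x, ?c x)) = ent M (\<lambda>x. itin T F (Suc n) (T x))"
    by (intro ent_cong) (simp add: snoc del: itin.simps)
  moreover have "\<dots> = ent M (itin T F (Suc n))" by (intro ent_T sf)
  ultimately show ?thesis by simp
qed

text \<open>Per step, strong subadditivity is used twice: the new letter of \<open>F\<close> is
  conditioned only on the simultaneous letter of \<open>G\<close>, and that letter of
  \<open>G\<close> only on the past of \<open>G\<close>. Forgetting conditions can only increase
  entropy.\<close>

lemma ent_itin_Pair_le:
  assumes F: "simple_function M F" and G: "simple_function M G"
  shows "ent M (itin T (\<lambda>x. (F x, G x)) n)
    \<le> ent M (itin T G n) + real n * (ent M (\<lambda>x. (F x, G x)) - ent M G)"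
proof (induction n)
  case 0
  then show ?case by (simp add: ent_const itin_zero)
next
  case (Suc n)
  let ?FG = "\<lambda>x. (F x, G x)"
  let ?a = "itin T ?FG n" and ?g = "itin T G n"
  let ?F = "\<lambda>x. F ((T ^^ n) x)" and ?G = "\<lambda>x. G ((T ^^ n) x)"
  have FG: "simple_function M ?FG" using F G by auto
  have snoc: "itin T H (Suc n) x = itin T H n x @ [H ((T ^^ n) x)]" for x and H :: "'a \<Rightarrow> 'd"
    using itin_add[of T H n 1 x] by simp
  have "ent M (\<lambda>x. (?a x, ?G x, ?F x)) + ent M ?G \<le> ent M (\<lambda>x. (?a x, ?G x)) + ent M (\<lambda>x. (?G x, ?F x))"
    by (intro ent_strong_subadditive simple_function_itin FG simple_function_funpow F G)
  moreover have "ent M (\<lambda>x. (?a x, ?G x, ?F x)) = ent M (itin T ?FG (Suc n))"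
    by (intro ent_cong) (auto simp: snoc simp del: itin.simps)
  moreover have "ent M ?G = ent M G" by (intro ent_funpow G)
  moreover have "ent M (\<lambda>x. (?G x, ?F x)) = ent M (\<lambda>x. ?FG ((T ^^ n) x))" by (intro ent_cong) auto
  moreover have "\<dots> = ent M ?FG" by (intro ent_funpow FG)
  moreover have "ent M (\<lambda>x. (?a x, ?g x, ?G x)) + ent M ?g \<le> ent M (\<lambda>x. (?a x, ?g x)) + ent M (\<lambda>x. (?g x, ?G x))"
    by (intro ent_strong_subadditive simple_function_itin FG simple_function_funpow G)
  moreover have "ent M (\<lambda>x. (?a x, ?g x, ?G x)) = ent M (\<lambda>x. (?a x, ?G x))"
    by (intro ent_cong) (auto simp: itin_eq_iff)
  moreover have "ent M (\<lambda>x. (?a x, ?g x)) = ent M ?a"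
    by (intro ent_cong) (auto simp: itin_eq_iff)
  moreover have "ent M (\<lambda>x. (?g x, ?G x)) = ent M (itin T G (Suc n))"
    by (intro ent_cong) (auto simp: snoc simp del: itin.simps)
  ultimately show ?case using Suc.IH by (simp add: algebra_simps del: itin.simps)
qed

text \<open>After division by \<open>n\<close> and passage to the limit this is the classical
  \<open>h(F) \<le> h(G) + H(F | G)\<close>.\<close>

lemma ent_itin_le:
  assumes F: "simple_function M F" and G: "simple_function M G"
  shows "ent M (itin T F n) \<le> ent M (itin T G n) + real n * (ent M (\<lambda>x. (F x, G x)) - ent M G)"
proof -
  have "ent M (itin T F n) \<le> ent M (itin T (\<lambda>x. (F x, G x)) n)"
    using F G by (intro ent_mono simple_function_itin) (auto simp: itin_eq_iff)
  then show ?thesis using ent_itin_Pair_le[OF F G, of n] by linarith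
qed

lemma ent_itin_step_mono:
  assumes F: "simple_function M F" and "m \<le> n"
  shows "ent M (itin T F (Suc n)) - ent M (itin T F n) \<le> ent M (itin T F (Suc m)) - ent M (itin T F m)"
  using \<open>m \<le> n\<close>
proof (induction rule: dec_induct)
  case (step k)
  then show ?case using ent_itin_concave[OF F, of k] by linarith
qed simp

lemma ent_itin_telescope:
  assumes F: "simple_function M F"
  shows "ent M (itin T F (N + k)) \<le> ent M (itin T F N) + real k * (ent M (itin T F (Suc N)) - ent M (itin T F N))"
proof (induction k)
  case (Suc k)
  then show ?case using ent_itin_step_mono[OF F, of N "N + k"]
    by (simp add: algebra_simps del: itin.simps)
qed simp

text \<open>For a concave sequence starting at 0, the next increment is at most the average of the
  previous ones.\<close>

lemma ent_rate_decreasing: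
  assumes F: "simple_function M F"
  shows "ent M (itin T F (Suc (Suc n))) / real (Suc (Suc n)) \<le> ent M (itin T F (Suc n)) / real (Suc n)"
proof -
  define a where "a n = ent M (itin T F n)" for n
  have "real n * (a (Suc n) - a n) \<le> a n" for n
  proof (induction n)
    case 0
    show ?case by (simp add: a_def ent_const itin_zero)
  next
    case (Suc n)
    have "a (Suc (Suc n)) - a (Suc n) \<le> a (Suc n) - a n"
      unfolding a_def by (rule ent_itin_concave[OF F])
    then have "real (Suc n) * (a (Suc (Suc n)) - a (Suc n)) \<le> real (Suc n) * (a (Suc n) - a n)"
      by (intro mult_left_mono) auto
    then show ?case using Suc by (simp add: algebra_simps)
  qed
  from this[of "Suc n"] have "real (Suc n) * a (Suc (Suc n)) \<le> real (Suc (Suc n)) * a (Suc n)"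
    by (simp add: algebra_simps)
  then show ?thesis unfolding a_def[symmetric] by (simp add: field_simps del: of_nat_Suc)
qed

lemma ent_rate_convergent:
  assumes F: "simple_function M F"
  obtains h where "(\<lambda>n. ent M (itin T F n) / real n) \<longlonglongrightarrow> h"
    "\<And>n. 0 < n \<Longrightarrow> h \<le> ent M (itin T F n) / real n"
proof -
  \<comment> \<open>Indexed from 1, because at 0 the quotient is \<open>0 / 0 = 0\<close> and
    monotonicity could fail there.\<close>
  let ?b = "\<lambda>n. ent M (itin T F (Suc n)) / real (Suc n)"
  have dec: "decseq ?b" by (intro decseq_SucI ent_rate_decreasing[OF F])
  have nn: "0 \<le> ?b n" for n by (intro divide_nonneg_nonneg ent_nonneg simple_function_itin F) auto
  obtain h where h: "?b \<longlonglongrightarrow> h" "\<And>i. h \<le> ?b i"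
    using decseq_convergent[OF dec, of 0] nn by metis
  have "(\<lambda>n. ent M (itin T F n) / real n) \<longlonglongrightarrow> h" using h(1) by (rule LIMSEQ_imp_Suc)
  moreover have "h \<le> ent M (itin T F n) / real n" if "0 < n" for n
    using h(2)[of "n - 1"] that by (simp del: itin.simps)
  ultimately show ?thesis using that by blast
qed

text \<open>Increments decrease, so beyond \<open>N\<close> the block entropies stay below a line
  whose slope is the increment at \<open>N\<close>. This is how a statement about the limit controls
  each finite length.\<close>

lemma ent_rate_le_step:
  assumes F: "simple_function M F" and h: "(\<lambda>n. ent M (itin T F n) / real n) \<longlonglongrightarrow> h"
  shows "h \<le> ent M (itin T F (Suc N)) - ent M (itin T F N)"
proof -
  define d where "d = ent M (itin T F (Suc N)) - ent M (itin T F N)"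
  have "(\<lambda>k. ent M (itin T F (k + N)) / real (k + N)) \<longlonglongrightarrow> h"
    by (rule LIMSEQ_ignore_initial_segment[OF h])
  moreover have "(\<lambda>k. (c + real k * d) / real (k + N)) \<longlonglongrightarrow> d" for c
    by real_asymp
  moreover have "ent M (itin T F (k + N)) / real (k + N) \<le> (ent M (itin T F N) + real k * d) / real (k + N)" for k
    using ent_itin_telescope[OF F, of N k] by (intro divide_right_mono) (simp_all add: d_def add.commute)
  ultimately have "h \<le> d" by (blast intro: LIMSEQ_le)
  then show ?thesis by (simp add: d_def)
qed

end

section \<open>The generator theorem\<close>

lemma take_drop_itin: "a + b \<le> n \<Longrightarrow> take b (drop a (itin T F n x)) = itin T F b ((T ^^ a) x)"
  by (rule nth_equalityI)
    (auto simp: nth_itin funpow_add[unfolded o_def, THEN fun_cong, symmetric] add.commute)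

lemma simple_function_iff_fibers:
  "simple_function M F \<longleftrightarrow> finite (fibers (space M) F) \<and> fibers (space M) F \<subseteq> sets M"
proof -
  have "inj_on (\<lambda>v. F -` {v} \<inter> space M) (F ` space M)" by (auto simp: inj_on_def)
  then have "finite (fibers (space M) F) \<longleftrightarrow> finite (F ` space M)"
    unfolding fibers_def by (rule finite_image_iff)
  then show ?thesis by (auto simp: simple_function_def fibers_def)
qed

section \<open>Approximation of measurable sets by cylinder sets, and comparison of entropy
  rates\<close>

context measure_preserving
begin

text \<open>Itineraries only record the future, so a set is compared with them after \<open>n\<close> steps; in the
  two-sided case the letters read then form a symmetric window.\<close>

definition approx_error :: "('a \<Rightarrow> 'b) \<Rightarrow> 'a set \<Rightarrow> nat \<Rightarrow> 'b list set \<Rightarrow> real" where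
  "approx_error F B n D = measure M {x \<in> space M. ((T ^^ n) x \<in> B) \<noteq> (itin T F (2 * n) x \<in> D)}"

definition approximable :: "('a \<Rightarrow> 'b) \<Rightarrow> 'a set \<Rightarrow> bool" where
  "approximable F B \<longleftrightarrow> (\<forall>d>0. \<exists>n D. approx_error F B n D < d)"

lemma sets_approx_error:
  assumes F: "simple_function M F" and B: "B \<in> sets M"
  shows "{x \<in> space M. ((T ^^ n) x \<in> B) \<noteq> (itin T F k x \<in> D)} \<in> sets M"
proof -
  let ?A = "(T ^^ n) -` B \<inter> space M" and ?C = "itin T F k -` D \<inter> space M"
  have "?A \<in> sets M" by (rule measurable_sets[OF measurable_funpow B])
  moreover have "?C \<in> sets M" by (rule simple_functionD(2)[OF simple_function_itin[OF F]])
  ultimately have "(?A - ?C) \<union> (?C - ?A) \<in> sets M" by blast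
  moreover have "(?A - ?C) \<union> (?C - ?A) = {x \<in> space M. ((T ^^ n) x \<in> B) \<noteq> (itin T F k x \<in> D)}" by blast
  ultimately show ?thesis by simp
qed

text \<open>\<open>?D'\<close> reads the central \<open>2 * n\<close> letters of the longer
  itinerary, so the new error event is a preimage of the old one under a power of \<open>T\<close>.
  Hence several sets can be approximated with a common \<open>n\<close>.\<close>

lemma approx_error_shift:
  assumes F: "simple_function M F" and B: "B \<in> sets M" and "n \<le> n'"
  shows "\<exists>D'. approx_error F B n' D' = approx_error F B n D"
proof
  let ?E = "{x \<in> space M. ((T ^^ n) x \<in> B) \<noteq> (itin T F (2 * n) x \<in> D)}"
  let ?D' = "{w. take (2 * n) (drop (n' - n) w) \<in> D}"
  have shift: "(T ^^ n') x = (T ^^ n) ((T ^^ (n' - n)) x)" for x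
    using \<open>n \<le> n'\<close> funpow_add[of n "n' - n" T] by simp
  have "{x \<in> space M. ((T ^^ n') x \<in> B) \<noteq> (itin T F (2 * n') x \<in> ?D')}
      = (T ^^ (n' - n)) -` ?E \<inter> space M"
    using \<open>n \<le> n'\<close> funpow_space by (auto simp: take_drop_itin shift)
  then show "approx_error F B n' ?D' = approx_error F B n D"
    unfolding approx_error_def using measure_funpow[OF sets_approx_error[OF F B]] by simp
qed

lemma approximable_eventually:
  assumes "simple_function M F" "B \<in> sets M" "approximable F B" "0 < d"
  obtains n where "\<And>n'. n \<le> n' \<Longrightarrow> \<exists>D. approx_error F B n' D < d"
  using approx_error_shift[OF assms(1,2)] assms(3,4) unfolding approximable_def by metis

lemma approximable_Compl:
  assumes "approximable F B"
  shows "approximable F (space M - B)"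
proof -
  have "approx_error F (space M - B) n (- D) = approx_error F B n D" for n D
    using funpow_space unfolding approx_error_def by (intro arg_cong[where f = "measure M"]) auto
  then show ?thesis using assms unfolding approximable_def by metis
qed

lemma approximable_empty: "approximable F {}"
proof -
  have "approx_error F {} 0 {} = 0" by (simp add: approx_error_def)
  then show ?thesis unfolding approximable_def by metis
qed

lemma approximable_Un:
  assumes F: "simple_function M F" and B: "B \<in> sets M" "C \<in> sets M"
    and ap: "approximable F B" "approximable F C"
  shows "approximable F (B \<union> C)"
  unfolding approximable_def
proof (intro allI impI)
  fix d :: real assume "0 < d"
  then have d2: "0 < d / 2" by simp
  obtain n1 where n1: "\<And>n'. n1 \<le> n' \<Longrightarrow> \<exists>D. approx_error F B n' D < d / 2"
    using approximable_eventually[OF F B(1) ap(1) d2] by blast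
  obtain n2 where n2: "\<And>n'. n2 \<le> n' \<Longrightarrow> \<exists>D. approx_error F C n' D < d / 2"
    using approximable_eventually[OF F B(2) ap(2) d2] by blast
  define n where "n = max n1 n2"
  obtain D E where D: "approx_error F B n D < d / 2" and E: "approx_error F C n E < d / 2"
    using n1[of n] n2[of n] by (auto simp: n_def)
  have "approx_error F (B \<union> C) n (D \<union> E) \<le> approx_error F B n D + approx_error F C n E"
    unfolding approx_error_def using F B
    by (intro order_trans[OF finite_measure_mono measure_Un_le] sets.Un sets_approx_error) auto
  then show "\<exists>n D. approx_error F (B \<union> C) n D < d" using D E by (intro exI[of _ n] exI[of _ "D \<union> E"]) linarith
qed

lemma approximable_limit:
  assumes F: "simple_function M F" and B: "B \<in> sets M"
    and ap: "\<And>d. 0 < d \<Longrightarrow> \<exists>C\<in>sets M. C \<subseteq> B \<and> approximable F C \<and> measure M (B - C) < d"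
  shows "approximable F B"
  unfolding approximable_def
proof (intro allI impI)
  fix d :: real assume "0 < d"
  then have d2: "0 < d / 2" by simp
  obtain C where C: "C \<in> sets M" "C \<subseteq> B" "approximable F C" "measure M (B - C) < d / 2" using ap[OF d2] by blast
  obtain n D where D: "approx_error F C n D < d / 2" using C(3) d2 unfolding approximable_def by blast
  have "approx_error F B n D \<le> approx_error F C n D + measure M ((T ^^ n) -` (B - C) \<inter> space M)"
    unfolding approx_error_def using F B C
    by (intro order_trans[OF finite_measure_mono measure_Un_le] sets.Un sets_approx_error
        measurable_sets[OF measurable_funpow] sets.Diff) auto
  also have "measure M ((T ^^ n) -` (B - C) \<inter> space M) = measure M (B - C)"
    using B C by (intro measure_funpow) auto
  finally show "\<exists>n D. approx_error F B n D < d" using D C(4) by (intro exI[of _ n] exI[of _ D]) linarith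
qed

lemma approximable_incseq:
  assumes F: "simple_function M F" and C: "\<And>n. C n \<in> sets M" "incseq C" "\<And>n. approximable F (C n)"
  shows "approximable F (\<Union>n. C n)"
proof (rule approximable_limit[OF F])
  show B: "(\<Union>n. C n) \<in> sets M" using C by auto
  fix d :: real assume "0 < d"
  have "(\<lambda>n. measure M (C n)) \<longlonglongrightarrow> measure M (\<Union>n. C n)"
    using C by (intro finite_Lim_measure_incseq) auto
  from tendstoD[OF this \<open>0 < d\<close>] obtain n where "dist (measure M (C n)) (measure M (\<Union>n. C n)) < d"
    unfolding eventually_sequentially by blast
  moreover have "measure M ((\<Union>n. C n) - C n) = measure M (\<Union>n. C n) - measure M (C n)"
    using B C by (intro finite_measure_Diff) auto
  ultimately have "measure M ((\<Union>n. C n) - C n) < d" by (simp add: dist_real_def abs_less_iff)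
  then show "\<exists>D\<in>sets M. D \<subseteq> (\<Union>n. C n) \<and> approximable F D \<and> measure M ((\<Union>n. C n) - D) < d"
    using C by blast
qed

lemma approximable_UN:
  fixes C :: "nat \<Rightarrow> 'a set"
  assumes F: "simple_function M F" and C: "\<And>n. C n \<in> sets M" "\<And>n. approximable F (C n)"
  shows "approximable F (\<Union>n. C n)"
proof -
  have fin: "approximable F (\<Union>i<n. C i)" for n
  proof (induction n)
    case (Suc n)
    then show ?case using approximable_Un[OF F, of "C n" "\<Union>i<n. C i"] C by (auto simp: lessThan_Suc)
  qed (simp add: approximable_empty)
  have "approximable F (\<Union>n. \<Union>i<n. C i)"
    using C by (intro approximable_incseq F fin incseq_SucI) (auto simp: lessThan_Suc)
  moreover have "(\<Union>n. \<Union>i<n. C i) = (\<Union>n. C n)" by blast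
  ultimately show ?thesis by simp
qed

lemma approximable_sigma:
  assumes F: "simple_function M F" and G: "sets M = sigma_sets (space M) G"
    and ap: "\<And>B. B \<in> G \<Longrightarrow> approximable F B" and B: "B \<in> sets M"
  shows "approximable F B"
proof -
  \<comment> \<open>Measurability is carried through the induction because the countable-union step
    requires measurable pieces.\<close>
  have "B \<in> sets M \<and> approximable F B" using B unfolding G
  proof (induction rule: sigma_sets.induct)
    case (Union a)
    then show ?case using approximable_UN[OF F, of a] unfolding G by (auto intro: sigma_sets.Union)
  qed (auto intro: ap sigma_sets.intros approximable_empty approximable_Compl)
  then show ?thesis by simp
qed

text \<open>Each cell of \<open>G\<close> is approximated up to \<open>d / card ?S\<close>; a wrong
  guess of the cell forces the point into one of these error events.\<close>

lemma approx_simple_function: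
  assumes F: "simple_function M F" and G: "simple_function M G"
    and ap: "\<And>B. B \<in> sets M \<Longrightarrow> approximable F B" and "0 < d"
  obtains n g where "measure M {x \<in> space M. G ((T ^^ n) x) \<noteq> g (itin T F (2 * n) x)} < d"
proof -
  let ?S = "G ` space M"
  let ?B = "\<lambda>v. G -` {v} \<inter> space M"
  have fin: "finite ?S" and B: "?B v \<in> sets M" for v using G by (auto dest: simple_functionD)
  have "?S \<noteq> {}" using not_empty by auto
  then have card: "0 < card ?S" using fin by (simp add: card_gt_0_iff)
  then have d': "0 < d / card ?S" using \<open>0 < d\<close> by simp
  have "\<exists>n. \<forall>n'\<ge>n. \<exists>D. approx_error F (?B v) n' D < d / card ?S" for v
    using approximable_eventually[OF F B ap[OF B] d'] by metis
  then obtain N where N: "\<And>v n'. N v \<le> n' \<Longrightarrow> \<exists>D. approx_error F (?B v) n' D < d / card ?S"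
    by metis
  define n where "n = Max (N ` ?S)"
  have "\<exists>D. approx_error F (?B v) n D < d / card ?S" if "v \<in> ?S" for v
    using that fin by (intro N) (auto simp: n_def)
  then obtain D where D: "\<And>v. v \<in> ?S \<Longrightarrow> approx_error F (?B v) n (D v) < d / card ?S"
    by metis
  \<comment> \<open>Any cell whose approximating set contains the word is accepted. If there is
    none, the choice is arbitrary, but then the true cell is already in error.\<close>
  define g where "g w = (SOME v. v \<in> ?S \<and> w \<in> D v)" for w
  let ?E = "\<lambda>v. {x \<in> space M. ((T ^^ n) x \<in> ?B v) \<noteq> (itin T F (2 * n) x \<in> D v)}"
  have "{x \<in> space M. G ((T ^^ n) x) \<noteq> g (itin T F (2 * n) x)} \<subseteq> (\<Union>v\<in>?S. ?E v)"
  proof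
    fix x assume "x \<in> {x \<in> space M. G ((T ^^ n) x) \<noteq> g (itin T F (2 * n) x)}"
    then have x: "x \<in> space M" and ne: "G ((T ^^ n) x) \<noteq> g (itin T F (2 * n) x)" by auto
    let ?w = "itin T F (2 * n) x" and ?v = "G ((T ^^ n) x)"
    have v: "?v \<in> ?S" "(T ^^ n) x \<in> ?B ?v" using funpow_space[OF x] by auto
    show "x \<in> (\<Union>v\<in>?S. ?E v)"
    proof (cases "?w \<in> D ?v")
      case True
      then have "\<exists>v. v \<in> ?S \<and> ?w \<in> D v" using v(1) by blast
      then have "g ?w \<in> ?S \<and> ?w \<in> D (g ?w)" unfolding g_def by (rule someI_ex)
      moreover have "(T ^^ n) x \<notin> ?B (g ?w)" using ne by auto
      ultimately show ?thesis using x by (intro UN_I[of "g ?w"]) auto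
    next
      case False
      then show ?thesis using x v by (intro UN_I[of ?v]) auto
    qed
  qed
  then have "measure M {x \<in> space M. G ((T ^^ n) x) \<noteq> g (itin T F (2 * n) x)} \<le> measure M (\<Union>v\<in>?S. ?E v)"
    by (intro finite_measure_mono sets.finite_UN fin sets_approx_error F B)
  also have "\<dots> \<le> (\<Sum>v\<in>?S. measure M (?E v))"
    by (intro finite_measure_subadditive_finite fin image_subsetI sets_approx_error F B)
  also have "\<dots> < (\<Sum>v\<in>?S. d / card ?S)"
    using D fin \<open>?S \<noteq> {}\<close> unfolding approx_error_def by (intro sum_strict_mono)
  also have "\<dots> = d" using card by simp
  finally show ?thesis using that by blast
qed

text \<open>After \<open>n\<close> steps \<open>G\<close> is almost a function of the window
  \<open>itin T F (2 * n)\<close>, so passing to these windows costs at most \<open>d\<close> per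
  letter. A block of \<open>k\<close> windows is determined by \<open>k + 2 * n\<close> letters of
  \<open>F\<close>, and the extra \<open>2 * n\<close> letters disappear from the rate.\<close>

lemma ent_rate_le_generator:
  assumes F: "simple_function M F" and G: "simple_function M G"
    and ap: "\<And>B. B \<in> sets M \<Longrightarrow> approximable F B"
    and f: "(\<lambda>n. ent M (itin T F n) / real n) \<longlonglongrightarrow> f"
    and g: "(\<lambda>n. ent M (itin T G n) / real n) \<longlonglongrightarrow> g"
  shows "g \<le> f"
proof (rule field_le_epsilon)
  fix d :: real assume "0 < d"
  let ?S = "G ` space M"
  have S: "finite ?S" "?S \<noteq> {}" using G not_empty by (auto dest: simple_functionD)
  then have card: "1 \<le> card ?S" by (simp add: Suc_le_eq card_gt_0_iff)
  \<comment> \<open>Chosen so that \<open>- ln (1 - e) = d / 2\<close>. The factor \<open>L\<close>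
    then depends on \<open>e\<close> and the range of \<open>G\<close> only, so the error
    probability \<open>d / (2 * L)\<close>, which supplies the other half of \<open>d\<close>, can
    be prescribed before \<open>n\<close>.\<close>
  define e where "e = 1 - exp (- (d / 2))"
  have e: "0 < e" "e < 1" using \<open>0 < d\<close> by (auto simp: e_def)
  define L where "L = ln (real (card ?S)) - ln e"
  have "ln e < 0" using e by simp
  moreover have "0 \<le> ln (real (card ?S))" using card by simp
  ultimately have L: "0 < L" unfolding L_def by linarith
  then have "0 < d / (2 * L)" using \<open>0 < d\<close> by simp
  then obtain n \<phi> where n: "measure M {x \<in> space M. G ((T ^^ n) x) \<noteq> \<phi> (itin T F (2 * n) x)} < d / (2 * L)"
    using approx_simple_function[OF F G ap] by blast
  let ?G = "\<lambda>x. G ((T ^^ n) x)" and ?F = "itin T F (2 * n)"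
  have sG: "simple_function M ?G" and sF: "simple_function M ?F"
    by (intro simple_function_funpow G simple_function_itin F)+
  have "ent M (\<lambda>x. (?G x, ?F x)) - ent M ?F
      \<le> - ln (1 - e) + measure M {x \<in> space M. ?G x \<noteq> \<phi> (?F x)} * L"
    unfolding L_def using funpow_space by (intro ent_Pair_approx sG sF S e) auto
  also have "\<dots> \<le> d / 2 + d / (2 * L) * L"
    using n L by (intro add_mono mult_right_mono) (auto simp: e_def)
  also have "\<dots> = d" using L by simp
  finally have small: "ent M (\<lambda>x. (?G x, ?F x)) - ent M ?F \<le> d" .
  have bound: "ent M (itin T G k) \<le> ent M (itin T F (k + 2 * n)) + real k * d" for k
  proof -
    have "itin T ?G k = (\<lambda>x. itin T G k ((T ^^ n) x))"
      by (intro ext nth_equalityI)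
        (auto simp: nth_itin funpow_add[unfolded o_def, THEN fun_cong, symmetric] add.commute)
    then have "ent M (itin T G k) = ent M (itin T ?G k)"
      using ent_funpow[OF simple_function_itin[OF G]] by simp
    also have "\<dots> \<le> ent M (itin T ?F k) + real k * (ent M (\<lambda>x. (?G x, ?F x)) - ent M ?F)"
      by (rule ent_itin_le[OF sG sF])
    also have "\<dots> \<le> ent M (itin T F (k + 2 * n)) + real k * d"
    proof (intro add_mono mult_left_mono small)
      show "ent M (itin T ?F k) \<le> ent M (itin T F (k + 2 * n))"
      proof (rule ent_mono)
        fix x y assume "itin T F (k + 2 * n) x = itin T F (k + 2 * n) y"
        then have *: "F ((T ^^ i) x) = F ((T ^^ i) y)" if "i < k + 2 * n" for i
          using that by (simp add: itin_eq_iff)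
        show "itin T ?F k x = itin T ?F k y"
          unfolding itin_eq_iff
          by (auto simp: funpow_add[unfolded o_def, THEN fun_cong, symmetric] intro!: *)
      qed (intro simple_function_itin F)+
    qed auto
    finally show ?thesis .
  qed
  have lim: "(\<lambda>k. ent M (itin T F (k + 2 * n)) / real (k + 2 * n) * (real (k + 2 * n) / real k) + d) \<longlonglongrightarrow> f * 1 + d"
  proof (intro tendsto_add tendsto_mult tendsto_const)
    show "(\<lambda>k. ent M (itin T F (k + 2 * n)) / real (k + 2 * n)) \<longlonglongrightarrow> f"
      by (rule LIMSEQ_ignore_initial_segment[OF f])
    show "(\<lambda>k. real (k + 2 * n) / real k) \<longlonglongrightarrow> 1" by real_asymp
  qed
  have "ent M (itin T G k) / real k \<le> ent M (itin T F (k + 2 * n)) / real (k + 2 * n) * (real (k + 2 * n) / real k) + d"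
    if "1 \<le> k" for k
  proof -
    have "ent M (itin T G k) / real k \<le> (ent M (itin T F (k + 2 * n)) + real k * d) / real k"
      by (intro divide_right_mono bound) simp
    also have "\<dots> = ent M (itin T F (k + 2 * n)) / real (k + 2 * n) * (real (k + 2 * n) / real k) + d"
      using that by (simp add: add_divide_distrib del: of_nat_add)
    finally show ?thesis .
  qed
  then have "g \<le> f * 1 + d" by (intro LIMSEQ_le[OF g lim]) blast
  then show "g \<le> f + d" by simp
qed

lemma metric_entropy_le_generator:
  assumes F: "simple_function M F" and ap: "\<And>B. B \<in> sets M \<Longrightarrow> approximable F B"
    and f: "(\<lambda>n. ent M (itin T F n) / real n) \<longlonglongrightarrow> f"
  shows "metric_entropy M T \<le> ereal f"
  unfolding metric_entropy_def
proof (rule SUP_least)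
  fix P assume P: "P \<in> {P. finite P \<and> P \<subseteq> sets M \<and> partition_on (space M) P}"
  define G where "G x = (THE B. B \<in> P \<and> x \<in> B)" for x
  have PG: "fibers (space M) G = P" unfolding G_def using P by (intro partition_eq_fibers) auto
  have G: "simple_function M G" unfolding simple_function_iff_fibers PG using P by auto
  obtain g where g: "(\<lambda>n. ent M (itin T G n) / real n) \<longlonglongrightarrow> g" using ent_rate_convergent[OF G] .
  have "partition_entropy M (iterated_join (space M) T P n) = ent M (itin T G n)" for n
    unfolding ent_def PG[symmetric] using not_empty by (subst fibers_itin[OF T_space]) auto
  then have "lim (\<lambda>n. partition_entropy M (iterated_join (space M) T P n) / real n) = g"
    using g by (simp add: limI)
  then show "ereal (lim (\<lambda>n. partition_entropy M (iterated_join (space M) T P n) / real n)) \<le> ereal f"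
    using ent_rate_le_generator[OF F G ap f g] by simp
qed

end

section \<open>Perron vectors and mixing of stochastic kernels\<close>

text \<open>Matrix powers for functions of two indices below \<open>s\<close>, so that
  \<open>A\<close> and the stochastic kernel \<open>P\<close> are treated alike;
  \<open>pow_mat_eq_kpow\<close> is the link to matrices.\<close>

primrec kpow :: "nat \<Rightarrow> (nat \<Rightarrow> nat \<Rightarrow> real) \<Rightarrow> nat \<Rightarrow> nat \<Rightarrow> nat \<Rightarrow> real" where
  "kpow s P 0 i j = (if i = j then 1 else 0)"
| "kpow s P (Suc n) i j = (\<Sum>k<s. P i k * kpow s P n k j)"

lemma kpow_add: "i < s \<Longrightarrow> kpow s P (m + n) i j = (\<Sum>k<s. kpow s P m i k * kpow s P n k j)"
proof (induction m arbitrary: i)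
  case 0
  then show ?case by (simp add: if_distrib[of "\<lambda>x. x * _"] sum.delta cong: if_cong)
next
  case (Suc m)
  then have "kpow s P (Suc m + n) i j = (\<Sum>l<s. \<Sum>k<s. P i l * kpow s P m l k * kpow s P n k j)"
    by (simp add: sum_distrib_left mult.assoc)
  also have "\<dots> = (\<Sum>k<s. kpow s P (Suc m) i k * kpow s P n k j)"
    by (subst sum.swap) (simp add: sum_distrib_right)
  finally show ?case .
qed

lemma kpow_Suc_right: "i < s \<Longrightarrow> j < s \<Longrightarrow> kpow s P (Suc n) i j = (\<Sum>k<s. kpow s P n i k * P k j)"
proof -
  assume ij: "i < s" "j < s"
  have "kpow s P 1 k j = P k j" if "k < s" for k
    using ij by (simp add: if_distrib[of "\<lambda>x. _ * x"] sum.delta cong: if_cong)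
  then show ?thesis using kpow_add[OF ij(1), of P n 1 j] by simp
qed

lemma kpow_nonneg:
  assumes "\<And>i j. i < s \<Longrightarrow> j < s \<Longrightarrow> 0 \<le> P i j"
  shows "i < s \<Longrightarrow> 0 \<le> kpow s P n i j"
  using assms by (induction n arbitrary: i) (auto intro!: sum_nonneg)

lemma kpow_sum:
  assumes "\<And>i. i < s \<Longrightarrow> (\<Sum>j<s. P i j) = 1"
  shows "i < s \<Longrightarrow> (\<Sum>j<s. kpow s P n i j) = 1"
proof (induction n arbitrary: i)
  case (Suc n)
  have "(\<Sum>j<s. kpow s P (Suc n) i j) = (\<Sum>k<s. P i k * (\<Sum>j<s. kpow s P n k j))"
    by (simp add: sum_distrib_left) (rule sum.swap)
  then show ?case using Suc assms by simp
qed (simp add: sum.delta)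

text \<open>Since \<open>n / M - 1 \<le> n div M\<close>, the rate is the \<open>M\<close>-th root
  of \<open>x\<close>, and \<open>1 / x\<close> pays for the incomplete last block.\<close>

lemma power_div_le_geometric:
  fixes x :: real
  assumes "0 < x" "x < 1" "0 < M"
  obtains C \<rho> where "0 < C" "0 < \<rho>" "\<rho> < 1" "\<And>n. x ^ (n div M) \<le> C * \<rho> ^ n"
proof
  let ?\<rho> = "x powr (1 / real M)"
  show "0 < 1 / x" "0 < ?\<rho>" using assms by auto
  show "?\<rho> < 1" using assms powr_less_mono2[of "1 / real M" x 1] by simp
  fix n
  have "n < M * (n div M) + M" using assms(3) by (metis add.commute mod_less_divisor mult_div_mod_eq nat_add_left_cancel_less)
  then have "real n < real M * (real (n div M) + 1)"
    by (simp add: algebra_simps flip: of_nat_mult of_nat_add)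
  then have "real n / real M - 1 \<le> real (n div M)" using assms(3) by (simp add: field_simps)
  then have "x powr real (n div M) \<le> x powr (real n / real M - 1)"
    using assms by (intro powr_mono') auto
  also have "\<dots> = 1 / x * (x powr (1 / real M)) powr real n"
    using assms by (simp add: powr_diff powr_powr)
  finally show "x ^ (n div M) \<le> 1 / x * ?\<rho> ^ n" using assms by (simp add: powr_realpow)
qed

text \<open>Doeblin's argument: the \<open>M\<close>-step kernel is the constant \<open>e\<close> in
  every entry plus a nonnegative remainder with row sums \<open>1 - s * e\<close>. The constant part
  acts alike in all rows, so only the remainder transmits the spread of a column, and it contracts
  it.\<close>

lemma kpow_oscillation:
  assumes nn: "\<And>i j. i < s \<Longrightarrow> j < s \<Longrightarrow> 0 \<le> P i j" and sum1: "\<And>i. i < s \<Longrightarrow> (\<Sum>j<s. P i j) = 1"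
    and e: "\<And>i j. i < s \<Longrightarrow> j < s \<Longrightarrow> e \<le> kpow s P M i j" and x: "0 \<le> x" "1 - real s * e \<le> x"
  shows "\<exists>lo. \<forall>i<s. lo \<le> kpow s P (q * M + r) i a \<and> kpow s P (q * M + r) i a \<le> lo + x ^ q"
proof (induction q)
  case 0
  have "kpow s P r i a \<le> 1" if "i < s" for i
  proof (cases "a < s")
    case True
    then have "kpow s P r i a \<le> (\<Sum>j<s. kpow s P r i j)"
      using kpow_nonneg[of s P, OF nn] that by (intro member_le_sum) auto
    then show ?thesis using kpow_sum[of s P, OF sum1] that by simp
  next
    case False
    have "kpow s P r i a = 0" using that
    proof (induction r arbitrary: i)
      case 0
      then show ?case using False by simp
    qed simp
    then show ?thesis by simp
  qed
  then show ?case using kpow_nonneg[of s P, OF nn] by (intro exI[of _ 0]) auto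
next
  case (Suc q)
  then obtain lo where lo: "\<And>i. i < s \<Longrightarrow> lo \<le> kpow s P (q * M + r) i a"
    "\<And>i. i < s \<Longrightarrow> kpow s P (q * M + r) i a \<le> lo + x ^ q" by blast
  let ?v = "\<lambda>k. kpow s P (q * M + r) k a"
  \<comment> \<open>The contribution common to all rows plus the least possible contribution of the
    remainder.\<close>
  define lo' where "lo' = e * (\<Sum>k<s. ?v k) + (1 - real s * e) * lo"
  have "lo' \<le> kpow s P (Suc q * M + r) i a \<and> kpow s P (Suc q * M + r) i a \<le> lo' + x ^ Suc q" if i: "i < s" for i
  proof -
    let ?Q = "\<lambda>k. kpow s P M i k - e"
    have Q: "0 \<le> ?Q k" if "k < s" for k using e[OF i that] by simp
    have sumQ: "(\<Sum>k<s. ?Q k) = 1 - real s * e"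
      using kpow_sum[of s P, OF sum1 i] by (simp add: sum_subtractf)
    have eq: "kpow s P (Suc q * M + r) i a = e * (\<Sum>k<s. ?v k) + (\<Sum>k<s. ?Q k * ?v k)"
      using kpow_add[OF i, of P M "q * M + r" a]
      by (simp add: add.assoc algebra_simps sum.distrib sum_subtractf sum_distrib_left)
    have "(\<Sum>k<s. ?Q k * lo) \<le> (\<Sum>k<s. ?Q k * ?v k)" using Q lo by (intro sum_mono mult_left_mono) auto
    then have 1: "(1 - real s * e) * lo \<le> (\<Sum>k<s. ?Q k * ?v k)" by (simp add: sumQ flip: sum_distrib_right)
    have "(\<Sum>k<s. ?Q k * ?v k) \<le> (\<Sum>k<s. ?Q k * (lo + x ^ q))" using Q lo by (intro sum_mono mult_left_mono) auto
    also have "\<dots> = (1 - real s * e) * lo + (1 - real s * e) * x ^ q"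
      unfolding sum_distrib_right[symmetric] sumQ by (simp add: distrib_left)
    also have "\<dots> \<le> (1 - real s * e) * lo + x * x ^ q" using x by (intro add_left_mono mult_right_mono) auto
    finally show ?thesis using 1 unfolding eq lo'_def by simp
  qed
  then show ?case by blast
qed

text \<open>A stationary \<open>p a\<close> is an average of column \<open>a\<close> over the rows,
  so it lies in the same short interval as the entries of that column. The constants are fixed
  before \<open>p\<close>, which is later supplied by the measure \<open>m\<close>.\<close>

lemma kpow_tendsto_stationary:
  assumes nn: "\<And>i j. i < s \<Longrightarrow> j < s \<Longrightarrow> 0 \<le> P i j" and sum1: "\<And>i. i < s \<Longrightarrow> (\<Sum>j<s. P i j) = 1"
    and pos: "\<And>i j. i < s \<Longrightarrow> j < s \<Longrightarrow> 0 < kpow s P M i j" and M: "0 < M" and s: "0 < s"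
  obtains C \<rho> where "0 < C" "0 < \<rho>" "\<rho> < 1"
    "\<And>p n i a. (\<And>i. i < s \<Longrightarrow> 0 \<le> p i) \<Longrightarrow> (\<Sum>i<s. p i) = 1 \<Longrightarrow>
       (\<And>j. j < s \<Longrightarrow> (\<Sum>i<s. p i * P i j) = p j) \<Longrightarrow> i < s \<Longrightarrow> a < s \<Longrightarrow>
       \<bar>kpow s P n i a - p a\<bar> \<le> C * \<rho> ^ n"
proof -
  define e where "e = Min ((\<lambda>(i, j). kpow s P M i j) ` ({..<s} \<times> {..<s}))"
  have ne: "(\<lambda>(i, j). kpow s P M i j) ` ({..<s} \<times> {..<s}) \<noteq> {}" using s by auto
  have e: "e \<le> kpow s P M i j" if "i < s" "j < s" for i j
    unfolding e_def using that by (intro Min_le) auto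
  have e0: "0 < e" unfolding e_def using ne pos by (subst Min_gr_iff) auto
  \<comment> \<open>The maximum with \<open>1 / 2\<close> keeps \<open>x\<close> positive when
    \<open>s * e = 1\<close>.\<close>
  define x where "x = max (1 / 2) (1 - real s * e)"
  have "0 < real s * e" using s e0 by simp
  then have x: "0 < x" "x < 1" "1 - real s * e \<le> x" by (auto simp: x_def)
  obtain C \<rho> where C: "0 < C" "0 < \<rho>" "\<rho> < 1" "\<And>n. x ^ (n div M) \<le> C * \<rho> ^ n"
    using power_div_le_geometric[OF x(1,2) M] by blast
  have "\<bar>kpow s P n i a - p a\<bar> \<le> C * \<rho> ^ n"
    if p: "\<And>i. i < s \<Longrightarrow> 0 \<le> p i" "(\<Sum>i<s. p i) = 1" "\<And>j. j < s \<Longrightarrow> (\<Sum>i<s. p i * P i j) = p j"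
      and i: "i < s" and a: "a < s" for p n i a
  proof -
    have stat: "p j = (\<Sum>k<s. p k * kpow s P n k j)" if "j < s" for j
      using that
    proof (induction n arbitrary: j)
      case 0
      then show ?case by (simp add: if_distrib[of "\<lambda>x. _ * x"] sum.delta cong: if_cong)
    next
      case (Suc n)
      have "(\<Sum>k<s. p k * kpow s P (Suc n) k j) = (\<Sum>l<s. (\<Sum>k<s. p k * P k l) * kpow s P n l j)"
        by (simp add: sum_distrib_left sum_distrib_right mult.assoc) (rule sum.swap)
      also have "\<dots> = (\<Sum>l<s. p l * kpow s P n l j)" by (intro sum.cong) (auto simp: p(3))
      also have "\<dots> = p j" using Suc by simp
      finally show ?case by simp
    qed
    have n: "n = (n div M) * M + n mod M" by simp
    obtain lo where lo: "\<And>i. i < s \<Longrightarrow> lo \<le> kpow s P n i a" "\<And>i. i < s \<Longrightarrow> kpow s P n i a \<le> lo + x ^ (n div M)"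
      using kpow_oscillation[of s P e M x "n div M" "n mod M" a, OF nn sum1 e _ x(3)] x(1) n by auto
    have "(\<Sum>k<s. p k * lo) \<le> p a" unfolding stat[OF a] using p lo by (intro sum_mono mult_left_mono) auto
    then have 1: "lo \<le> p a" by (simp add: p(2) flip: sum_distrib_right)
    have "p a \<le> (\<Sum>k<s. p k * (lo + x ^ (n div M)))"
      unfolding stat[OF a] using p lo by (intro sum_mono mult_left_mono) auto
    then have "p a \<le> lo + x ^ (n div M)" by (simp add: p(2) flip: sum_distrib_right)
    then have "\<bar>kpow s P n i a - p a\<bar> \<le> x ^ (n div M)" using 1 lo[OF i] by linarith
    then show ?thesis using C(4)[of n] by linarith
  qed
  then show ?thesis using that[OF C(1,2,3)] by blast
qed

lemma kpow_eigenvector: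
  assumes "\<And>i. i < s \<Longrightarrow> (\<Sum>j<s. a i j * r j) = l * r i"
  shows "i < s \<Longrightarrow> (\<Sum>j<s. kpow s a n i j * r j) = l ^ n * r i"
proof (induction n arbitrary: i)
  case 0
  then show ?case by (simp add: if_distrib[of "\<lambda>x. x * _"] sum.delta cong: if_cong)
next
  case (Suc n)
  have "(\<Sum>j<s. kpow s a (Suc n) i j * r j) = (\<Sum>k<s. a i k * (\<Sum>j<s. kpow s a n k j * r j))"
    by (simp add: sum_distrib_left sum_distrib_right mult.assoc) (rule sum.swap)
  also have "\<dots> = (\<Sum>k<s. a i k * (l ^ n * r k))" by (intro sum.cong) (auto simp: Suc.IH)
  also have "\<dots> = l ^ n * (\<Sum>k<s. a i k * r k)" by (simp add: sum_distrib_left mult_ac)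
  finally show ?case using assms[OF Suc.prems] by simp
qed

section \<open>The Perron eigenvector\<close>

text \<open>Vectors are sequences that vanish from \<open>s\<close> on; compactness then comes from
  the product topology.\<close>

definition simplex_vec :: "nat \<Rightarrow> (nat \<Rightarrow> real) set" where
  "simplex_vec s = {x. (\<forall>i. 0 \<le> x i) \<and> (\<forall>i\<ge>s. x i = 0) \<and> (\<Sum>i<s. x i) = 1}"

lemma continuous_on_snd_coord [continuous_intros]:
  "continuous_on UNIV (\<lambda>p :: real \<times> (nat \<Rightarrow> real). snd p i)"
  by (rule continuous_on_compose2[OF continuous_on_product_coordinates[of i] continuous_on_snd]) auto

text \<open>The eigenvector maximises the Collatz--Wielandt quotient: where the maximiser failed to be
  an eigenvector, applying a positive power of the matrix would improve the quotient.\<close>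

lemma perron_eigenvector:
  assumes nn: "\<And>i j. i < s \<Longrightarrow> j < s \<Longrightarrow> 0 \<le> a i j"
    and pos: "\<And>i j. i < s \<Longrightarrow> j < s \<Longrightarrow> 0 < kpow s a M i j" and M: "0 < M" and s: "0 < s"
  obtains l r where "0 < l" "\<And>i. i < s \<Longrightarrow> 0 < r i" "\<And>i. i < s \<Longrightarrow> (\<Sum>j<s. a i j * r j) = l * r i"
proof -
  define B where "B = (\<Sum>i<s. \<Sum>j<s. a i j)"
  \<comment> \<open>Pairs \<open>(t, x)\<close> with \<open>t * x\<close> below the image of
    \<open>x\<close> coordinatewise: this expresses the quotient without dividing by coordinates
    that may be 0.\<close>
  define S where "S = {p :: real \<times> (nat \<Rightarrow> real). 0 \<le> fst p \<and> snd p \<in> simplex_vec s \<and>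
    (\<forall>i. i < s \<longrightarrow> fst p * snd p i \<le> (\<Sum>j<s. a i j * snd p j))}"
  have x1: "x i \<le> 1" if "x \<in> simplex_vec s" for x i
  proof (cases "i < s")
    case True
    then have "x i \<le> (\<Sum>i<s. x i)" using that by (intro member_le_sum) (auto simp: simplex_vec_def)
    then show ?thesis using that by (simp add: simplex_vec_def)
  qed (use that in \<open>auto simp: simplex_vec_def\<close>)
  have bound: "t \<le> B" if "(t, x) \<in> S" for t x
  proof -
    have x: "x \<in> simplex_vec s" using that by (simp add: S_def)
    have "t = (\<Sum>i<s. t * x i)" using x by (simp add: simplex_vec_def flip: sum_distrib_left)
    also have "\<dots> \<le> (\<Sum>i<s. \<Sum>j<s. a i j * x j)" using that by (intro sum_mono) (auto simp: S_def)
    also have "\<dots> \<le> (\<Sum>i<s. \<Sum>j<s. a i j * 1)"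
      using nn x1[OF x] by (intro sum_mono mult_left_mono) auto
    finally show ?thesis by (simp add: B_def)
  qed
  have "compact S"
  proof -
    have "compact (PiE UNIV (\<lambda>_ :: nat. {0..1 :: real}))"
      using compactin_PiE[of "\<lambda>_ :: nat. euclidean :: real topology" UNIV "\<lambda>_. {0..1}"]
      by (simp add: euclidean_product_topology)
    then have "compact ({0..B} \<times> PiE UNIV (\<lambda>_ :: nat. {0..1 :: real}))"
      by (intro compact_Times) auto
    moreover have "S \<subseteq> {0..B} \<times> PiE UNIV (\<lambda>_ :: nat. {0..1 :: real})"
      using bound x1 by (auto simp: S_def simplex_vec_def)
    moreover have "closed S"
      unfolding S_def simplex_vec_def mem_Collect_eq
      by (intro closed_Collect_conj closed_Collect_all closed_Collect_imp open_Collect_const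
          closed_Collect_le closed_Collect_eq continuous_intros)
    ultimately show ?thesis by (metis compact_Int_closed inf.absorb2)
  qed
  moreover have "S \<noteq> {}"
  proof -
    have "(0, \<lambda>i. if i = 0 then 1 else 0) \<in> S"
      using s nn by (auto simp: S_def simplex_vec_def sum.delta intro!: sum_nonneg)
    then show ?thesis by blast
  qed
  ultimately obtain p where p: "p \<in> S" "\<And>q. q \<in> S \<Longrightarrow> fst q \<le> fst p"
    using continuous_attains_sup[of S fst] continuous_on_fst[OF continuous_on_id] by blast
  obtain t x where tx: "p = (t, x)" by (cases p)
  have t0: "0 \<le> t" and x: "x \<in> simplex_vec s" and ge: "\<And>i. i < s \<Longrightarrow> t * x i \<le> (\<Sum>j<s. a i j * x j)"
    using p(1) by (auto simp: S_def tx)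
  have x0: "0 \<le> x i" for i using x by (simp add: simplex_vec_def)
  have pos_apply: "0 < (\<Sum>j<s. kpow s a M i j * z j)"
    if "\<And>j. j < s \<Longrightarrow> 0 \<le> z j" "k < s" "0 < z k" "i < s" for z k i
  proof (rule sum_pos2[of _ k])
    show "0 < kpow s a M i k * z k" using pos that by simp
    show "0 \<le> kpow s a M i j * z j" if "j \<in> {..<s}" for j
      using pos[of i j] that \<open>i < s\<close> \<open>\<And>j. j < s \<Longrightarrow> 0 \<le> z j\<close> by (simp add: less_imp_le)
  qed (use that in auto)
  have "\<exists>k<s. 0 < x k"
  proof (rule ccontr)
    assume "\<not> (\<exists>k<s. 0 < x k)"
    then have "(\<Sum>i<s. x i) \<le> 0" by (intro sum_nonpos) (meson lessThan_iff not_less)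
    then show False using x by (simp add: simplex_vec_def)
  qed
  then obtain k0 where k0: "k0 < s" "0 < x k0" by blast
  \<comment> \<open>Applying the \<open>M\<close>-th power makes every coordinate positive, even
    where \<open>x\<close> vanishes.\<close>
  define y where "y i = (if i < s then \<Sum>j<s. kpow s a M i j * x j else 0)" for i
  have y: "0 < y i" if "i < s" for i unfolding y_def using that pos_apply[of x k0 i] x0 k0 by simp
  have eig: "(\<Sum>j<s. a i j * x j) = t * x i" if "i < s" for i
  proof (rule ccontr)
    assume ne: "(\<Sum>j<s. a i j * x j) \<noteq> t * x i"
    \<comment> \<open>The defect in the eigenvalue equation. As the matrix commutes with its
      \<open>M\<close>-th power, the defect at \<open>y\<close> is \<open>u\<close>, the image of
      \<open>z\<close>, which is positive in every coordinate.\<close>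
    define z where "z i = (\<Sum>j<s. a i j * x j) - t * x i" for i
    have z: "0 \<le> z j" if "j < s" for j using ge[OF that] by (simp add: z_def)
    have zi: "0 < z i" using z[OF that] ne by (simp add: z_def)
    define u where "u k = (\<Sum>j<s. kpow s a M k j * z j)" for k
    have u: "0 < u k" if "k < s" for k unfolding u_def using pos_apply[of z i k] z \<open>i < s\<close> zi that by simp
    have Ay: "(\<Sum>j<s. a k j * y j) = t * y k + u k" if "k < s" for k
    proof -
      have "(\<Sum>j<s. a k j * y j) = (\<Sum>l<s. (\<Sum>j<s. a k j * kpow s a M j l) * x l)"
        by (simp add: y_def sum_distrib_left sum_distrib_right mult.assoc) (rule sum.swap)
      also have "\<dots> = (\<Sum>l<s. (\<Sum>j<s. kpow s a M k j * a j l) * x l)"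
        using kpow_Suc_right[OF that, of _ a M] by (intro sum.cong) auto
      also have "\<dots> = (\<Sum>j<s. kpow s a M k j * (\<Sum>l<s. a j l * x l))"
        by (simp add: sum_distrib_left sum_distrib_right mult.assoc) (rule sum.swap)
      also have "\<dots> = t * y k + u k" using that
        by (simp add: y_def u_def z_def right_diff_distrib sum_subtractf sum_distrib_left mult_ac)
      finally show ?thesis .
    qed
    \<comment> \<open>The least relative slack: at the normalised \<open>y\<close> the value
      \<open>t\<close> can be raised by \<open>d\<close>, against its maximality.\<close>
    define d where "d = Min ((\<lambda>k. u k / y k) ` {..<s})"
    have ne: "(\<lambda>k. u k / y k) ` {..<s} \<noteq> {}" using s by auto
    have d: "0 < d" unfolding d_def using ne u y by (subst Min_gr_iff) auto
    have du: "d * y k \<le> u k" if "k < s" for k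
    proof -
      have "d \<le> u k / y k" unfolding d_def using that by (intro Min_le) auto
      then show ?thesis using y[OF that] by (simp add: field_simps)
    qed
    define n where "n = (\<Sum>i<s. y i)"
    have n: "0 < n" unfolding n_def using s y by (intro sum_pos) auto
    have "(t + d, \<lambda>i. y i / n) \<in> S"
    proof -
      have "(t + d) * (y k / n) \<le> (\<Sum>j<s. a k j * (y j / n))" if "k < s" for k
      proof -
        have "(\<Sum>j<s. a k j * (y j / n)) = (\<Sum>j<s. a k j * y j) / n" by (simp add: sum_divide_distrib)
        also have "\<dots> = (t * y k + u k) / n" using Ay[OF that] by simp
        also have "\<dots> \<ge> (t + d) * y k / n"
          using du[OF that] n by (intro divide_right_mono) (auto simp: algebra_simps)
        finally show ?thesis by simp
      qed
      moreover have "0 \<le> y k" for k using y[of k] by (cases "k < s") (auto simp: y_def less_imp_le)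
      moreover have "(\<Sum>i<s. y i / n) = 1" using n by (simp add: n_def flip: sum_divide_distrib)
      ultimately show ?thesis using t0 d n
        by (auto simp: S_def simplex_vec_def y_def)
    qed
    from p(2)[OF this] show False using d by (simp add: tx)
  qed
  \<comment> \<open>The positive vector \<open>y\<close> is now a multiple of \<open>x\<close>, so
    both the factor \<open>t ^ M\<close> and all coordinates of \<open>x\<close> must be
    positive.\<close>
  have pw: "y i = t ^ M * x i" if "i < s" for i
    unfolding y_def using that kpow_eigenvector[of s a x t, OF eig that] by simp
  have "0 < t ^ M * x 0" using y[OF s] pw[OF s] by simp
  then have "t \<noteq> 0" using M by (auto simp: zero_power)
  then have "0 < t" using t0 by simp
  moreover have "0 < x i" if "i < s" for i
    using y[OF that] pw[OF that] \<open>0 < t\<close> by (simp add: zero_less_mult_iff)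
  ultimately show ?thesis using that eig by blast
qed

lemma pow_mat_eq_kpow:
  assumes A: "A \<in> carrier_mat s s" and "i < s" "j < s"
  shows "(A ^\<^sub>m n) $$ (i, j) = kpow s (\<lambda>i j. A $$ (i, j)) n i j"
  using assms(2,3)
proof (induction n arbitrary: i j)
  case (Suc n)
  have An: "A ^\<^sub>m n \<in> carrier_mat s s" using A by simp
  have "(A ^\<^sub>m Suc n) $$ (i, j) = (\<Sum>k<s. (A ^\<^sub>m n) $$ (i, k) * A $$ (k, j))"
    using A An Suc.prems by (simp add: scalar_prod_def lessThan_atLeast0)
  also have "\<dots> = (\<Sum>k<s. kpow s (\<lambda>i j. A $$ (i, j)) n i k * A $$ (k, j))"
    using Suc by (intro sum.cong) auto
  also have "\<dots> = kpow s (\<lambda>i j. A $$ (i, j)) (Suc n) i j" by (rule kpow_Suc_right[OF Suc.prems, symmetric])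
  finally show ?case .
qed (use A in auto)

text \<open>With a unit diagonal a path may wait at its starting point, so an entry that is positive
  in some power stays positive in all higher ones.\<close>

lemma primitive_matrix:
  assumes A: "transition_matrix s A" "irreducible_mat A" "aperiodic_mat A"
  obtains M where "0 < M" "\<And>i j. i < s \<Longrightarrow> j < s \<Longrightarrow> 0 < kpow s (\<lambda>i j. A $$ (i, j)) M i j"
proof -
  let ?a = "\<lambda>i j. A $$ (i, j)"
  have c: "A \<in> carrier_mat s s" and row: "dim_row A = s" using A(1) by (auto simp: transition_matrix_def)
  have nn: "0 \<le> ?a i j" if "i < s" "j < s" for i j using A(1) that by (force simp: transition_matrix_def)
  have step: "kpow s ?a n i j \<le> kpow s ?a (Suc n) i j" if "i < s" for n i j
  proof -
    have "A $$ (i, i) * kpow s ?a n i j \<le> kpow s ?a (Suc n) i j"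
      unfolding kpow.simps using that nn kpow_nonneg[of s ?a, OF nn]
      by (intro member_le_sum[of i _ "\<lambda>k. A $$ (i, k) * kpow s ?a n k j"]) auto
    then show ?thesis using A(3) that by (simp add: aperiodic_mat_def row)
  qed
  have mono: "kpow s ?a n i j \<le> kpow s ?a m i j" if "i < s" "n \<le> m" for n m i j
    using \<open>n \<le> m\<close> by (induction rule: dec_induct) (use step[OF \<open>i < s\<close>] in \<open>auto intro: order_trans simp del: kpow.simps\<close>)
  have "\<forall>i<s. \<forall>j<s. \<exists>n. 0 < kpow s ?a n i j"
    using A(2) unfolding irreducible_mat_def row by (metis pow_mat_eq_kpow[OF c])
  then obtain N where N: "\<And>i j. i < s \<Longrightarrow> j < s \<Longrightarrow> 0 < kpow s ?a (N i j) i j" by metis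
  \<comment> \<open>The sum dominates all exponents \<open>N i j\<close> at once, and
    \<open>Suc\<close> makes it positive.\<close>
  define M where "M = Suc (\<Sum>i<s. \<Sum>j<s. N i j)"
  have "N i j \<le> M" if "i < s" "j < s" for i j
  proof -
    have "N i j \<le> (\<Sum>j<s. N i j)" using that by (intro member_le_sum) auto
    also have "\<dots> \<le> (\<Sum>i<s. \<Sum>j<s. N i j)" using that by (intro member_le_sum[of i]) auto
    finally show ?thesis by (simp add: M_def)
  qed
  then have "0 < kpow s ?a M i j" if "i < s" "j < s" for i j
    using N[OF that] mono[OF that(1), of "N i j" M j] that by fastforce
  then show ?thesis using that[of M] by (simp add: M_def del: kpow.simps)
qed

section \<open>Words and the Parry chain\<close>

definition words :: "nat \<Rightarrow> nat \<Rightarrow> nat list set" where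
  "words s n = {w. set w \<subseteq> {..<s} \<and> length w = n}"

lemma finite_words [simp]: "finite (words s n)"
  unfolding words_def by (rule finite_lists_length_eq) simp

lemma words_0 [simp]: "words s 0 = {[]}"
  by (auto simp: words_def)

lemma words_SucD:
  assumes "w \<in> words s (Suc n)"
  shows "w \<noteq> []" "set w \<subseteq> {..<s}" "hd w < s" "last w < s"
proof -
  show "w \<noteq> []" "set w \<subseteq> {..<s}" using assms by (auto simp: words_def)
  then show "hd w < s" "last w < s" by (metis hd_in_set lessThan_iff subsetD, metis last_in_set lessThan_iff subsetD)
qed

lemma sum_words_Cons: "(\<Sum>w\<in>words s (Suc n). f w) = (\<Sum>a<s. \<Sum>w\<in>words s n. f (a # w))"
proof -
  have eq: "words s (Suc n) = (\<lambda>(a, w). a # w) ` ({..<s} \<times> words s n)"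
    by (auto simp: words_def length_Suc_conv image_iff)
  have inj: "inj_on (\<lambda>(a, w). a # w) ({..<s} \<times> words s n)" by (auto simp: inj_on_def)
  show ?thesis unfolding eq sum.reindex[OF inj] by (simp add: sum.cartesian_product case_prod_beta o_def)
qed

lemma sum_words_snoc: "(\<Sum>w\<in>words s (Suc n). f w) = (\<Sum>w\<in>words s n. \<Sum>a<s. f (w @ [a]))"
proof -
  have eq: "words s (Suc n) = (\<lambda>(w, a). w @ [a]) ` (words s n \<times> {..<s})"
  proof (intro equalityI subsetI)
    fix w assume "w \<in> words s (Suc n)"
    then show "w \<in> (\<lambda>(w, a). w @ [a]) ` (words s n \<times> {..<s})"
      by (cases w rule: rev_cases) (auto simp: words_def)
  qed (auto simp: words_def)
  have inj: "inj_on (\<lambda>(w, a). w @ [a]) (words s n \<times> {..<s})" by (auto simp: inj_on_def)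
  show ?thesis unfolding eq sum.reindex[OF inj] by (simp add: sum.cartesian_product case_prod_beta o_def)
qed

fun chain :: "(nat \<Rightarrow> nat \<Rightarrow> real) \<Rightarrow> nat list \<Rightarrow> real" where
  "chain P [] = 1"
| "chain P [a] = 1"
| "chain P (a # b # w) = P a b * chain P (b # w)"

lemma chain_append: "w \<noteq> [] \<Longrightarrow> chain P (w @ v) = chain P w * chain P (last w # v)"
  by (induction P w rule: chain.induct) auto

lemma chain_snoc: "w \<noteq> [] \<Longrightarrow> chain P (w @ [a]) = chain P w * P (last w) a"
  by (simp add: chain_append)

text \<open>The path expansion of a matrix power; \<open>k\<close> intermediate letters mean
  \<open>k + 1\<close> transitions.\<close>

lemma sum_chain_kpow: "b < s \<Longrightarrow> (\<Sum>v\<in>words s k. chain P (a # v @ [b])) = kpow s P (Suc k) a b"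
proof (induction k arbitrary: a)
  case 0
  then show ?case by (simp add: if_distrib[of "\<lambda>x. _ * x"] sum.delta cong: if_cong)
next
  case (Suc k)
  then show ?case by (simp add: sum_words_Cons flip: sum_distrib_left)
qed

lemma sum_chain:
  assumes "\<And>i. i < s \<Longrightarrow> (\<Sum>j<s. P i j) = 1"
  shows "a < s \<Longrightarrow> (\<Sum>v\<in>words s k. chain P (a # v)) = 1"
proof (induction k arbitrary: a)
  case (Suc k)
  then show ?case using assms by (simp add: sum_words_Cons flip: sum_distrib_left)
qed simp

section \<open>The Parry chain and the growth of the number of words\<close>

locale parry_chain =
  fixes s :: nat and A :: "real mat" and l :: real and r :: "nat \<Rightarrow> real"
  assumes s_pos: "0 < s" and A01: "transition_matrix s A" and l_pos: "0 < l"
    and r_pos: "\<And>i. i < s \<Longrightarrow> 0 < r i"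
    and eigen: "\<And>i. i < s \<Longrightarrow> (\<Sum>j<s. A $$ (i, j) * r j) = l * r i"
begin

definition P :: "nat \<Rightarrow> nat \<Rightarrow> real" where
  "P i j = A $$ (i, j) * r j / (l * r i)"

definition admissible :: "nat list \<Rightarrow> bool" where
  "admissible w \<longleftrightarrow> successively (\<lambda>i j. A $$ (i, j) = 1) w"

lemma A_cases: "i < s \<Longrightarrow> j < s \<Longrightarrow> A $$ (i, j) = 0 \<or> A $$ (i, j) = 1"
  using A01 by (auto simp: transition_matrix_def)

lemma P_nonneg: "i < s \<Longrightarrow> j < s \<Longrightarrow> 0 \<le> P i j"
  using A_cases[of i j] r_pos l_pos by (auto simp: P_def less_imp_le)

lemma P_sum: "i < s \<Longrightarrow> (\<Sum>j<s. P i j) = 1"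
  using eigen[of i] r_pos[of i] l_pos by (simp add: P_def flip: sum_divide_distrib)

text \<open>\<open>P\<close> is conjugate to \<open>A / l\<close> by the diagonal matrix of
  \<open>r\<close>; the relation is multiplied out to be free of division.\<close>

lemma kpow_P: "i < s \<Longrightarrow> kpow s P n i j * (l ^ n * r i) = kpow s (\<lambda>i j. A $$ (i, j)) n i j * r j"
proof (induction n arbitrary: i)
  case (Suc n)
  have "kpow s P (Suc n) i j * (l ^ Suc n * r i)
      = (\<Sum>k<s. A $$ (i, k) * (kpow s P n k j * (l ^ n * r k)))"
    unfolding kpow.simps sum_distrib_right using r_pos[OF Suc.prems] l_pos
    by (intro sum.cong refl) (simp add: P_def)
  also have "\<dots> = (\<Sum>k<s. A $$ (i, k) * (kpow s (\<lambda>i j. A $$ (i, j)) n k j * r j))"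
    by (intro sum.cong) (auto simp: Suc.IH)
  also have "\<dots> = kpow s (\<lambda>i j. A $$ (i, j)) (Suc n) i j * r j"
    by (simp add: sum_distrib_right mult.assoc)
  finally show ?case .
qed simp

lemma kpow_P_pos: "i < s \<Longrightarrow> j < s \<Longrightarrow> 0 < kpow s (\<lambda>i j. A $$ (i, j)) n i j \<Longrightarrow> 0 < kpow s P n i j"
  using kpow_P[of i n j] r_pos[of i] r_pos[of j] l_pos
  by (metis mult_pos_pos zero_less_mult_pos2 zero_less_power)

text \<open>The factors \<open>r j / r i\<close> telescope, so the weight of an admissible word
  depends only on its length and its two end letters.\<close>

lemma chain_P:
  "w \<noteq> [] \<Longrightarrow> set w \<subseteq> {..<s} \<Longrightarrow>
    chain P w = (if admissible w then r (last w) / (l ^ (length w - 1) * r (hd w)) else 0)"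
proof (induction P w rule: chain.induct)
  case (2 a)
  then show ?case using r_pos[of a] by (simp add: admissible_def)
next
  case (3 a b w)
  then show ?case using A_cases[of a b] r_pos[of a] r_pos[of b] l_pos
    by (auto simp: admissible_def P_def)
qed simp

lemma chain_P_nonneg: "set w \<subseteq> {..<s} \<Longrightarrow> 0 \<le> chain P w"
proof (cases "w = []")
  case False
  assume "set w \<subseteq> {..<s}"
  then show ?thesis using r_pos l_pos False last_in_set[of w] hd_in_set[of w]
    by (auto simp: chain_P less_imp_le subset_iff)
qed simp

text \<open>The chain weights of the words of length \<open>n + 1\<close> add up to
  \<open>s\<close>, one for each first letter, while each admissible word weighs
  \<open>1 / l ^ n\<close> up to the bounded factor \<open>r (last w) / r (hd w)\<close>.\<close>

lemma card_admissible_bounds: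
  obtains \<kappa> where "0 < \<kappa>"
    "\<And>n. l ^ n / \<kappa> \<le> real (card {w \<in> words s (Suc n). admissible w})"
    "\<And>n. real (card {w \<in> words s (Suc n). admissible w}) \<le> \<kappa> * l ^ n"
proof -
  define hi where "hi = Max (r ` {..<s})"
  define lo where "lo = Min (r ` {..<s})"
  have ne: "r ` {..<s} \<noteq> {}" using s_pos by auto
  have lo: "0 < lo" unfolding lo_def using ne r_pos by (subst Min_gr_iff) auto
  have lor: "lo \<le> r i" if "i < s" for i unfolding lo_def using that by (intro Min_le) auto
  have hir: "r i \<le> hi" if "i < s" for i unfolding hi_def using that by (intro Max_ge) auto
  have hi: "lo \<le> hi" using lor[OF s_pos] hir[OF s_pos] by simp
  define k where "k = hi / lo"
  have k: "1 \<le> k" using hi lo by (simp add: k_def)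
  have eq: "real s * l ^ n = (\<Sum>w\<in>{w \<in> words s (Suc n). admissible w}. r (last w) / r (hd w))" for n
  proof -
    have chain: "chain P w = (if admissible w then r (last w) / (l ^ n * r (hd w)) else 0)"
      if "w \<in> words s (Suc n)" for w
      using chain_P[OF words_SucD(1,2)[OF that]] that by (simp add: words_def)
    have "real s = (\<Sum>w\<in>words s (Suc n). chain P w)"
      using sum_chain[of s P, OF P_sum] by (simp add: sum_words_Cons)
    also have "\<dots> = (\<Sum>w\<in>{w \<in> words s (Suc n). admissible w}. r (last w) / (l ^ n * r (hd w)))"
      by (intro sum.mono_neutral_cong_right) (auto simp: chain)
    finally show ?thesis using l_pos
      by (simp add: sum_distrib_right)
  qed
  have rat: "1 / k \<le> r j / r i \<and> r j / r i \<le> k" if "i < s" "j < s" for i j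
    using lor[OF that(1)] lor[OF that(2)] hir[OF that(1)] hir[OF that(2)] lo hi
    unfolding k_def by (auto intro!: frac_le)
  have rw: "1 / k \<le> r (last w) / r (hd w) \<and> r (last w) / r (hd w) \<le> k" if "w \<in> words s (Suc n)" for w n
    by (intro rat words_SucD[OF that])
  have up: "real s * l ^ n \<le> real (card {w \<in> words s (Suc n). admissible w}) * k" for n
    unfolding eq using rw by (intro sum_bounded_above) auto
  have low: "real (card {w \<in> words s (Suc n). admissible w}) * (1 / k) \<le> real s * l ^ n" for n
    unfolding eq using rw by (intro sum_bounded_below) auto
  show ?thesis
  \<comment> \<open>One constant for both directions: the upper bound needs \<open>k * s\<close>,
    and the lower bound \<open>s * l ^ n / k\<close> is weakened by
    \<open>1 / s \<le> s\<close>.\<close>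
  proof (rule that[of "k * real s"])
    show "0 < k * real s" using k s_pos by simp
    fix n
    have "1 / real s \<le> real s" using s_pos by (rule_tac order_trans[of _ 1]) auto
    then have "l ^ n / k * (1 / real s) \<le> l ^ n / k * real s"
      using k l_pos by (intro mult_left_mono) auto
    then have "l ^ n / (k * real s) \<le> l ^ n * real s / k" by simp
    also have "\<dots> \<le> real (card {w \<in> words s (Suc n). admissible w})"
      using up[of n] k by (simp add: field_simps)
    finally show "l ^ n / (k * real s) \<le> real (card {w \<in> words s (Suc n). admissible w})" .
    show "real (card {w \<in> words s (Suc n). admissible w}) \<le> k * real s * l ^ n"
      using low[of n] k by (simp add: field_simps)
  qed
qed

lemma word_growth:
  "(\<lambda>n. ln (real (card {w \<in> words s n. admissible w})) / real n) \<longlonglongrightarrow> ln l"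
proof -
  let ?N = "\<lambda>n. real (card {w \<in> words s (Suc n). admissible w})"
  obtain k where k: "0 < k" "\<And>n. l ^ n / k \<le> ?N n" "\<And>n. ?N n \<le> k * l ^ n"
    using card_admissible_bounds by blast
  have lower: "(real n * ln l - ln k) / real (Suc n) \<le> ln (?N n) / real (Suc n)" for n
  proof -
    have "real n * ln l - ln k = ln (l ^ n / k)" using k(1) l_pos by (simp add: ln_div ln_realpow)
    also have "\<dots> \<le> ln (?N n)" using k l_pos
      by (intro ln_mono) (auto intro: less_le_trans[OF _ k(2)])
    finally show ?thesis by (intro divide_right_mono) auto
  qed
  have upper: "ln (?N n) / real (Suc n) \<le> (real n * ln l + ln k) / real (Suc n)" for n
  proof -
    have "0 < l ^ n / k" using k(1) l_pos by simp
    then have "ln (?N n) \<le> ln (k * l ^ n)" using k(2)[of n] k(3)[of n] by (intro ln_mono) linarith+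
    also have "\<dots> = real n * ln l + ln k" using k(1) l_pos by (simp add: ln_mult ln_realpow)
    finally show ?thesis by (intro divide_right_mono) auto
  qed
  have lim: "(\<lambda>n. (real n * L + c) / real (Suc n)) \<longlonglongrightarrow> L" for L c :: real
    by real_asymp
  have "(\<lambda>n. ln (?N n) / real (Suc n)) \<longlonglongrightarrow> ln l"
    by (rule tendsto_sandwich[OF _ _ lim[of "ln l" "- ln k"] lim[of "ln l" "ln k"]])
      (use lower upper in auto)
  then show ?thesis by (rule LIMSEQ_imp_Suc)
qed

end

section \<open>Laws of words and the extremal case\<close>

text \<open>\<open>p w\<close> stands for the measure of the cylinder of \<open>w\<close>:
  \<open>p_snoc\<close> splits it by the next letter, and \<open>p_Cons\<close>, which splits by the
  preceding letter, expresses invariance.\<close>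

locale word_process = parry_chain +
  fixes p :: "nat list \<Rightarrow> real"
  assumes p_nonneg: "\<And>w. 0 \<le> p w" and p_Nil: "p [] = 1"
    and p_snoc: "\<And>w. (\<Sum>a<s. p (w @ [a])) = p w" and p_Cons: "\<And>w. (\<Sum>a<s. p (a # w)) = p w"
    and p_admissible: "\<And>w. 0 < p w \<Longrightarrow> admissible w"
begin

definition word_ent :: "nat \<Rightarrow> real" where
  "word_ent n = - (\<Sum>w\<in>words s n. p w * ln (p w))"

lemma sum_p_append: "(\<Sum>w\<in>words s n. p (w @ v)) = p v"
proof (induction n arbitrary: v)
  case (Suc n)
  have "(\<Sum>w\<in>words s (Suc n). p (w @ v)) = (\<Sum>a<s. p (a # v))"
    by (simp add: sum_words_snoc) (subst sum.swap, simp add: Suc)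
  then show ?case by (simp add: p_Cons)
qed simp

lemma sum_p: "(\<Sum>w\<in>words s n. p w) = 1"
  using sum_p_append[where v = "[]"] by (simp add: p_Nil)

text \<open>The last letter of a word of any positive length has the law of a single letter. This
  makes the terms with \<open>ln (r a)\<close> and \<open>ln (r (last w))\<close> cancel in
  \<open>p_markov\<close>.\<close>

lemma sum_p_last: "(\<Sum>w\<in>words s (Suc n). p w * g (last w)) = (\<Sum>a<s. p [a] * g a)"
  by (simp add: sum_words_snoc) (subst sum.swap, simp add: sum_p_append flip: sum_distrib_right)

lemma p_snoc_le: "a < s \<Longrightarrow> p (w @ [a]) \<le> p w"
  using member_le_sum[of a "{..<s}" "\<lambda>a. p (w @ [a])"] p_nonneg by (simp add: p_snoc)

text \<open>The conditional entropy of the next letter given a word is at most \<open>ln l\<close>; this is the Gibbs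
  inequality against the kernel \<open>P\<close>, so extremality forces the conditional law to be \<open>P\<close>.\<close>

lemma p_markov:
  assumes ent: "ln l \<le> word_ent (Suc (Suc n)) - word_ent (Suc n)"
    and w: "w \<in> words s (Suc n)" and a: "a < s"
  shows "p (w @ [a]) = p w * P (last w) a"
proof -
  let ?S = "words s (Suc n) \<times> {..<s}"
  let ?p = "\<lambda>(w, a). p (w @ [a])" and ?q = "\<lambda>(w, a). p w * P (last w) a"
  have last: "last w < s" "w \<noteq> []" if "w \<in> words s (Suc n)" for w
    using words_SucD[OF that] by auto
  have A1: "A $$ (last w, a) = 1" if "0 < p (w @ [a])" "w \<in> words s (Suc n)" for w a
    using p_admissible[OF that(1)] last(2)[OF that(2)] by (simp add: admissible_def successively_append_iff)
  have qpos: "0 < p w \<and> 0 < P (last w) a" if "0 < p (w @ [a])" "w \<in> words s (Suc n)" "a < s" for w a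
    using p_snoc_le[OF that(3), of w] that(1) A1[OF that(1,2)] r_pos[OF that(3)] r_pos[OF last(1)[OF that(2)]] l_pos
    by (auto simp: P_def)
  have sump: "sum ?p ?S = 1"
    using sum_p[of "Suc (Suc n)"] by (simp add: sum_words_snoc[where n = "Suc n"] sum.cartesian_product)
  have "sum ?q ?S = (\<Sum>w\<in>words s (Suc n). p w * (\<Sum>a<s. P (last w) a))"
    by (simp add: sum.cartesian_product[symmetric] sum_distrib_left)
  also have "\<dots> = (\<Sum>w\<in>words s (Suc n). p w)" using last by (intro sum.cong) (auto simp: P_sum)
  finally have sumq: "sum ?q ?S = 1" by (simp add: sum_p)
  \<comment> \<open>Where \<open>p (w @ [a])\<close> is positive the entry of \<open>A\<close> is 1,
    so \<open>ln (P (last w) a)\<close> splits into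
    \<open>ln (r a) - ln (r (last w)) - ln l\<close>.\<close>
  have "(\<Sum>x\<in>?S. ?p x * ln (?p x / ?q x)) = (\<Sum>w\<in>words s (Suc n). \<Sum>a<s.
      p (w @ [a]) * ln (p (w @ [a])) - p (w @ [a]) * ln (p w)
      - p (w @ [a]) * ln (r a) + p (w @ [a]) * ln (r (last w)) + p (w @ [a]) * ln l)"
    unfolding sum.cartesian_product
  proof (intro sum.cong refl)
    fix x assume "x \<in> ?S"
    then obtain w a where x: "x = (w, a)" "w \<in> words s (Suc n)" "a < s" by auto
    have "?p (w, a) * ln (?p (w, a) / ?q (w, a)) = p (w @ [a]) * ln (p (w @ [a])) - p (w @ [a]) * ln (p w)
      - p (w @ [a]) * ln (r a) + p (w @ [a]) * ln (r (last w)) + p (w @ [a]) * ln l"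
    proof (cases "p (w @ [a]) = 0")
      case False
      then have pos: "0 < p (w @ [a])" using p_nonneg[of "w @ [a]"] by simp
      then show ?thesis using qpos[OF pos x(2,3)] A1[OF pos x(2)] r_pos[OF x(3)] r_pos[OF last(1)[OF x(2)]] l_pos
        by (simp add: P_def ln_div ln_mult algebra_simps)
    qed simp
    then show "?p x * ln (?p x / ?q x) = (case x of (w, a) \<Rightarrow> p (w @ [a]) * ln (p (w @ [a])) - p (w @ [a]) * ln (p w)
      - p (w @ [a]) * ln (r a) + p (w @ [a]) * ln (r (last w)) + p (w @ [a]) * ln l)"
      unfolding x(1) by simp
  qed
  also have "\<dots> = (\<Sum>w\<in>words s (Suc n). \<Sum>a<s. p (w @ [a]) * ln (p (w @ [a])))
      - (\<Sum>w\<in>words s (Suc n). p w * ln (p w))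
      - (\<Sum>w\<in>words s (Suc n). \<Sum>a<s. p (w @ [a]) * ln (r a))
      + (\<Sum>w\<in>words s (Suc n). p w * ln (r (last w))) + (\<Sum>w\<in>words s (Suc n). p w) * ln l"
    by (simp only: sum.distrib sum_subtractf sum_distrib_right[symmetric] p_snoc)
  also have "(\<Sum>w\<in>words s (Suc n). \<Sum>a<s. p (w @ [a]) * ln (p (w @ [a]))) = - word_ent (Suc (Suc n))"
    by (simp add: word_ent_def sum_words_snoc[where n = "Suc n"])
  also have "(\<Sum>w\<in>words s (Suc n). p w * ln (p w)) = - word_ent (Suc n)" by (simp add: word_ent_def)
  also have "(\<Sum>w\<in>words s (Suc n). \<Sum>a<s. p (w @ [a]) * ln (r a)) = (\<Sum>a<s. p [a] * ln (r a))"
    using sum_p_last[where n = "Suc n" and g = "\<lambda>a. ln (r a)"] by (simp add: sum_words_snoc[where n = "Suc n"])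
  also have "(\<Sum>w\<in>words s (Suc n). p w * ln (r (last w))) = (\<Sum>a<s. p [a] * ln (r a))"
    by (rule sum_p_last)
  finally have le: "(\<Sum>x\<in>?S. ?p x * ln (?p x / ?q x)) \<le> 0" using ent by (simp add: sum_p)
  have "?p (w, a) = ?q (w, a)"
  proof (rule gibbs_equality[of ?S ?p ?q])
    show "0 \<le> ?p x" for x by (auto simp: p_nonneg split: prod.split)
    show "0 \<le> ?q x" if "x \<in> ?S" for x
      using that last by (auto simp: p_nonneg intro!: mult_nonneg_nonneg P_nonneg)
    show "0 < ?q x" if "x \<in> ?S" "0 < ?p x" for x using that qpos by auto
  qed (use sump sumq le w a in auto)
  then show ?thesis by simp
qed

end

text \<open>The increments start at words of length 1, since the kernel needs a last letter to move
  from.\<close>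

locale extremal_word_process = word_process +
  assumes extremal: "\<And>n. ln l \<le> word_ent (Suc (Suc n)) - word_ent (Suc n)"
begin

lemma p_eq_chain: "w \<noteq> [] \<Longrightarrow> set w \<subseteq> {..<s} \<Longrightarrow> p w = p [hd w] * chain P w"
proof (induction w rule: rev_induct)
  case (snoc a w)
  show ?case
  proof (cases "w = []")
    case False
    then obtain n where "length w = Suc n" by (cases w) auto
    then have "w \<in> words s (Suc n)" "a < s" using snoc.prems by (auto simp: words_def)
    from p_markov[OF extremal this] show ?thesis using snoc False by (simp add: chain_snoc)
  qed simp
qed simp

lemma p_stationary: "j < s \<Longrightarrow> (\<Sum>i<s. p [i] * P i j) = p [j]"
proof -
  assume j: "j < s"
  have "(\<Sum>i<s. p [i] * P i j) = (\<Sum>i<s. p (i # [j]))"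
    using j p_eq_chain[of "[i, j]" for i] by (intro sum.cong) simp_all
  then show ?thesis by (simp only: p_Cons)
qed

lemma sum_p_single: "(\<Sum>i<s. p [i]) = 1"
  using sum_p[of 1] by (simp add: sum_words_Cons)

text \<open>\<open>q\<close> will be the frequency of words along the periodic points, \<open>tr\<close> the trace of \<open>P ^ n\<close>.\<close>

lemma word_total_variation:
  assumes M: "0 < M" and pos: "\<And>i j. i < s \<Longrightarrow> j < s \<Longrightarrow> 0 < kpow s P M i j"
  obtains C \<rho> where "0 < C" "0 < \<rho>" "\<rho> < 1"
    "\<And>n k q tr. tr = (\<Sum>i<s. kpow s P n i i) \<Longrightarrow> 0 < tr \<Longrightarrow> k < n \<Longrightarrow>
       (\<And>w. w \<in> words s (Suc k) \<Longrightarrow> 0 \<le> q w) \<Longrightarrow> (\<Sum>w\<in>words s (Suc k). q w) = 1 \<Longrightarrow>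
       (\<And>w. w \<in> words s (Suc k) \<Longrightarrow> q w * tr = chain P w * kpow s P (n - k) (last w) (hd w)) \<Longrightarrow>
       (\<Sum>w\<in>words s (Suc k). \<bar>p w - q w\<bar>) \<le> C * \<rho> ^ (n - k)"
proof -
  obtain C \<rho> where C: "0 < C" "0 < \<rho>" "\<rho> < 1"
    and stat: "\<And>\<pi> n i a. (\<And>i. i < s \<Longrightarrow> 0 \<le> \<pi> i) \<Longrightarrow> (\<Sum>i<s. \<pi> i) = 1 \<Longrightarrow>
       (\<And>j. j < s \<Longrightarrow> (\<Sum>i<s. \<pi> i * P i j) = \<pi> j) \<Longrightarrow> i < s \<Longrightarrow> a < s \<Longrightarrow>
       \<bar>kpow s P n i a - \<pi> a\<bar> \<le> C * \<rho> ^ n"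
    using kpow_tendsto_stationary[of s P M, OF P_nonneg P_sum pos M s_pos] by blast
  have conv: "\<bar>kpow s P n i a - p [a]\<bar> \<le> C * \<rho> ^ n" if "i < s" "a < s" for n i a
    by (rule stat[of "\<lambda>i. p [i]"]) (use that in \<open>simp_all add: p_nonneg sum_p_single p_stationary\<close>)
  \<comment> \<open>Large enough for both cases below: \<open>4 * s * C\<close> would do when the
    trace is far from 1, and \<open>2 * s * (1 + s) * C\<close> otherwise.\<close>
  let ?C = "4 * real s * (1 + real s) * C"
  have s1: "1 \<le> real s" using s_pos by simp
  have "(\<Sum>w\<in>words s (Suc k). \<bar>p w - q w\<bar>) \<le> ?C * \<rho> ^ (n - k)"
    if tr: "tr = (\<Sum>i<s. kpow s P n i i)" "0 < tr" and k: "k < n"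
      and q: "\<And>w. w \<in> words s (Suc k) \<Longrightarrow> 0 \<le> q w" "(\<Sum>w\<in>words s (Suc k). q w) = 1"
      "\<And>w. w \<in> words s (Suc k) \<Longrightarrow> q w * tr = chain P w * kpow s P (n - k) (last w) (hd w)" for n k q tr
  proof -
    let ?e = "C * \<rho> ^ (n - k)"
    have e: "0 < ?e" using C by simp
    have "\<bar>tr - 1\<bar> = \<bar>\<Sum>i<s. kpow s P n i i - p [i]\<bar>" by (simp add: tr sum_subtractf sum_p_single)
    also have "\<dots> \<le> (\<Sum>i<s. C * \<rho> ^ n)" by (intro order_trans[OF sum_abs] sum_mono conv) auto
    also have "\<dots> \<le> (\<Sum>i<s. ?e)" using C by (intro sum_mono mult_left_mono power_decreasing) auto
    finally have tr1: "\<bar>tr - 1\<bar> \<le> real s * ?e" by simp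
    show ?thesis
    \<comment> \<open>If the trace is far from 1, the claimed bound exceeds 2, the trivial bound for
      the distance of two probability vectors. Otherwise dividing by \<open>tr\<close> costs at most
      a factor 2.\<close>
    proof (cases "tr < 1 / 2")
      case True
      then have "1 / 2 \<le> real s * ?e" using tr1 by linarith
      also have "\<dots> \<le> (1 + real s) * (real s * ?e)" using e mult_right_mono[of 1 "1 + real s" "real s * ?e"] by simp
      finally have "2 \<le> 4 * ((1 + real s) * (real s * ?e))" by linarith
      also have "\<dots> = ?C * \<rho> ^ (n - k)" by (simp only: mult_ac)
      finally have "2 \<le> ?C * \<rho> ^ (n - k)" .
      have "(\<Sum>w\<in>words s (Suc k). \<bar>p w - q w\<bar>) \<le> (\<Sum>w\<in>words s (Suc k). p w + q w)"
        using p_nonneg q(1) by (intro sum_mono) (auto simp: abs_le_iff add_increasing add_increasing2)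
      also have "\<dots> = 2" by (simp add: sum.distrib sum_p q(2))
      also note \<open>2 \<le> ?C * \<rho> ^ (n - k)\<close>
      finally show ?thesis .
    next
      case False
      have bound: "\<bar>p w - q w\<bar> \<le> chain P w * (2 * (1 + real s) * ?e)" if w: "w \<in> words s (Suc k)" for w
      proof -
        let ?K = "kpow s P (n - k) (last w) (hd w)"
        have w': "w \<noteq> []" "set w \<subseteq> {..<s}" "hd w < s" "last w < s"
          using words_SucD[OF w] by auto
        have "p [hd w] \<le> 1"
          using member_le_sum[of "hd w" "{..<s}" "\<lambda>i. p [i]"] w' p_nonneg by (simp add: sum_p_single)
        then have "p [hd w] * \<bar>tr - 1\<bar> \<le> 1 * (real s * ?e)" using p_nonneg tr1 by (intro mult_mono) auto
        \<comment> \<open>Separates the two sources of error: the trace against 1, and the return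
          probability against the stationary mass of the first letter.\<close>
        have "(p w - q w) * tr = chain P w * (p [hd w] * (tr - 1) - (?K - p [hd w]))"
          using q(3)[OF w] by (simp add: p_eq_chain[OF w'(1,2)] algebra_simps)
        then have "\<bar>p w - q w\<bar> * tr = chain P w * \<bar>p [hd w] * (tr - 1) - (?K - p [hd w])\<bar>"
          using tr(2) chain_P_nonneg[OF w'(2)] by (metis abs_mult abs_of_nonneg abs_of_pos)
        also have "\<dots> \<le> chain P w * (real s * ?e + ?e)"
        proof (intro mult_left_mono chain_P_nonneg w')
          have "\<bar>p [hd w] * (tr - 1) - (?K - p [hd w])\<bar> \<le> \<bar>p [hd w] * (tr - 1)\<bar> + \<bar>?K - p [hd w]\<bar>"
            by (rule abs_triangle_ineq4)
          also have "\<dots> \<le> real s * ?e + ?e"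
            using \<open>p [hd w] * \<bar>tr - 1\<bar> \<le> 1 * (real s * ?e)\<close> conv[OF w'(4,3), of "n - k"] p_nonneg
            by (simp add: abs_mult)
          finally show "\<bar>p [hd w] * (tr - 1) - (?K - p [hd w])\<bar> \<le> real s * ?e + ?e" .
        qed
        finally have "\<bar>p w - q w\<bar> * tr \<le> chain P w * ((1 + real s) * ?e)" by (simp add: algebra_simps)
        moreover have "\<bar>p w - q w\<bar> * (1 / 2) \<le> \<bar>p w - q w\<bar> * tr" using False by (intro mult_left_mono) auto
        ultimately show ?thesis by (simp add: algebra_simps)
      qed
      have "(\<Sum>w\<in>words s (Suc k). \<bar>p w - q w\<bar>) \<le> (\<Sum>w\<in>words s (Suc k). chain P w) * (2 * (1 + real s) * ?e)"
        unfolding sum_distrib_right by (intro sum_mono bound)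
      also have "(\<Sum>w\<in>words s (Suc k). chain P w) = real s"
        using sum_chain[of s P, OF P_sum] by (simp add: sum_words_Cons)
      also have "real s * (2 * (1 + real s) * ?e) = 2 * (real s * ((1 + real s) * ?e))" by (simp only: mult_ac)
      also have "\<dots> \<le> 4 * (real s * ((1 + real s) * ?e))" using e by (intro mult_right_mono) auto
      also have "\<dots> = ?C * \<rho> ^ (n - k)" by (simp only: mult_ac)
      finally show ?thesis .
    qed
  qed
  then show ?thesis using that[of ?C \<rho>] C s_pos by (simp add: add_pos_nonneg)
qed

end

section \<open>Subshifts and their periodic points\<close>

text \<open>This locale treats the index types \<open>nat\<close> and \<open>int\<close> uniformly. The map \<open>clip\<close> continues a finite
  word to the left and right by repeating its end letters, and \<open>residue n\<close> continues it periodically.\<close>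

locale shift_index =
  fixes W :: "nat \<Rightarrow> 'i::semiring_1 set" and clip :: "'i \<Rightarrow> nat" and residue :: "nat \<Rightarrow> 'i \<Rightarrow> nat"
  assumes mono_W: "mono W" and Un_W: "(\<Union>n. W n) = UNIV" and W_0: "W 0 = {}"
    and W_shift: "\<And>i k. i \<in> W k \<Longrightarrow> \<exists>j<2 * k. i + of_nat k = of_nat j"
    and clip_of_nat: "\<And>k. clip (of_nat k) = k"
    and clip_step: "\<And>i. clip (i + 1) = clip i \<or> clip (i + 1) = Suc (clip i)"
    and residue_less: "\<And>n i. 0 < n \<Longrightarrow> residue n i < n"
    and residue_of_nat: "\<And>n k. k < n \<Longrightarrow> residue n (of_nat k) = k"
    and residue_step: "\<And>n i. 0 < n \<Longrightarrow> residue n (i + 1) = Suc (residue n i) mod n"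
    and periodic: "\<And>n (x :: 'i \<Rightarrow> nat) i. 0 < n \<Longrightarrow> (\<And>i. x (i + of_nat n) = x i) \<Longrightarrow> x i = x (of_nat (residue n i))"

lemma funpow_left_shift: "(left_shift ^^ k) x = (\<lambda>i :: 'i :: semiring_1. x (i + of_nat k))"
  by (induction k) (auto simp: left_shift_def ac_simps)

abbreviation word :: "nat \<Rightarrow> ('i::semiring_1 \<Rightarrow> nat) \<Rightarrow> nat list" where
  "word \<equiv> itin left_shift (\<lambda>x. x 0)"

lemma nth_word: "i < n \<Longrightarrow> word n x ! i = x (of_nat i)"
  by (simp add: nth_itin funpow_left_shift)

lemma word_eq_iff:
  fixes x y :: "'i::semiring_1 \<Rightarrow> nat"
  shows "word n x = word n y \<longleftrightarrow> (\<forall>i<n. x (of_nat i) = y (of_nat i))"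
  by (simp add: itin_eq_iff funpow_left_shift)

text \<open>Fibres are nonempty and disjoint, so none can be omitted from a cover.\<close>

lemma min_subcover_card_fibers:
  assumes "finite (F ` X)"
  shows "min_subcover_card X (fibers X F) = card (F ` X)"
proof -
  have inj: "inj_on (\<lambda>v. F -` {v} \<inter> X) (F ` X)" by (auto simp: inj_on_def)
  have "V = fibers X F" if V: "V \<subseteq> fibers X F" "\<Union>V = X" for V
  proof (intro equalityI subsetI V(1)[THEN subsetD])
    fix D assume "D \<in> fibers X F"
    then obtain x where x: "x \<in> X" "D = F -` {F x} \<inter> X" by (auto simp: fibers_def)
    then obtain C where C: "C \<in> V" "x \<in> C" using V(2) by blast
    then have "C = D" using V(1) x by (auto simp: fibers_def)
    then show "D \<in> V" using C(1) by simp
  qed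
  note V = this
  have all: "finite (fibers X F)" "\<Union>(fibers X F) = X" using assms by (auto simp: fibers_def)
  have "(\<exists>V\<subseteq>fibers X F. finite V \<and> card V = k \<and> \<Union>V = X) \<longleftrightarrow> k = card (fibers X F)" for k
  proof
    assume "\<exists>V\<subseteq>fibers X F. finite V \<and> card V = k \<and> \<Union>V = X"
    then obtain V' where "V' \<subseteq> fibers X F" "card V' = k" "\<Union>V' = X" by blast
    then show "k = card (fibers X F)" using V[of V'] by simp
  next
    assume "k = card (fibers X F)"
    then show "\<exists>V\<subseteq>fibers X F. finite V \<and> card V = k \<and> \<Union>V = X"
      using all by (intro exI[of _ "fibers X F"]) simp
  qed
  moreover have "card (fibers X F) = card (F ` X)" unfolding fibers_def by (rule card_image[OF inj])
  ultimately show ?thesis unfolding min_subcover_card_def by (simp add: Least_equality)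
qed

locale sft = shift_index W clip residue + parry_chain s A l r
  for W :: "nat \<Rightarrow> 'i::semiring_1 set" and clip residue s A l r +
  fixes \<theta> :: real
  assumes aperiodic: "aperiodic_mat A" and \<theta>: "0 < \<theta>" "\<theta> < 1"
begin

abbreviation X :: "('i \<Rightarrow> nat) set" where "X \<equiv> subshift A"

lemma dim_row: "dim_row A = s"
  using A01 unfolding transition_matrix_def by auto

lemma X_iff: "x \<in> X \<longleftrightarrow> (\<forall>n. x n < s \<and> A $$ (x n, x (n + 1)) = 1)"
  by (simp add: subshift_def dim_row)

lemma A_diag: "i < s \<Longrightarrow> A $$ (i, i) = 1"
  using aperiodic by (simp add: aperiodic_mat_def dim_row)

lemma shift_X: "x \<in> X \<Longrightarrow> left_shift x \<in> X"
  by (auto simp: X_iff left_shift_def)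

lemma funpow_shift_X: "x \<in> X \<Longrightarrow> (left_shift ^^ k) x \<in> X"
  by (induction k) (auto intro: shift_X)

lemma zero_X: "(\<lambda>_. 0) \<in> X"
  using A_diag s_pos by (simp add: X_iff)

lemma word_in_words: "x \<in> X \<Longrightarrow> word n x \<in> words s n"
  by (auto simp: words_def in_set_conv_nth nth_word X_iff)

lemma word_admissible: "x \<in> X \<Longrightarrow> admissible (word n x)"
  by (simp add: admissible_def successively_conv_nth nth_word X_iff add.commute[of 1])

text \<open>The unit diagonal permits repeating the first letter to the left and the last letter to
  the right. The empty word has no letter to repeat and is treated apart.\<close>

lemma word_surj:
  assumes w: "w \<in> words s n" "admissible w"
  shows "\<exists>x\<in>X. word n x = w"
proof (cases "w = []")
  case True
  then show ?thesis using w zero_X by (auto simp: words_def)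
next
  case False
  have len: "length w = n" "0 < n" "set w \<subseteq> {..<s}" using w False by (auto simp: words_def)
  define x where "x i = w ! min (clip i) (n - 1)" for i
  have ws: "w ! j < s" if "j < n" for j using len that by (metis nth_mem lessThan_iff subsetD)
  have step: "A $$ (w ! min c (n - 1), w ! min c' (n - 1)) = 1" if "c' = c \<or> c' = Suc c" for c c'
  proof (cases "c' = Suc c \<and> Suc c < n")
    case True
    then have "min c (n - 1) = c" "min c' (n - 1) = Suc c" by auto
    then show ?thesis using True w(2) len by (simp add: admissible_def successively_conv_nth)
  next
    case False
    then have "min c (n - 1) = min c' (n - 1)" using that by auto
    then show ?thesis using A_diag ws[of "min c' (n - 1)"] len by simp
  qed
  have "x \<in> X" unfolding X_iff x_def using ws len step clip_step by auto
  moreover have "word n x = w"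
    using len by (intro nth_equalityI) (auto simp: nth_word x_def clip_of_nat min_def)
  ultimately show ?thesis by blast
qed

lemma word_image: "word n ` X = {w \<in> words s n. admissible w}"
  using word_in_words word_admissible word_surj by (auto simp: image_iff) metis

lemma agree_shift:
  assumes "word (2 * k) x = word (2 * k) y"
  shows "agree (W k) ((left_shift ^^ k) x) ((left_shift ^^ k) y)"
  unfolding agree_def
proof
  fix i assume "i \<in> W k"
  then obtain j where "j < 2 * k" "i + of_nat k = of_nat j" using W_shift by blast
  then show "(left_shift ^^ k) x i = (left_shift ^^ k) y i"
    using assms by (simp add: funpow_left_shift word_eq_iff)
qed

sublocale ms: Metric_space X "shift_dist W \<theta>"
  by (rule Metric_space_shift_dist[OF mono_W Un_W W_0 \<theta>])

lemma topspace_X: "topspace (shift_top W \<theta> A) = X"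
  by (simp add: shift_top_def)

text \<open>Balls and sets of points that agree on a window are cofinal in each other, so from here
  on open sets are described without the metric.\<close>

lemma openin_iff:
  "openin (shift_top W \<theta> A) U \<longleftrightarrow> U \<subseteq> X \<and> (\<forall>x\<in>U. \<exists>k. \<forall>y\<in>X. agree (W k) x y \<longrightarrow> y \<in> U)"
proof -
  have fwd: "\<exists>k. \<forall>y\<in>X. agree (W k) x y \<longrightarrow> y \<in> U"
    if "x \<in> X" "0 < e" "ms.mball x e \<subseteq> U" for x e U
  proof -
    obtain k where k: "\<theta> ^ k < e" using real_arch_pow_inv[OF \<open>0 < e\<close> \<theta>(2)] by blast
    have "y \<in> U" if y: "y \<in> X" "agree (W k) x y" for y
    proof (cases "x = y")
      case False
      have "k \<le> Max {n. agree (W n) x y}"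
        using finite_agree[OF mono_W Un_W False] y by (intro Max_ge) auto
      then have "shift_dist W \<theta> x y \<le> \<theta> ^ k"
        using False \<theta> by (simp add: shift_dist_def power_decreasing)
      then show ?thesis using that k \<open>x \<in> X\<close> \<open>ms.mball x e \<subseteq> U\<close> by (auto simp: ms.in_mball subset_iff)
    qed (use that \<open>x \<in> X\<close> \<open>0 < e\<close> \<open>ms.mball x e \<subseteq> U\<close> in auto)
    then show ?thesis by blast
  qed
  have bwd: "\<exists>e>0. ms.mball x e \<subseteq> U"
    if "x \<in> X" "\<forall>y\<in>X. agree (W k) x y \<longrightarrow> y \<in> U" for x k U
  proof (intro exI conjI subsetI)
    fix y assume "y \<in> ms.mball x (\<theta> ^ k)"
    then have y: "y \<in> X" "shift_dist W \<theta> x y < \<theta> ^ k" by (auto simp: ms.in_mball)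
    have "agree (W k) x y"
    proof (cases "x = y")
      case False
      let ?m = "Max {n. agree (W n) x y}"
      have "?m \<in> {n. agree (W n) x y}"
        using W_0 by (intro Max_in finite_agree[OF mono_W Un_W False]) (auto simp: agree_def intro!: exI[of _ 0])
      moreover have "\<theta> ^ ?m < \<theta> ^ k" using y(2) False by (simp add: shift_dist_def)
      then have "k \<le> ?m" using \<theta> power_decreasing[of ?m k \<theta>] by (meson not_less nle_le less_imp_le)
      then have "W k \<subseteq> W ?m" by (rule monoD[OF mono_W])
      ultimately show ?thesis by (auto simp: agree_def)
    qed (simp add: agree_def)
    then show "y \<in> U" using that y by blast
  qed (use \<theta> in simp)
  show ?thesis unfolding shift_top_def ms.openin_mtopology using fwd bwd by blast
qed

lemma openin_coordinate: "openin (shift_top W \<theta> A) {x \<in> X. x i = a}"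
proof -
  obtain k where "i \<in> W k" using Un_W by blast
  then show ?thesis unfolding openin_iff by (auto simp: agree_def intro!: exI[of _ k])
qed

text \<open>A single cover gives a lower bound. For the partition by coordinate 0 the minimal
  subcovers of the joins are counted exactly by admissible words.\<close>

lemma topological_entropy_ge: "ereal (ln l) \<le> topological_entropy (shift_top W \<theta> A) left_shift"
proof -
  let ?U = "fibers X (\<lambda>x. x 0)"
  have "iterated_join X left_shift ?U n = fibers X (word n)" for n
    using zero_X shift_X by (intro fibers_itin) auto
  then have "min_subcover_card X (iterated_join X left_shift ?U n) = card {w \<in> words s n. admissible w}" for n
    by (simp add: min_subcover_card_fibers word_image)
  then have "lim (\<lambda>n. ln (real (min_subcover_card X (iterated_join X left_shift ?U n))) / real n) = ln l"
    using word_growth by (simp add: limI)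
  moreover have "?U \<in> {U. (\<forall>B\<in>U. openin (shift_top W \<theta> A) B) \<and> \<Union>U = X}"
  proof -
    have "(\<lambda>x. x 0) -` {v} \<inter> X = {x \<in> X. x 0 = v}" for v by auto
    then show ?thesis using openin_coordinate[of 0] by (auto simp: fibers_def)
  qed
  ultimately show ?thesis
    unfolding topological_entropy_def topspace_X by (intro SUP_upper2[of ?U]) simp_all
qed

section \<open>Counting periodic points\<close>

lemma Fix_iff: "x \<in> Fix A n \<longleftrightarrow> x \<in> X \<and> (\<forall>i. x (i + of_nat n) = x i)"
  by (auto simp: Fix_def funpow_left_shift fun_eq_iff)

text \<open>Guarantees that \<open>Fix A n\<close> is nonempty for every \<open>n\<close>, so that,
  together with finiteness, \<open>equidist\<close> is the intended uniform measure and the trace of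
  the \<open>n\<close>-th power of \<open>P\<close> is positive.\<close>

lemma zero_Fix: "(\<lambda>_. 0) \<in> (Fix A n :: ('i \<Rightarrow> nat) set)"
  using zero_X by (simp add: Fix_iff)

lemma word_Fix_inj: "0 < n \<Longrightarrow> inj_on (word n) (Fix A n :: ('i \<Rightarrow> nat) set)"
proof (rule inj_onI)
  fix x y :: "'i \<Rightarrow> nat" assume n: "0 < n" and xy: "x \<in> Fix A n" "y \<in> Fix A n" "word n x = word n y"
  show "x = y"
  proof
    fix i
    have "x i = x (of_nat (residue n i))" "y i = y (of_nat (residue n i))"
      using xy(1,2) n by (auto simp: Fix_iff intro!: periodic)
    then show "x i = y i" using xy(3) residue_less[OF n, of i] by (simp add: word_eq_iff)
  qed
qed

text \<open>Appending the first letter records the transition that closes the cycle.\<close>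

lemma word_Fix_image:
  assumes n: "0 < n"
  shows "word n ` (Fix A n :: ('i \<Rightarrow> nat) set) = {w \<in> words s n. admissible (w @ [hd w])}"
proof (intro equalityI subsetI)
  fix w assume "w \<in> word n ` (Fix A n :: ('i \<Rightarrow> nat) set)"
  then obtain x :: "'i \<Rightarrow> nat" where x: "x \<in> X" "\<And>i. x (i + of_nat n) = x i" "w = word n x"
    by (auto simp: Fix_iff)
  have "x (of_nat n) = x 0" using x(2)[of 0] by simp
  then have "word (Suc n) x = w @ [hd w]"
    using itin_add[of left_shift "\<lambda>x. x 0" n 1 x] n x(3) nth_word[of 0 n x]
    by (simp add: funpow_left_shift hd_conv_nth length_0_conv[symmetric] del: length_0_conv)
  then show "w \<in> {w \<in> words s n. admissible (w @ [hd w])}"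
    using word_admissible[OF x(1), of "Suc n"] word_in_words[OF x(1), of n] x(3) by simp
next
  fix w assume "w \<in> {w \<in> words s n. admissible (w @ [hd w])}"
  then have w: "length w = n" "set w \<subseteq> {..<s}" "admissible (w @ [hd w])" by (auto simp: words_def)
  define x where "x i = w ! residue n i" for i
  have ws: "w ! j < s" if "j < n" for j using w that by (metis nth_mem lessThan_iff subsetD)
  have step: "A $$ (w ! j, w ! (Suc j mod n)) = 1" if "j < n" for j
  proof -
    have "A $$ ((w @ [hd w]) ! j, (w @ [hd w]) ! Suc j) = 1"
      using w that by (simp add: admissible_def successively_conv_nth)
    moreover have "(w @ [hd w]) ! Suc j = w ! (Suc j mod n)"
    proof (cases "Suc j = n")
      case True
      then show ?thesis using w n by (simp add: nth_append hd_conv_nth length_0_conv[symmetric] del: length_0_conv)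
    qed (use w that in \<open>simp add: nth_append\<close>)
    ultimately show ?thesis using w that by (simp add: nth_append)
  qed
  have "residue n (i + of_nat k) = (residue n i + k) mod n" for i k
  proof (induction k)
    case (Suc k)
    have "residue n (i + of_nat (Suc k)) = Suc (residue n (i + of_nat k)) mod n"
      using residue_step[OF n, of "i + of_nat k"] by (simp add: ac_simps)
    then show ?case using Suc by (simp add: mod_Suc_eq)
  qed (simp add: residue_less n)
  then have "x (i + of_nat n) = x i" for i using residue_less[OF n, of i] by (simp add: x_def)
  moreover have "x \<in> X" unfolding X_iff x_def using ws step residue_less[OF n] by (simp add: residue_step[OF n])
  ultimately have "x \<in> Fix A n" by (simp add: Fix_iff)
  moreover have "word n x = w" using w by (intro nth_equalityI) (auto simp: nth_word x_def residue_of_nat)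
  ultimately show "w \<in> word n ` (Fix A n :: ('i \<Rightarrow> nat) set)" by blast
qed

lemma finite_Fix:
  assumes "0 < n"
  shows "finite (Fix A n :: ('i \<Rightarrow> nat) set)"
proof (rule finite_imageD[OF _ word_Fix_inj[OF assms]])
  show "finite (word n ` (Fix A n :: ('i \<Rightarrow> nat) set))" unfolding word_Fix_image[OF assms] by simp
qed

text \<open>The points correspond to the closed words that continue \<open>w\<close> by
  \<open>n - Suc k\<close> free letters. Their common weight turns the count into a sum of chain
  weights, and summing out the free letters leaves a return probability.\<close>

lemma card_Fix_word:
  assumes k: "k < n" and w: "w \<in> words s (Suc k)"
  shows "real (card {x \<in> Fix A n :: ('i \<Rightarrow> nat) set. word (Suc k) x = w})
    = l ^ n * chain P w * kpow s P (n - k) (last w) (hd w)"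
proof -
  let ?F = "{x \<in> Fix A n :: ('i \<Rightarrow> nat) set. word (Suc k) x = w}"
  let ?m = "n - Suc k"
  let ?V = "{v \<in> words s ?m. admissible (w @ v @ [hd w])}"
  note wD = words_SucD[OF w]
  have n: "0 < n" using k by simp
  have take: "take (Suc k) (word n x) = word (Suc k) x" for x :: "'i \<Rightarrow> nat"
    using take_drop_itin[of 0 "Suc k" n left_shift "\<lambda>x. x 0" x] k by simp
  have "word n ` ?F = (\<lambda>v. w @ v) ` ?V"
  proof -
    have "word n ` ?F = {u \<in> words s n. admissible (u @ [hd u]) \<and> take (Suc k) u = w}"
    proof -
      have "word n ` ?F = {u \<in> word n ` (Fix A n :: ('i \<Rightarrow> nat) set). take (Suc k) u = w}"
        using take by auto
      then show ?thesis unfolding word_Fix_image[OF n] by auto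
    qed
    also have "\<dots> = (\<lambda>v. w @ v) ` ?V"
    proof (intro equalityI subsetI)
      fix u assume u: "u \<in> {u \<in> words s n. admissible (u @ [hd u]) \<and> take (Suc k) u = w}"
      then have eq: "u = w @ drop (Suc k) u" by (metis (mono_tags, lifting) append_take_drop_id mem_Collect_eq)
      then have "hd u = hd w" using wD(1) by (metis hd_append2)
      have "set (drop (Suc k) u) \<subseteq> {..<s}" using u set_drop_subset[of "Suc k" u] by (auto simp: words_def)
      moreover have "admissible (w @ drop (Suc k) u @ [hd w])" using u eq \<open>hd u = hd w\<close> by (metis (mono_tags, lifting) append_assoc mem_Collect_eq)
      moreover have "length (drop (Suc k) u) = ?m" using u by (simp add: words_def)
      ultimately have "drop (Suc k) u \<in> ?V" by (simp add: words_def)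
      then show "u \<in> (\<lambda>v. w @ v) ` ?V" by (subst eq) (rule imageI)
    qed (use w wD k in \<open>auto simp: words_def\<close>)
    finally show ?thesis .
  qed
  moreover have "inj_on (word n) ?F" using word_Fix_inj[OF n] by (rule inj_on_subset) auto
  moreover have "inj_on (\<lambda>v. w @ v) ?V" by (simp add: inj_on_def)
  ultimately have "card ?F = card ?V" using card_image[of "word n" ?F] card_image[of "\<lambda>v. w @ v" ?V] by simp
  moreover have "real (card ?V) = (\<Sum>v\<in>words s ?m. l ^ n * chain P (w @ v @ [hd w]))"
  proof -
    \<comment> \<open>First and last letter coincide, so the two values of \<open>r\<close> in
      \<open>chain_P\<close> cancel and the rescaled weight is an indicator.\<close>
    have "l ^ n * chain P (w @ v @ [hd w]) = (if admissible (w @ v @ [hd w]) then 1 else 0)" if "v \<in> words s ?m" for v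
    proof -
      have "length (w @ v @ [hd w]) - 1 = n" "set (w @ v @ [hd w]) \<subseteq> {..<s}"
        using that w wD k by (auto simp: words_def)
      then show ?thesis using chain_P[of "w @ v @ [hd w]"] wD l_pos r_pos[of "hd w"] by simp
    qed
    then show ?thesis by (simp add: sum.If_cases Int_def)
  qed
  moreover have "\<dots> = l ^ n * chain P w * (\<Sum>v\<in>words s ?m. chain P (last w # v @ [hd w]))"
    using wD by (simp add: chain_append sum_distrib_left mult.assoc)
  moreover have "Suc ?m = n - k" using k by simp
  ultimately show ?thesis using sum_chain_kpow[OF wD(3), where k = ?m and P = P and a = "last w"] by simp
qed

lemma sum_card_Fix_word:
  assumes "0 < n"
  shows "(\<Sum>w\<in>words s k. card {x \<in> Fix A n :: ('i \<Rightarrow> nat) set. word k x = w}) = card (Fix A n :: ('i \<Rightarrow> nat) set)"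
proof -
  have "word k ` (Fix A n :: ('i \<Rightarrow> nat) set) \<subseteq> words s k" using word_in_words by (auto simp: Fix_iff)
  then show ?thesis
    using sum.group[OF finite_Fix[OF assms] finite_words, of "word k" s k "\<lambda>_. 1 :: nat"] by simp
qed

lemma card_Fix:
  assumes n: "0 < n"
  shows "real (card (Fix A n :: ('i \<Rightarrow> nat) set)) = l ^ n * (\<Sum>i<s. kpow s P n i i)"
proof -
  have "real (card (Fix A n :: ('i \<Rightarrow> nat) set))
      = (\<Sum>w\<in>words s (Suc 0). real (card {x \<in> Fix A n :: ('i \<Rightarrow> nat) set. word (Suc 0) x = w}))"
    unfolding sum_card_Fix_word[OF n, of "Suc 0", symmetric] by simp
  also have "\<dots> = (\<Sum>w\<in>words s (Suc 0). l ^ n * chain P w * kpow s P (n - 0) (last w) (hd w))"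
    by (intro sum.cong refl card_Fix_word n)
  also have "\<dots> = l ^ n * (\<Sum>i<s. kpow s P n i i)" by (simp add: sum_words_Cons sum_distrib_left)
  finally show ?thesis .
qed

text \<open>The one-sided shift need not be injective, but on points of period \<open>n\<close> its
  \<open>k\<close>-th iterate is undone by \<open>n * k - k\<close> further steps. Hence the uniform
  measure on \<open>Fix A n\<close> is invariant.\<close>

lemma shift_Fix_bij:
  assumes n: "0 < n"
  shows "inj_on (left_shift ^^ k) (Fix A n :: ('i \<Rightarrow> nat) set)"
    "(left_shift ^^ k) ` (Fix A n :: ('i \<Rightarrow> nat) set) = Fix A n"
proof -
  have inverse: "(left_shift ^^ (n * k - k)) ((left_shift ^^ k) x) = x" if "x \<in> Fix A n" for x :: "'i \<Rightarrow> nat"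
  proof -
    have "(left_shift ^^ (n * j)) x = x" for j
      using that by (induction j) (simp_all add: Fix_def funpow_add)
    moreover have "n * k - k + k = n * k" using n by simp
    ultimately show ?thesis by (metis funpow_add comp_apply)
  qed
  show inj: "inj_on (left_shift ^^ k) (Fix A n :: ('i \<Rightarrow> nat) set)"
    by (rule inj_on_inverseI[of _ "left_shift ^^ (n * k - k)"]) (rule inverse)
  have "(left_shift ^^ k) x \<in> Fix A n" if "x \<in> Fix A n" for x :: "'i \<Rightarrow> nat"
    using that funpow_shift_X[of x k] unfolding Fix_iff funpow_left_shift
    by (simp add: add.assoc) (metis add.assoc add.commute)
  then show "(left_shift ^^ k) ` (Fix A n :: ('i \<Rightarrow> nat) set) = Fix A n"
    by (intro endo_inj_surj finite_Fix n inj) auto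
qed

end

section \<open>Measures of maximal entropy\<close>

lemma (in prob_space) integral_simple_comp:
  fixes h :: "'b \<Rightarrow> complex"
  assumes F: "simple_function M F" and S: "finite S" "F ` space M \<subseteq> S"
  shows "(\<integral>x. h (F x) \<partial>M) = (\<Sum>v\<in>S. complex_of_real (mass M F v) * h v)"
proof -
  have fib: "F -` {v} \<inter> space M \<in> sets M" for v by (rule simple_functionD(2)[OF F])
  have "(\<integral>x. h (F x) \<partial>M) = (\<integral>x. (\<Sum>v\<in>S. indicat_real (F -` {v} \<inter> space M) x *\<^sub>R h v) \<partial>M)"
  proof (rule Bochner_Integration.integral_cong[OF refl])
    fix x assume x: "x \<in> space M"
    then have "(\<Sum>v\<in>S. indicat_real (F -` {v} \<inter> space M) x *\<^sub>R h v) = (\<Sum>v\<in>S. if v = F x then h v else 0)"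
      by (intro sum.cong) (auto simp: indicator_def)
    then show "h (F x) = (\<Sum>v\<in>S. indicat_real (F -` {v} \<inter> space M) x *\<^sub>R h v)"
      using x S by (auto simp: sum.delta)
  qed
  also have "\<dots> = (\<Sum>v\<in>S. \<integral>x. indicat_real (F -` {v} \<inter> space M) x *\<^sub>R h v \<partial>M)"
    using fib by (intro Bochner_Integration.integral_sum integrable_scaleR_left)
      (auto simp: integrable_indicator_iff emeasure_eq_measure)
  also have "\<dots> = (\<Sum>v\<in>S. complex_of_real (mass M F v) * h v)"
    using fib by (intro sum.cong refl) (simp add: mass_def scaleR_conv_of_real)
  finally show ?thesis .
qed

locale sft_mme = sft W clip residue s A l r \<theta>
  for W :: "nat \<Rightarrow> 'i::semiring_1 set" and clip residue s A l r \<theta> +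
  fixes m :: "('i \<Rightarrow> nat) measure"
  assumes mme: "max_entropy_measure (shift_top W \<theta> A) left_shift m"
begin

lemma inv: "invariant_borel_prob (shift_top W \<theta> A) left_shift m"
  using mme by (simp add: max_entropy_measure_def)

sublocale mp: measure_preserving m left_shift
  using inv unfolding invariant_borel_prob_def measure_preserving_def measure_preserving_axioms_def by blast

lemma opens_subset: "{U. openin (shift_top W \<theta> A) U} \<subseteq> Pow X"
  using openin_subset[of "shift_top W \<theta> A"] by (auto simp: topspace_X)

lemma sets_m: "sets m = sigma_sets X {U. openin (shift_top W \<theta> A) U}"
proof -
  have "sets m = sets (sigma (topspace (shift_top W \<theta> A)) {U. openin (shift_top W \<theta> A) U})"
    using inv unfolding invariant_borel_prob_def by blast
  then show ?thesis using opens_subset by (simp add: topspace_X sets_measure_of)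
qed

lemma space_m: "space m = X"
  using sets_m sets.sets_into_space[of _ m] sets.top[of m] sigma_sets_into_sp[OF opens_subset] sigma_sets_top
  by (metis order_antisym)

lemma open_sets: "openin (shift_top W \<theta> A) U \<Longrightarrow> U \<in> sets m"
  by (simp add: sets_m sigma_sets.Basic)

lemma simple_coordinate: "simple_function m (\<lambda>x. x i)"
  unfolding simple_function_def space_m
proof
  show "finite ((\<lambda>x. x i) ` X)" by (rule finite_subset[of _ "{..<s}"]) (auto simp: X_iff)
  have "(\<lambda>x. x i) -` {a} \<inter> X = {x \<in> X. x i = a}" for a by auto
  then show "\<forall>a\<in>(\<lambda>x. x i) ` X. (\<lambda>x. x i) -` {a} \<inter> X \<in> sets m"
    using open_sets[OF openin_coordinate] by simp
qed

lemma simple_word: "simple_function m (word n)"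
  by (rule mp.simple_function_itin[OF simple_coordinate])

text \<open>A set decided by the window \<open>W n\<close> is, after \<open>n\<close> shifts,
  decided exactly by the next \<open>2 * n\<close> letters: the error is 0.\<close>

lemma approximable_window:
  assumes C: "C \<in> sets m" "\<And>x y. x \<in> C \<Longrightarrow> y \<in> X \<Longrightarrow> agree (W n) x y \<Longrightarrow> y \<in> C"
  shows "mp.approximable (\<lambda>x. x 0) C"
proof -
  define D where "D = word (2 * n) ` {x \<in> X. (left_shift ^^ n) x \<in> C}"
  have "((left_shift ^^ n) x \<in> C) = (word (2 * n) x \<in> D)" if x: "x \<in> X" for x
    unfolding D_def
  proof
    assume "word (2 * n) x \<in> word (2 * n) ` {x \<in> X. (left_shift ^^ n) x \<in> C}"
    then obtain y where y: "y \<in> X" "(left_shift ^^ n) y \<in> C" "word (2 * n) y = word (2 * n) x" by auto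
    then show "(left_shift ^^ n) x \<in> C" using C(2)[OF y(2) funpow_shift_X[OF x]] agree_shift by blast
  qed (use x in blast)
  then have "{x \<in> space m. ((left_shift ^^ n) x \<in> C) \<noteq> (word (2 * n) x \<in> D)} = {}"
    unfolding space_m by blast
  then have "mp.approx_error (\<lambda>x. x 0) C n D = 0" unfolding mp.approx_error_def by (simp only: measure_empty)
  then show ?thesis unfolding mp.approximable_def by (auto intro!: exI[of _ n] exI[of _ D])
qed

lemma approximable_sets:
  assumes "B \<in> sets m"
  shows "mp.approximable (\<lambda>x. x 0) B"
proof (rule mp.approximable_sigma[OF simple_coordinate _ _ assms])
  show "sets m = sigma_sets (space m) {U. openin (shift_top W \<theta> A) U}" by (simp add: space_m sets_m)
  fix U assume "U \<in> {U. openin (shift_top W \<theta> A) U}"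
  then have U: "U \<subseteq> X" "\<And>x. x \<in> U \<Longrightarrow> \<exists>k. \<forall>y\<in>X. agree (W k) x y \<longrightarrow> y \<in> U"
    unfolding openin_iff mem_Collect_eq by blast+
  \<comment> \<open>The points whose \<open>n\<close>-th window already forces membership in
    \<open>U\<close>. These sets are open and increase to \<open>U\<close>.\<close>
  define C where "C n = {x \<in> X. \<forall>y\<in>X. agree (W n) x y \<longrightarrow> y \<in> U}" for n
  have agree_trans: "agree I x z" if "agree I x y" "agree I y z" for I and x y z :: "'i \<Rightarrow> nat"
    using that by (simp add: agree_def)
  have Cn: "y \<in> C n" if "x \<in> C n" "y \<in> X" "agree (W n) x y" for n x y
    using that agree_trans[OF that(3)] by (auto simp: C_def)
  have CX: "C n \<subseteq> X" for n by (auto simp: C_def)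
  have "openin (shift_top W \<theta> A) (C n)" for n using Cn CX unfolding openin_iff by blast
  then have sets: "C n \<in> sets m" for n by (rule open_sets)
  have "W n \<subseteq> W (Suc n)" for n by (rule monoD[OF mono_W]) simp
  then have "agree (W n) x y" if "agree (W (Suc n)) x y" for n and x y :: "'i \<Rightarrow> nat"
    using that unfolding agree_def by blast
  then have "incseq C" unfolding C_def by (intro incseq_SucI) blast
  moreover have "(\<Union>n. C n) = U" using U by (auto simp: C_def agree_def)
  moreover have "mp.approximable (\<lambda>x. x 0) (C n)" for n
    using sets Cn by (rule approximable_window)
  ultimately show "mp.approximable (\<lambda>x. x 0) U"
    using mp.approximable_incseq[OF simple_coordinate sets, of "\<lambda>n. n" 0] by simp
qed

definition freq :: "nat list \<Rightarrow> real" where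
  "freq w = mass m (word (length w)) w"

lemma freq_word: "length w = n \<Longrightarrow> freq w = mass m (word n) w"
  by (simp add: freq_def)

sublocale wp: word_process s A l r freq
proof unfold_locales
  show "0 \<le> freq w" for w by (simp add: freq_def)
  show "freq [] = 1" using mp.prob_space by (simp add: freq_def mass_def itin_zero)
  have coord: "(\<lambda>x. x i) ` space m \<subseteq> {..<s}" for i by (auto simp: space_m X_iff)
  show "(\<Sum>a<s. freq (w @ [a])) = freq w" for w
  proof -
    let ?n = "length w"
    have "mass m (\<lambda>x. (word ?n x, x (of_nat ?n))) (w, a) = freq (w @ [a])" for a
    proof -
      have "word (Suc ?n) x = word ?n x @ [x (of_nat ?n)]" for x :: "'i \<Rightarrow> nat"
        using itin_add[of left_shift "\<lambda>x. x 0" ?n 1 x] by (simp add: funpow_left_shift)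
      then have "word (Suc ?n) -` {w @ [a]} = (\<lambda>x :: 'i \<Rightarrow> nat. (word ?n x, x (of_nat ?n))) -` {(w, a)}"
        by (auto simp del: itin.simps)
      then show ?thesis by (simp add: freq_def mass_def del: itin.simps)
    qed
    then show ?thesis
      using mp.mass_marginal_snd[OF simple_word[of ?n] simple_coordinate[of "of_nat ?n"] _ coord, of w]
      by (simp add: freq_def)
  qed
  show "(\<Sum>a<s. freq (a # w)) = freq w" for w
  proof -
    let ?n = "length w"
    have "mass m (\<lambda>x. (x 0, word ?n (left_shift x))) (a, w) = freq (a # w)" for a
    proof -
      have "word (Suc ?n) -` {a # w} = (\<lambda>x :: 'i \<Rightarrow> nat. (x 0, word ?n (left_shift x))) -` {(a, w)}"
        by auto
      then show ?thesis by (simp add: freq_def mass_def del: itin.simps)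
    qed
    then have "(\<Sum>a<s. freq (a # w)) = mass m (\<lambda>x. word ?n (left_shift x)) w"
      using mp.mass_marginal_fst[OF simple_coordinate[of 0] mp.simple_function_T[OF simple_word[of ?n]] _ coord, of w]
      by simp
    also have "\<dots> = freq w" using mp.mass_funpow[OF simple_word[of ?n], of 1 w] by (simp add: freq_def)
    finally show ?thesis .
  qed
  show "admissible w" if "0 < freq w" for w
  proof -
    have "w \<in> word (length w) ` X"
      using that mass_outside[of w "word (length w)" m] by (auto simp: freq_def space_m)
    then obtain x where "x \<in> X" "w = word (length w) x" by blast
    then show ?thesis by (metis word_admissible)
  qed
qed

lemma word_ent_eq: "wp.word_ent n = ent m (word n)"
proof -
  have "word n ` space m \<subseteq> words s n" using word_in_words by (auto simp: space_m)
  then show ?thesis by (simp add: wp.word_ent_def ent_eq_sum[OF finite_words] words_def freq_word)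
qed

text \<open>The only place where the equality of metric and topological entropy enters.\<close>

sublocale wp: extremal_word_process s A l r freq
proof unfold_locales
  obtain h where h: "(\<lambda>n. ent m (word n) / real n) \<longlonglongrightarrow> h"
    using mp.ent_rate_convergent[OF simple_coordinate] by blast
  have "metric_entropy m left_shift \<le> ereal h"
    by (rule mp.metric_entropy_le_generator[OF simple_coordinate approximable_sets h])
  moreover have "metric_entropy m left_shift = topological_entropy (shift_top W \<theta> A) left_shift"
    using mme by (simp add: max_entropy_measure_def)
  ultimately have "ereal (ln l) \<le> ereal h" using topological_entropy_ge by (metis order_trans)
  then have "ln l \<le> h" by simp
  then show "ln l \<le> wp.word_ent (Suc (Suc n)) - wp.word_ent (Suc n)" for n
    unfolding word_ent_eq using mp.ent_rate_le_step[OF simple_coordinate h, of "Suc n"] by linarith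
qed

text \<open>The test functions are replaced by functions of a word of length \<open>2 * k + 1\<close>, after shifting
  by \<open>k\<close> so that in the two-sided case the word covers a symmetric window.\<close>

lemma equidistribution_bound:
  assumes f_cont: "continuous_map (shift_top W \<theta> A) euclidean f"
    and f_bound: "\<And>x. x \<in> X \<Longrightarrow> cmod (f x) \<le> B" and B: "0 \<le> B"
    and f_lip: "\<And>x y k. x \<in> X \<Longrightarrow> y \<in> X \<Longrightarrow> agree (W k) x y \<Longrightarrow> cmod (f x - f y) \<le> e k"
    and k: "2 * k < n"
  shows "cmod ((\<integral>x. f x \<partial>m) - (\<integral>x. f x \<partial>equidist (Fix A n))) \<le> 2 * e k +
    B * (\<Sum>w\<in>words s (Suc (2 * k)). \<bar>freq w
      - real (card {x \<in> Fix A n :: ('i \<Rightarrow> nat) set. word (Suc (2 * k)) x = w}) / real (card (Fix A n :: ('i \<Rightarrow> nat) set))\<bar>)"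
proof -
  let ?N = "Suc (2 * k)"
  let ?w = "word ?N" and ?T = "left_shift ^^ k" and ?Fix = "Fix A n :: ('i \<Rightarrow> nat) set"
  let ?q = "\<lambda>w. real (card {x \<in> ?Fix. ?w x = w}) / real (card ?Fix)"
  have n: "0 < n" using k by simp
  have f_meas: "f \<in> borel_measurable m"
  proof (rule borel_measurableI)
    fix S :: "complex set" assume "open S"
    then have "openin (shift_top W \<theta> A) {x \<in> topspace (shift_top W \<theta> A). f x \<in> S}"
      by (intro openin_continuous_map_preimage[OF f_cont]) simp
    moreover have "{x \<in> topspace (shift_top W \<theta> A). f x \<in> S} = f -` S \<inter> space m"
      by (auto simp: topspace_X space_m)
    ultimately show "f -` S \<inter> space m \<in> sets m" using open_sets by simp
  qed
  \<comment> \<open>A representative point for each word that occurs. \<open>h\<close> samples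
    \<open>f\<close> there; its value 0 on the other words keeps the bound \<open>B\<close> valid
    for all words.\<close>
  define z where "z w = (SOME x. x \<in> X \<and> ?w x = w)" for w
  have z: "z (?w x) \<in> X" "?w (z (?w x)) = ?w x" if "x \<in> X" for x
    using someI[of "\<lambda>y. y \<in> X \<and> ?w y = ?w x" x] that by (auto simp: z_def simp del: itin.simps)
  define h where "h w = (if w \<in> ?w ` X then f (?T (z w)) else 0)" for w
  have h_bound: "cmod (h w) \<le> B" for w
    using z f_bound funpow_shift_X B by (auto simp: h_def simp del: itin.simps)
  have h_close: "cmod (f (?T x) - h (?w x)) \<le> e k" if x: "x \<in> X" for x
  proof -
    have "word (2 * k) (z (?w x)) = word (2 * k) x"
      using z(2)[OF x] unfolding word_eq_iff by simp
    then have "agree (W k) (?T x) (?T (z (?w x)))" by (intro agree_shift) simp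
    then have "cmod (f (?T x) - f (?T (z (?w x)))) \<le> e k"
      by (intro f_lip funpow_shift_X x z)
    then show ?thesis using x by (simp add: h_def del: itin.simps)
  qed
  have words_ge: "?w ` space m \<subseteq> words s ?N" using word_in_words by (auto simp: space_m simp del: itin.simps)
  have int_fT: "integrable m (\<lambda>x. f (?T x))"
  proof (rule mp.integrable_const_bound)
    show "AE x in m. norm (f (?T x)) \<le> B" using f_bound funpow_shift_X by (intro AE_I2) (simp add: space_m)
    show "(\<lambda>x. f (?T x)) \<in> borel_measurable m" by (rule measurable_compose[OF mp.measurable_funpow f_meas])
  qed
  have int_h: "integrable m (\<lambda>x. h (?w x))"
  proof (rule mp.integrable_const_bound)
    show "AE x in m. norm (h (?w x)) \<le> B" using h_bound by (intro AE_I2)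
    show "(\<lambda>x. h (?w x)) \<in> borel_measurable m"
      by (rule borel_measurable_simple_function[OF simple_function_compose1[OF simple_word]])
  qed
  have "(\<integral>x. f x \<partial>m) = (\<integral>x. f (?T x) \<partial>m)"
    using integral_distr[OF mp.measurable_funpow f_meas, of k] by (simp add: mp.distr_funpow)
  then have "(\<integral>x. f x \<partial>m) - (\<Sum>w\<in>words s ?N. complex_of_real (freq w) * h w) = (\<integral>x. f (?T x) - h (?w x) \<partial>m)"
    using mp.integral_simple_comp[OF simple_word finite_words words_ge, of h] int_fT int_h
    by (simp add: words_def freq_def del: itin.simps)
  moreover have "cmod (\<integral>x. f (?T x) - h (?w x) \<partial>m) \<le> e k"
  proof -
    have "cmod (\<integral>x. f (?T x) - h (?w x) \<partial>m) \<le> (\<integral>x. cmod (f (?T x) - h (?w x)) \<partial>m)"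
      by (rule integral_norm_bound)
    also have "\<dots> \<le> e k"
      using h_close int_fT int_h by (intro mp.integral_le_const AE_I2) (auto simp: space_m simp del: itin.simps)
    finally show ?thesis .
  qed
  ultimately have m_part: "cmod ((\<integral>x. f x \<partial>m) - (\<Sum>w\<in>words s ?N. complex_of_real (freq w) * h w)) \<le> e k"
    by simp
  have fin: "finite ?Fix" "?Fix \<noteq> {}" using finite_Fix[OF n] zero_Fix[of n] by auto
  then have card: "0 < card ?Fix" by (simp add: card_gt_0_iff)
  have FixX: "x \<in> X" if "x \<in> ?Fix" for x using that by (simp add: Fix_iff)
  have "(\<integral>x. f x \<partial>equidist ?Fix) = (\<Sum>x\<in>?Fix. f x) / of_nat (card ?Fix)"
    using fin by (subst integral_measure_pmf[of ?Fix])
      (auto simp: sum_divide_distrib scaleR_conv_of_real intro!: sum.cong)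
  \<comment> \<open>The counterpart for periodic points of the invariance of \<open>m\<close>: both
    integrals are shifted by \<open>k\<close> before \<open>f\<close> is replaced by
    \<open>h\<close>.\<close>
  also have "(\<Sum>x\<in>?Fix. f x) = (\<Sum>x\<in>?Fix. f (?T x))"
    using sum.reindex[OF shift_Fix_bij(1)[OF n, of k], of f] shift_Fix_bij(2)[OF n, of k] by simp
  finally have fix_eq: "(\<integral>x. f x \<partial>equidist ?Fix) = (\<Sum>x\<in>?Fix. f (?T x)) / of_nat (card ?Fix)" .
  have "(\<Sum>x\<in>?Fix. h (?w x)) = (\<Sum>w\<in>words s ?N. \<Sum>x\<in>{x \<in> ?Fix. ?w x = w}. h (?w x))"
    using word_in_words FixX by (intro sum.group[symmetric] fin finite_words) (auto simp del: itin.simps)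
  also have "\<dots> = (\<Sum>w\<in>words s ?N. of_nat (card {x \<in> ?Fix. ?w x = w}) * h w)"
    by (intro sum.cong refl) (simp del: itin.simps)
  finally have "(\<Sum>x\<in>?Fix. h (?w x)) / of_nat (card ?Fix) = (\<Sum>w\<in>words s ?N. complex_of_real (?q w) * h w)"
    by (simp add: sum_divide_distrib del: itin.simps)
  then have "(\<integral>x. f x \<partial>equidist ?Fix) - (\<Sum>w\<in>words s ?N. complex_of_real (?q w) * h w)
      = (\<Sum>x\<in>?Fix. f (?T x) - h (?w x)) / of_nat (card ?Fix)"
    unfolding fix_eq by (simp add: sum_subtractf diff_divide_distrib del: itin.simps)
  moreover have "cmod ((\<Sum>x\<in>?Fix. f (?T x) - h (?w x)) / of_nat (card ?Fix)) \<le> e k"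
  proof -
    have "cmod (\<Sum>x\<in>?Fix. f (?T x) - h (?w x)) \<le> real (card ?Fix) * e k"
      using h_close FixX by (intro sum_norm_bound) blast
    then show ?thesis using card by (simp add: norm_divide field_simps del: itin.simps)
  qed
  ultimately have fix_part: "cmod ((\<integral>x. f x \<partial>equidist ?Fix) - (\<Sum>w\<in>words s ?N. complex_of_real (?q w) * h w)) \<le> e k"
    by simp
  have "cmod ((\<Sum>w\<in>words s ?N. complex_of_real (freq w) * h w) - (\<Sum>w\<in>words s ?N. complex_of_real (?q w) * h w))
      = cmod (\<Sum>w\<in>words s ?N. complex_of_real (freq w - ?q w) * h w)"
    by (simp add: sum_subtractf left_diff_distrib del: itin.simps)
  also have "\<dots> \<le> (\<Sum>w\<in>words s ?N. \<bar>freq w - ?q w\<bar> * B)"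
  proof (rule sum_norm_le)
    fix w
    have "cmod (complex_of_real (freq w - ?q w) * h w) = \<bar>freq w - ?q w\<bar> * cmod (h w)"
      by (simp only: norm_mult norm_of_real)
    also have "\<dots> \<le> \<bar>freq w - ?q w\<bar> * B" by (intro mult_left_mono h_bound) simp
    finally show "cmod (complex_of_real (freq w - ?q w) * h w) \<le> \<bar>freq w - ?q w\<bar> * B" .
  qed
  also have "\<dots> = B * (\<Sum>w\<in>words s ?N. \<bar>freq w - ?q w\<bar>)" by (simp only: sum_distrib_left mult.commute)
  finally have mid: "cmod ((\<Sum>w\<in>words s ?N. complex_of_real (freq w) * h w)
      - (\<Sum>w\<in>words s ?N. complex_of_real (?q w) * h w)) \<le> B * (\<Sum>w\<in>words s ?N. \<bar>freq w - ?q w\<bar>)" .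
  have tri: "cmod (a - d) \<le> cmod (a - b) + cmod (d - c) + cmod (b - c)" for a b c d :: complex
  proof -
    have "a - d = (a - b) + (b - c) - (d - c)" by simp
    then have "cmod (a - d) \<le> cmod ((a - b) + (b - c)) + cmod (d - c)" by (metis norm_triangle_ineq4)
    then show ?thesis using norm_triangle_ineq[of "a - b" "b - c"] by linarith
  qed
  show ?thesis
    using tri[of "\<integral>x. f x \<partial>m" "\<integral>x. f x \<partial>equidist ?Fix" "\<Sum>w\<in>words s ?N. complex_of_real (freq w) * h w"
        "\<Sum>w\<in>words s ?N. complex_of_real (?q w) * h w"] m_part fix_part mid by linarith
qed

text \<open>The seminorm pairs the window of index \<open>n + 1\<close> with
  \<open>\<theta> ^ n\<close>, whence the factor \<open>1 / \<theta>\<close>. The window of index 0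
  is empty and not seen by the seminorm; there the supremum norm is used twice, whence the factor
  2.\<close>

lemma lipschitz_fun_bounds:
  assumes "lipschitz_fun W \<theta> A f"
  obtains B where "lip_norm W \<theta> A f = ereal B" "0 \<le> B" "\<And>x. x \<in> X \<Longrightarrow> cmod (f x) \<le> B"
    "\<And>x y k. x \<in> X \<Longrightarrow> y \<in> X \<Longrightarrow> agree (W k) x y \<Longrightarrow> cmod (f x - f y) \<le> 2 * B / \<theta> * \<theta> ^ k"
proof -
  have sup: "ereal (cmod (f x)) \<le> sup_norm_on X f" if "x \<in> X" for x
    unfolding sup_norm_on_def by (rule SUP_upper[OF that])
  have lip: "ereal (cmod (f x - f y) / \<theta> ^ n) \<le> lip_seminorm W \<theta> A f"
    if "x \<in> X" "y \<in> X" "agree (W (n + 1)) x y" for x y n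
    unfolding lip_seminorm_def using that by (intro Sup_upper) blast
  have nonneg: "0 \<le> sup_norm_on X f" "0 \<le> lip_seminorm W \<theta> A f"
    using order_trans[OF _ sup[OF zero_X], of 0] order_trans[OF _ lip[OF zero_X zero_X, of 0], of 0]
    by (auto simp: agree_def)
  moreover have "lip_seminorm W \<theta> A f + sup_norm_on X f < \<infinity>"
    using assms by (simp add: lipschitz_fun_def lip_norm_def)
  ultimately obtain a b where ab: "lip_seminorm W \<theta> A f = ereal a" "sup_norm_on X f = ereal b"
    by (cases "lip_seminorm W \<theta> A f"; cases "sup_norm_on X f") auto
  have ab0: "0 \<le> a" "0 \<le> b" using nonneg by (simp_all add: ab)
  have fb: "cmod (f x) \<le> b" if "x \<in> X" for x using sup[OF that] by (simp add: ab)
  show ?thesis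
  proof (rule that[of "a + b"])
    show "lip_norm W \<theta> A f = ereal (a + b)" by (simp add: lip_norm_def ab)
    show "0 \<le> a + b" using ab0 by simp
    show "cmod (f x) \<le> a + b" if "x \<in> X" for x using fb[OF that] ab0 by linarith
    show "cmod (f x - f y) \<le> 2 * (a + b) / \<theta> * \<theta> ^ k" if xy: "x \<in> X" "y \<in> X" "agree (W k) x y" for x y k
    proof (cases k)
      case 0
      have "cmod (f x - f y) \<le> cmod (f x) + cmod (f y)" by (rule norm_triangle_ineq4)
      also have "\<dots> \<le> b + b" by (intro add_mono fb xy)
      also have "\<dots> \<le> 2 * (a + b)" using ab0 by simp
      also have "\<dots> \<le> 2 * (a + b) / \<theta>"
        using \<theta> ab0 mult_left_le[of \<theta> "2 * (a + b)"] by (simp add: pos_le_divide_eq)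
      finally show ?thesis using 0 by simp
    next
      case (Suc n)
      then have "cmod (f x - f y) / \<theta> ^ n \<le> a" using lip[OF xy(1,2), of n] xy(3) by (simp add: ab)
      then have "cmod (f x - f y) \<le> a * \<theta> ^ n" using \<theta> by (simp add: pos_divide_le_eq)
      also have "\<dots> \<le> 2 * (a + b) * \<theta> ^ n" using \<theta> ab0 by (intro mult_right_mono) auto
      finally show ?thesis using \<theta> Suc by simp
    qed
  qed
qed

lemma exponential_equidistribution:
  assumes M: "0 < M" and pos: "\<And>i j. i < s \<Longrightarrow> j < s \<Longrightarrow> 0 < kpow s (\<lambda>i j. A $$ (i, j)) M i j"
  shows "\<exists>c>0. \<exists>\<delta>>0. \<forall>f. lipschitz_fun W \<theta> A f \<longrightarrow> (\<forall>n\<ge>1.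
    ereal (cmod ((\<integral>x. f x \<partial>m) - (\<integral>x. f x \<partial>equidist (Fix A n))))
      \<le> ereal c * lip_norm W \<theta> A f * ereal (exp (- \<delta> * real n)))"
proof -
  obtain C \<rho> where C: "0 < C" "0 < \<rho>" "\<rho> < 1"
    and tv: "\<And>n k q tr. tr = (\<Sum>i<s. kpow s P n i i) \<Longrightarrow> 0 < tr \<Longrightarrow> k < n \<Longrightarrow>
       (\<And>w. w \<in> words s (Suc k) \<Longrightarrow> 0 \<le> q w) \<Longrightarrow> (\<Sum>w\<in>words s (Suc k). q w) = 1 \<Longrightarrow>
       (\<And>w. w \<in> words s (Suc k) \<Longrightarrow> q w * tr = chain P w * kpow s P (n - k) (last w) (hd w)) \<Longrightarrow>
       (\<Sum>w\<in>words s (Suc k). \<bar>freq w - q w\<bar>) \<le> C * \<rho> ^ (n - k)"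
    using wp.word_total_variation[OF M kpow_P_pos[OF _ _ pos]] by blast
  \<comment> \<open>The slower of the two rates: approximation of \<open>f\<close> by functions of
    words, and mixing of the chain.\<close>
  define \<kappa> where "\<kappa> = max \<theta> \<rho>"
  have \<kappa>: "0 < \<kappa>" "\<kappa> < 1" "\<theta> \<le> \<kappa>" "\<rho> \<le> \<kappa>" using \<theta> C by (auto simp: \<kappa>_def)
  obtain D \<eta> where D: "0 < D" "0 < \<eta>" "\<eta> < 1" "\<And>n. \<kappa> ^ (n div 4) \<le> D * \<eta> ^ n"
    using power_div_le_geometric[OF \<kappa>(1,2), of 4] by auto
  have bound: "cmod ((\<integral>x. f x \<partial>m) - (\<integral>x. f x \<partial>equidist (Fix A n))) \<le> (4 / \<theta> + C) * D * B * \<eta> ^ n"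
    if f: "lipschitz_fun W \<theta> A f" and B: "0 \<le> B" "\<And>x. x \<in> X \<Longrightarrow> cmod (f x) \<le> B"
      "\<And>x y k. x \<in> X \<Longrightarrow> y \<in> X \<Longrightarrow> agree (W k) x y \<Longrightarrow> cmod (f x - f y) \<le> 2 * B / \<theta> * \<theta> ^ k"
      and n: "1 \<le> n" for f B n
  proof -
    \<comment> \<open>Words of length \<open>2 * ?k + 1\<close> leave
      \<open>n - 2 * ?k \<ge> ?k\<close> steps for mixing, so both errors are governed by the power
      \<open>?k\<close>; \<open>2 * ?k < n\<close> holds from \<open>n = 1\<close> on.\<close>
    let ?k = "n div 4" and ?Fix = "Fix A n :: ('i \<Rightarrow> nat) set"
    let ?q = "\<lambda>w. real (card {x \<in> ?Fix. word (Suc (2 * ?k)) x = w}) / real (card ?Fix)"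
    have k: "2 * ?k < n" and n0: "0 < n" using n by auto
    have "finite ?Fix" "?Fix \<noteq> {}" using finite_Fix[OF n0] zero_Fix[of n] by auto
    then have card: "0 < real (card ?Fix)" by (simp add: card_gt_0_iff)
    have tr: "0 < (\<Sum>i<s. kpow s P n i i)"
      using card l_pos unfolding card_Fix[OF n0] by (simp add: zero_less_mult_iff)
    have "(\<Sum>w\<in>words s (Suc (2 * ?k)). \<bar>freq w - ?q w\<bar>) \<le> C * \<rho> ^ (n - 2 * ?k)"
    proof (rule tv[OF refl tr k])
      show "(\<Sum>w\<in>words s (Suc (2 * ?k)). ?q w) = 1"
        using sum_card_Fix_word[OF n0, of "Suc (2 * ?k)"] card
        by (simp flip: sum_divide_distrib of_nat_sum del: itin.simps)
      fix w assume "w \<in> words s (Suc (2 * ?k))"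
      then show "?q w * (\<Sum>i<s. kpow s P n i i) = chain P w * kpow s P (n - 2 * ?k) (last w) (hd w)"
        using tr l_pos by (simp add: card_Fix_word[OF k] card_Fix[OF n0] del: itin.simps)
    qed simp
    also have "\<dots> \<le> C * \<rho> ^ ?k" using C by (intro mult_left_mono power_decreasing) auto
    finally have tvk: "(\<Sum>w\<in>words s (Suc (2 * ?k)). \<bar>freq w - ?q w\<bar>) \<le> C * \<rho> ^ ?k" .
    have "cmod ((\<integral>x. f x \<partial>m) - (\<integral>x. f x \<partial>equidist (Fix A n)))
        \<le> 2 * (2 * B / \<theta> * \<theta> ^ ?k) + B * (\<Sum>w\<in>words s (Suc (2 * ?k)). \<bar>freq w - ?q w\<bar>)"
      using f B k by (intro equidistribution_bound) (auto simp: lipschitz_fun_def)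
    also have "\<dots> \<le> 2 * (2 * B / \<theta> * \<theta> ^ ?k) + B * (C * \<rho> ^ ?k)"
      using B(1) tvk by (intro add_left_mono mult_left_mono)
    also have "\<dots> \<le> 2 * (2 * B / \<theta> * \<kappa> ^ ?k) + B * (C * \<kappa> ^ ?k)"
      using B(1) C \<theta> \<kappa> by (intro add_mono mult_left_mono power_mono) auto
    also have "\<dots> = (4 / \<theta> + C) * B * \<kappa> ^ ?k" by (simp add: algebra_simps)
    also have "\<dots> \<le> (4 / \<theta> + C) * B * (D * \<eta> ^ n)"
      using B(1) C \<theta> D(4) by (intro mult_left_mono) auto
    finally show ?thesis by (simp only: mult_ac)
  qed
  show ?thesis
  proof (intro exI conjI allI impI)
    show "0 < (4 / \<theta> + C) * D" using C D \<theta> by (simp add: add_pos_pos)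
    show "0 < - ln \<eta>" using D by simp
    fix f :: "('i \<Rightarrow> nat) \<Rightarrow> complex" and n :: nat
    assume f: "lipschitz_fun W \<theta> A f" and n: "1 \<le> n"
    obtain B where B: "lip_norm W \<theta> A f = ereal B" "0 \<le> B" "\<And>x. x \<in> X \<Longrightarrow> cmod (f x) \<le> B"
      "\<And>x y k. x \<in> X \<Longrightarrow> y \<in> X \<Longrightarrow> agree (W k) x y \<Longrightarrow> cmod (f x - f y) \<le> 2 * B / \<theta> * \<theta> ^ k"
      using lipschitz_fun_bounds[OF f] by blast
    have "exp (- (- ln \<eta>) * real n) = \<eta> ^ n" using D by (simp add: exp_of_nat2_mult)
    then show "ereal (cmod ((\<integral>x. f x \<partial>m) - (\<integral>x. f x \<partial>equidist (Fix A n))))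
        \<le> ereal ((4 / \<theta> + C) * D) * lip_norm W \<theta> A f * ereal (exp (- (- ln \<eta>) * real n))"
      using bound[OF f B(2-4) n] by (simp add: B(1))
  qed
qed

end

section \<open>The one-sided and the two-sided index set\<close>

lemma shift_index_nat: "shift_index window1 (\<lambda>i. i) (\<lambda>n i. i mod n)"
proof
  fix n and x :: "nat \<Rightarrow> nat" and i
  assume "0 < n" and per: "\<And>i. x (i + of_nat n) = x i"
  have "x (j + n * q) = x j" for j q
  proof (induction q)
    case (Suc q)
    then show ?case using per[of "j + n * q"] by (simp add: ac_simps)
  qed simp
  from this[of "i mod n" "i div n"] show "x i = x (of_nat (i mod n))" by simp
next
  show "(\<Union>n. window1 n) = UNIV" by (auto simp: window1_def)
  show "\<exists>j<2 * k. i + of_nat k = of_nat j" if "i \<in> window1 k" for i k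
    using that by (auto simp: window1_def)
qed (auto simp: window1_def mono_def mod_Suc_eq)

text \<open>\<open>nat\<close> sends all negative indices to 0, so a word is continued to the left
  by its first letter.\<close>

lemma shift_index_int: "shift_index window2 nat (\<lambda>n i. nat (i mod int n))"
proof
  fix n and x :: "int \<Rightarrow> nat" and i
  assume "0 < n" and per: "\<And>i. x (i + of_nat n) = x i"
  have nonneg: "x (j + int n * int q) = x j" for j q
  proof (induction q)
    case (Suc q)
    have eq: "j + int n * int (Suc q) = j + int n * int q + int n" by (simp add: algebra_simps)
    show ?case unfolding eq using per[of "j + int n * int q"] Suc by simp
  qed simp
  have "x (j + int n * q) = x j" for j q
  proof (cases "0 \<le> q")
    case True
    then show ?thesis using nonneg[of j "nat q"] by simp
  next
    case False
    \<comment> \<open>A negative multiple is undone by starting from the shifted index and moving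
      forward by \<open>- q\<close> periods.\<close>
    then show ?thesis using nonneg[of "j + int n * q" "nat (- q)"] by simp
  qed
  from this[of "i mod int n" "i div int n"] show "x i = x (of_nat (nat (i mod int n)))"
    using \<open>0 < n\<close> by simp
next
  show "(\<Union>n. window2 n) = UNIV"
  proof -
    have "i \<in> window2 (nat (\<bar>i\<bar> + 1))" for i by (simp add: window2_def)
    then show ?thesis by blast
  qed
  show "\<exists>j<2 * k. i + of_nat k = of_nat j" if "i \<in> window2 k" for i k
    using that by (intro exI[of _ "nat (i + int k)"]) (auto simp: window2_def)
  show "nat (i + 1) = nat i \<or> nat (i + 1) = Suc (nat i)" for i by (cases "0 \<le> i") auto
  show "nat ((i + 1) mod int n) = Suc (nat (i mod int n)) mod n" if "0 < n" for n i
  proof -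
    have "(i + 1) mod int n = (i mod int n + 1) mod int n" by (simp add: mod_add_left_eq)
    then show ?thesis using that by (simp add: nat_mod_distrib Suc_nat_eq_nat_zadd1 add.commute)
  qed
qed (auto simp: window2_def mono_def nat_less_iff)

theorem theorem1p4:
  fixes s :: nat and A :: "real mat" and \<theta> :: real
  assumes "1 \<le> s"
    and "transition_matrix s A" and "irreducible_mat A" and "aperiodic_mat A"
    and "0 < \<theta>" and "\<theta> < 1"
  shows
    "(\<forall>m :: (nat \<Rightarrow> nat) measure. max_entropy_measure (shift_top window1 \<theta> A) left_shift m \<longrightarrow>
       (\<exists>c>0. \<exists>\<delta>>0. \<forall>f. lipschitz_fun window1 \<theta> A f \<longrightarrow> (\<forall>n\<ge>1.
          ereal (cmod ((\<integral>x. f x \<partial>m) - (\<integral>x. f x \<partial>equidist (Fix A n))))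
            \<le> ereal c * lip_norm window1 \<theta> A f * ereal (exp (- \<delta> * real n)))))
     \<and>
     (\<forall>m :: (int \<Rightarrow> nat) measure. max_entropy_measure (shift_top window2 \<theta> A) left_shift m \<longrightarrow>
       (\<exists>c>0. \<exists>\<delta>>0. \<forall>f. lipschitz_fun window2 \<theta> A f \<longrightarrow> (\<forall>n\<ge>1.
          ereal (cmod ((\<integral>x. f x \<partial>m) - (\<integral>x. f x \<partial>equidist (Fix A n))))
            \<le> ereal c * lip_norm window2 \<theta> A f * ereal (exp (- \<delta> * real n)))))"
proof -
  have s: "0 < s" using assms(1) by simp
  obtain M where M: "0 < M" "\<And>i j. i < s \<Longrightarrow> j < s \<Longrightarrow> 0 < kpow s (\<lambda>i j. A $$ (i, j)) M i j"
    using primitive_matrix[OF assms(2-4)] by blast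
  have "0 \<le> A $$ (i, j)" if "i < s" "j < s" for i j
    using assms(2) that by (force simp: transition_matrix_def)
  then obtain l r where lr: "0 < l" "\<And>i. i < s \<Longrightarrow> 0 < r i"
    "\<And>i. i < s \<Longrightarrow> (\<Sum>j<s. A $$ (i, j) * r j) = l * r i"
    using perron_eigenvector[of s "\<lambda>i j. A $$ (i, j)" M, OF _ M(2) M(1) s] by blast
  have chain: "parry_chain s A l r" using s assms(2) lr by (rule parry_chain.intro)
  have ax: "sft_axioms A \<theta>" using assms(4-6) by (rule sft_axioms.intro)
  show ?thesis
  proof (intro conjI allI impI)
    fix m :: "(nat \<Rightarrow> nat) measure"
    assume "max_entropy_measure (shift_top window1 \<theta> A) left_shift m"
    then interpret sft_mme window1 "\<lambda>i. i" "\<lambda>n i. i mod n" s A l r \<theta> m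
      by (intro sft_mme.intro sft.intro sft_mme_axioms.intro shift_index_nat chain ax)
    show "\<exists>c>0. \<exists>\<delta>>0. \<forall>f. lipschitz_fun window1 \<theta> A f \<longrightarrow> (\<forall>n\<ge>1.
          ereal (cmod ((\<integral>x. f x \<partial>m) - (\<integral>x. f x \<partial>equidist (Fix A n))))
            \<le> ereal c * lip_norm window1 \<theta> A f * ereal (exp (- \<delta> * real n)))"
      by (rule exponential_equidistribution[OF M])
  next
    fix m :: "(int \<Rightarrow> nat) measure"
    assume "max_entropy_measure (shift_top window2 \<theta> A) left_shift m"
    then interpret sft_mme window2 nat "\<lambda>n i. nat (i mod int n)" s A l r \<theta> m
      by (intro sft_mme.intro sft.intro sft_mme_axioms.intro shift_index_int chain ax)
    show "\<exists>c>0. \<exists>\<delta>>0. \<forall>f. lipschitz_fun window2 \<theta> A f \<longrightarrow> (\<forall>n\<ge>1.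
          ereal (cmod ((\<integral>x. f x \<partial>m) - (\<integral>x. f x \<partial>equidist (Fix A n))))
            \<le> ereal c * lip_norm window2 \<theta> A f * ereal (exp (- \<delta> * real n)))"
      by (rule exponential_equidistribution[OF M])
  qed
qed

end
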